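(* The mapping $\Phi_0$ is a bijection between $\widetilde{\mathcal B}_0$ and the set of weighted mobiles of excess zero.
   Context: A map is a connected finite graph (loops and multiple edges allowed) embedded in the oriented sphere up to orientation-preserving homeomorphism; corners are angular sectors between consecutive half-edges around a vertex. A biorientation assigns to each half-edge a direction, ingoing (toward its vertex) or outgoing; an edge is $i$-way if exactly $i$ of its half-edges are ingoing. Directed paths follow 2-way edges or 1-way edges toward their ingoing half-edge; a circuit is a simple closed directed path. Relative to a chosen face $f$, a circuit is counterclockwise if $f$ is on its right, and the biorientation is minimal with respect to $f$ if it has no counterclockwise circuit. A weighted biorientation gives each half-edge a real weight. A source-biorientation is a biorientation with a marked vertex $v_0$ (root-vertex), accessible from $v_0$ (every vertex reachable from $v_0$ by a directed path), and such that all half-edges incident to $v_0$ are outgoing. $\widetilde{\mathcal B}_0$ is the set of weighted source-biorientations that are minimal with respect to some face incident to the root-vertex. A weighted mobile is a plane tree with vertices colored black or white (not necessarily properly), black vertices possibly carrying dangling half-edges (buds), with a real weight on each non-bud half-edge; its excess is the number of black-white edges plus twice the number of white-white edges minus the number of buds. Local transformations (a black vertex $b_g$ placed in each face $g$): for an edge $e$ with half-edges $h$ at $v$ and $h'$ at $v'$ of weights $w,w'$, with $c,c'$ the corners preceding $h,h'$ in clockwise order around $v,v'$, lying in faces $f,f'$: if $e$ is 1-way with $h$ ingoing, create an edge $b_f$–$v$ in corner $c$ (weight $w$ at $v$, $w'$ at $b_f$), attach a bud to $b_{f'}$ toward $c'$, delete $e$; if 0-way, create an edge $b_f$–$b_{f'}$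 (weight $w'$ at $b_f$, $w$ at $b_{f'}$), delete $e$; if 2-way, attach buds to $b_f$ and $b_{f'}$ toward $c$ and $c'$ and keep $e$. For $B\in\widetilde{\mathcal B}_0$ with root-vertex $v_0$ (vertices of $B$ colored white), $\Phi_0(B)$ is obtained by performing the local transformation of every edge and then deleting $v_0$.
   Formalization: Maps and mobiles are required to have at least one edge: the mobile consisting of a single white vertex has excess zero but no preimage, so the claim fails for it; the trivial pair (vertex map, single black vertex) is excluded as well. *)

theory Defs
  imports Complex_Main
begin

section \<open>Combinatorial encoding of maps (rotation systems)\<close>

text \<open>A map is encoded by its set of half-edges (darts), a fixed-point-free
involution alpha pairing the two half-edges of each edge, and a permutation
sigma giving, for each half-edge h, the next half-edge in CLOCKWISE order
around its vertex.  Vertices are sigma-orbits, faces are (sigma o alpha)-orbits.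
The corner preceding h in clockwise order around its vertex (between
sigma^-1 h and h) is identified with h; it lies in the face containing h.
Walking along h away from its vertex, the face of h is on the left and the
face of alpha h is on the right.\<close>

definition orb :: "('a \<Rightarrow> 'a) \<Rightarrow> 'a \<Rightarrow> 'a set" where
  "orb f x = {(f ^^ n) x | n. True}"

record 'h prem =
  darts :: "'h set"
  alpha :: "'h \<Rightarrow> 'h"
  sigma :: "'h \<Rightarrow> 'h"

definition vertex :: "('h, 'z) prem_scheme \<Rightarrow> 'h \<Rightarrow> 'h set" where
  "vertex M d = orb (sigma M) d"

definition face :: "('h, 'z) prem_scheme \<Rightarrow> 'h \<Rightarrow> 'h set" where
  "face M d = orb (sigma M \<circ> alpha M) d"

definition connected_prem :: "('h, 'z) prem_scheme \<Rightarrow> bool" where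
  "connected_prem M \<longleftrightarrow> (\<forall>x\<in>darts M. \<forall>y\<in>darts M.
     (x, y) \<in> {(d, e). d \<in> darts M \<and> (e = alpha M d \<or> e = sigma M d)}\<^sup>*)"

text \<open>Plane map (genus 0, connected, at least one edge).\<close>
definition is_planemap :: "('h, 'z) prem_scheme \<Rightarrow> bool" where
  "is_planemap M \<longleftrightarrow>
     finite (darts M) \<and> darts M \<noteq> {} \<and>
     bij_betw (alpha M) (darts M) (darts M) \<and>
     (\<forall>d\<in>darts M. alpha M (alpha M d) = d \<and> alpha M d \<noteq> d) \<and>
     bij_betw (sigma M) (darts M) (darts M) \<and>
     connected_prem M \<and>
     int (card (vertex M ` darts M)) - int (card (darts M) div 2)
       + int (card (face M ` darts M)) = 2"

section \<open>Weighted biorientations\<close>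

text \<open>ingoing h: half-edge h is directed toward its vertex. root: some half-edge
incident to the root-vertex v0 (only its vertex matters).\<close>
record 'h wbiori = "'h prem" +
  ingoing :: "'h \<Rightarrow> bool"
  weight :: "'h \<Rightarrow> real"
  root :: 'h

text \<open>One step of directed reachability on half-edges: stay at the same vertex,
or traverse the edge of x from the vertex of x to the vertex of alpha x, allowed
iff alpha x is ingoing (1-way toward its ingoing half-edge, or 2-way).\<close>
definition acc_rel :: "('h, 'z) wbiori_scheme \<Rightarrow> ('h \<times> 'h) set" where
  "acc_rel B = {(x, y). x \<in> darts B \<and> y \<in> darts B \<and>
      (y \<in> vertex B x \<or> (y = alpha B x \<and> ingoing B y))}"

text \<open>A circuit: list of half-edges d_1..d_k, d_i traversed from its vertex to
the vertex of alpha d_i, each step directed, visiting pairwise distinct vertices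
and using pairwise distinct edges, and closing up.\<close>
definition is_circuit :: "('h, 'z) wbiori_scheme \<Rightarrow> 'h list \<Rightarrow> bool" where
  "is_circuit B cs \<longleftrightarrow>
     cs \<noteq> [] \<and> set cs \<subseteq> darts B \<and>
     distinct (map (vertex B) cs) \<and>
     (\<forall>x\<in>set cs. alpha B x \<notin> set cs) \<and>
     (\<forall>i<length cs. ingoing B (alpha B (cs ! i)) \<and>
        cs ! (Suc i mod length cs) \<in> vertex B (alpha B (cs ! i)))"

text \<open>Adjacency of faces across edges not on the circuit.\<close>
definition dual_rel :: "('h, 'z) wbiori_scheme \<Rightarrow> 'h list \<Rightarrow> ('h \<times> 'h) set" where
  "dual_rel B cs = {(x, y). x \<in> darts B \<and> y \<in> darts B \<and>
      (y \<in> face B x \<or> (y = alpha B x \<and> x \<notin> set cs \<and> y \<notin> set cs))}"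

text \<open>Face f (a set of half-edges, i.e. a face orbit) lies on the right of the
circuit: it is in the region of the sphere minus the circuit that contains the
face on the right of the first half-edge of the circuit.\<close>
definition ccw_wrt :: "('h, 'z) wbiori_scheme \<Rightarrow> 'h set \<Rightarrow> 'h list \<Rightarrow> bool" where
  "ccw_wrt B f cs \<longleftrightarrow> (\<exists>x\<in>f. (alpha B (hd cs), x) \<in> (dual_rel B cs)\<^sup>*)"

definition minimal_wrt :: "('h, 'z) wbiori_scheme \<Rightarrow> 'h set \<Rightarrow> bool" where
  "minimal_wrt B f \<longleftrightarrow> \<not> (\<exists>cs. is_circuit B cs \<and> ccw_wrt B f cs)"

text \<open>The class B0-tilde.\<close>
definition inB0 :: "('h, 'z) wbiori_scheme \<Rightarrow> bool" where
  "inB0 B \<longleftrightarrow>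
     is_planemap B \<and> root B \<in> darts B \<and>
     (\<forall>d\<in>vertex B (root B). \<not> ingoing B d) \<and>
     (\<forall>d\<in>darts B. (root B, d) \<in> (acc_rel B)\<^sup>*) \<and>
     (\<exists>d\<in>vertex B (root B). minimal_wrt B (face B d))"

definition biori_iso :: "('a, 'z) wbiori_scheme \<Rightarrow> ('b, 'y) wbiori_scheme \<Rightarrow> bool" where
  "biori_iso B B' \<longleftrightarrow> (\<exists>\<psi>. bij_betw \<psi> (darts B) (darts B') \<and>
     (\<forall>d\<in>darts B. \<psi> (alpha B d) = alpha B' (\<psi> d) \<and> \<psi> (sigma B d) = sigma B' (\<psi> d) \<and>
        ingoing B' (\<psi> d) = ingoing B d \<and> weight B' (\<psi> d) = weight B d) \<and>
     \<psi> (root B) \<in> vertex B' (root B'))"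

section \<open>Weighted mobiles\<close>

text \<open>Buds are the half-edges fixed by alpha. black d: the vertex of d is black.\<close>
record 'h mobile = "'h prem" +
  black :: "'h \<Rightarrow> bool"
  mweight :: "'h \<Rightarrow> real"

definition is_mobile :: "('h, 'z) mobile_scheme \<Rightarrow> bool" where
  "is_mobile M \<longleftrightarrow>
     finite (darts M) \<and>
     bij_betw (alpha M) (darts M) (darts M) \<and>
     (\<forall>d\<in>darts M. alpha M (alpha M d) = d) \<and>
     bij_betw (sigma M) (darts M) (darts M) \<and>
     (\<forall>d\<in>darts M. black M (sigma M d) = black M d) \<and>
     (\<forall>d\<in>darts M. alpha M d = d \<longrightarrow> black M d) \<and>
     (\<exists>d\<in>darts M. alpha M d \<noteq> d) \<and>
     connected_prem M \<and>
     card (vertex M ` darts M) = card {d\<in>darts M. alpha M d \<noteq> d} div 2 + 1"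

definition excess :: "('h, 'z) mobile_scheme \<Rightarrow> int" where
  "excess M =
     int (card {d\<in>darts M. alpha M d \<noteq> d \<and> black M d \<and> \<not> black M (alpha M d)})
   + int (card {d\<in>darts M. alpha M d \<noteq> d \<and> \<not> black M d \<and> \<not> black M (alpha M d)})
   - int (card {d\<in>darts M. alpha M d = d})"

definition mobile_iso :: "('a, 'z) mobile_scheme \<Rightarrow> ('b, 'y) mobile_scheme \<Rightarrow> bool" where
  "mobile_iso M M' \<longleftrightarrow> (\<exists>\<psi>. bij_betw \<psi> (darts M) (darts M') \<and>
     (\<forall>d\<in>darts M. \<psi> (alpha M d) = alpha M' (\<psi> d) \<and> \<psi> (sigma M d) = sigma M' (\<psi> d) \<and>
        black M' (\<psi> d) = black M d \<and>
        (alpha M d \<noteq> d \<longrightarrow> mweight M' (\<psi> d) = mweight M d)))"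

section \<open>The mapping Phi0\<close>

text \<open>Half-edges of Phi0(B): Bl h is the half-edge at the black vertex b_f of the
face f containing the corner at h, created by the local transformation of the
edge of h on the side of h (edge to the white vertex of h if the edge is 1-way
with h ingoing; edge to b_f' if 0-way; a bud toward corner h otherwise).
Wh h (for h ingoing) is the half-edge at the (white) vertex of h: the kept
half-edge h if the edge is 2-way, or the new edge b_f--v in corner h if 1-way.
Half-edges at v0 are all outgoing, so no half-edge of the mobile sits at v0
(v0 is deleted).\<close>
datatype 'h mdart = Bl 'h | Wh 'h

definition nextIn :: "('h \<Rightarrow> 'h) \<Rightarrow> ('h \<Rightarrow> bool) \<Rightarrow> 'h \<Rightarrow> 'h" where
  "nextIn s ing h = (s ^^ (LEAST k. k > 0 \<and> ing ((s ^^ k) h))) h"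

definition Phi0 :: "('h, 'z) wbiori_scheme \<Rightarrow> 'h mdart mobile" where
  "Phi0 B = \<lparr> darts = Bl ` darts B \<union> Wh ` {h\<in>darts B. ingoing B h},
     alpha = (\<lambda>x. case x of
        Bl h \<Rightarrow> (if ingoing B (alpha B h) then Bl h
                 else if ingoing B h then Wh h else Bl (alpha B h))
      | Wh h \<Rightarrow> (if ingoing B (alpha B h) then Wh (alpha B h) else Bl h)),
     sigma = (\<lambda>x. case x of
        Bl h \<Rightarrow> Bl (alpha B (inv_into (darts B) (sigma B) h))
      | Wh h \<Rightarrow> Wh (nextIn (sigma B) (ingoing B) h)),
     black = (\<lambda>x. case x of Bl _ \<Rightarrow> True | Wh _ \<Rightarrow> False),
     mweight = (\<lambda>x. case x of Bl h \<Rightarrow> weight B (alpha B h) | Wh h \<Rightarrow> weight B h) \<rparr>"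

end

theory Submission
  imports Defs
begin

text \<open>
  Reading the buds and the white half-edges of \<open>Phi0 B\<close> as closing and opening parentheses along its
  contour, the bud at \<open>h\<close> closes the parenthesis opened by \<open>Wh (alpha B h)\<close>.  The contour is a depth-first
  search of the forest which attaches each ingoing half-edge \<open>c\<close> to its parent, the first ingoing half-edge
  counterclockwise from \<open>alpha B c\<close>; hence \<open>Phi0 B\<close> is connected, and the parenthesis matching can be read
  off it, as soon as the parent relation has no cycle.  The matching determines \<open>B\<close>, which gives
  injectivity, and matching the parentheses of a mobile of excess zero closes it to a biorientation.

  A cycle of parents would be a closed directed walk that can be entered from its right only.  It is a
  sum of circuits, so if none of them is counterclockwise the face potential of the walk is at most its
  value \<open>0\<close> around the root-vertex; but the potential jumps to \<open>1\<close> where a directed path from the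
  root-vertex first reaches the walk.  Conversely, on the left of a counterclockwise circuit the iterated
  parents stay on the left and never reach the root-vertex.

  All topology comes from counting edge sets modulo 2: face boundaries are cycles, and there are
  \<open>2 ^ (F - 1)\<close> boundaries and at most \<open>2 ^ (E - V + 1)\<close> cycles.  So \<open>V - E + F \<le> 2\<close> for every connected
  rotation system, with all cycles being boundaries in case of equality.
\<close>

section \<open>Orbits of permutations of finite sets\<close>

text \<open>One count serves both directions. Each edge leaves exactly one edge in the mobile, black
  vertices are the faces, and white vertices are the vertices with an ingoing half-edge. So V - E +
  F = 2 loses one vertex, the root-vertex, and becomes the relation of a tree; conversely the tree
  relation and the existence of one source force genus zero and the uniqueness of that source. The
  excess vanishes because an ingoing half-edge \<open>h\<close> yields one white half-edge and one
  bud, at \<open>alpha B h\<close>. The count does not see connectedness of the image, accessibility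
  or minimality. All three hinge on the parent relation: for a source-biorientation its acyclicity
  is extracted from minimality, for a closed mobile it comes from the lengths of contour runs, and
  it is the hypothesis under which both sides meet.\<close>

lemma orb_refl [simp]: "x \<in> orb f x"
  unfolding orb_def by (auto intro: exI[of _ 0])

lemma orb_step: "y \<in> orb f x \<Longrightarrow> f y \<in> orb f x"
  unfolding orb_def by (auto intro: exI[of _ "Suc _"])

lemma funpow_in_orb: "(f ^^ n) x \<in> orb f x"
  unfolding orb_def by auto

lemma orb_induct [consumes 1, case_names base step]:
  assumes "y \<in> orb f x" "P x" "\<And>z. z \<in> orb f x \<Longrightarrow> P z \<Longrightarrow> P (f z)"
  shows "P y"
proof -
  have "P ((f ^^ n) x)" for n
    by (induction n) (auto simp: assms funpow_in_orb)
  then show ?thesis using assms(1) unfolding orb_def by auto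
qed

lemma orb_trans:
  assumes "y \<in> orb f x" "z \<in> orb f y"
  shows "z \<in> orb f x"
  using assms(2) by (induction z rule: orb_induct) (simp_all add: assms(1) orb_step)

context
  fixes f :: "'a \<Rightarrow> 'a" and D
  assumes fin: "finite D" and bij: "bij_betw f D D"
begin

lemma bij_closed: "x \<in> D \<Longrightarrow> f x \<in> D"
  using bij by (auto simp: bij_betw_def)

lemma orb_subset: "x \<in> D \<Longrightarrow> orb f x \<subseteq> D"
proof
  fix y assume "y \<in> orb f x" "x \<in> D"
  then show "y \<in> D" by (induction rule: orb_induct) (auto intro: bij_closed)
qed

lemma finite_orb: "x \<in> D \<Longrightarrow> finite (orb f x)"
  using orb_subset fin finite_subset by blast

lemma orb_inj: "x \<in> D \<Longrightarrow> inj_on f (orb f x)"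
  using bij orb_subset inj_on_subset unfolding bij_betw_def by metis

lemma orb_image: assumes "x \<in> D" shows "f ` orb f x = orb f x"
proof (rule endo_inj_surj)
  show "f ` orb f x \<subseteq> orb f x" by (rule image_subsetI) (rule orb_step)
qed (simp_all add: assms finite_orb orb_inj)

lemma orb_bij: "x \<in> D \<Longrightarrow> bij_betw f (orb f x) (orb f x)"
  unfolding bij_betw_def by (simp add: orb_image orb_inj)

lemma in_orb_succ: assumes "x \<in> D" shows "x \<in> orb f (f x)"
proof -
  have "y \<in> orb f x \<Longrightarrow> f y \<in> orb f (f x)" for y
    by (induction rule: orb_induct) (simp_all add: orb_step)
  moreover obtain y where "y \<in> orb f x" "f y = x"
    using orb_image[OF assms] orb_refl[of x f] by (metis imageE)
  ultimately show ?thesis by blast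
qed

lemma orb_sym:
  assumes "x \<in> D" "y \<in> orb f x"
  shows "x \<in> orb f y"
  using assms(2)
proof (induction y rule: orb_induct)
  case (step z)
  then have "z \<in> D" using orb_subset[OF assms(1)] by blast
  then show ?case using in_orb_succ orb_trans[OF _ step.IH] by blast
qed simp

lemma orb_eq:
  assumes "x \<in> D" "y \<in> orb f x"
  shows "orb f y = orb f x"
proof
  show "orb f y \<subseteq> orb f x" using orb_trans[OF assms(2)] by (rule subsetI)
  show "orb f x \<subseteq> orb f y" using orb_trans[OF orb_sym[OF assms]] by (rule subsetI)
qed

lemma orb_succ [simp]: "x \<in> D \<Longrightarrow> orb f (f x) = orb f x"
  by (rule orb_eq) (simp_all add: orb_step)

lemma bij_pre: "x \<in> D \<Longrightarrow> \<exists>y\<in>D. f y = x"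
  using bij unfolding bij_betw_def by (metis imageE)

lemma bij_inj: "x \<in> D \<Longrightarrow> y \<in> D \<Longrightarrow> f x = f y \<Longrightarrow> x = y"
  using bij unfolding bij_betw_def inj_on_def by blast

lemma orb_inv:
  "y \<in> orb f x \<Longrightarrow> x \<in> D \<Longrightarrow> (\<And>d. d \<in> D \<Longrightarrow> P (f d) = P d) \<Longrightarrow> P y = P x"
proof (induction rule: orb_induct)
  case (step z)
  then have "z \<in> D" using orb_subset by blast
  then show ?case using step by simp
qed simp

end

lemma odd_card_sym_diff:
  assumes "finite A" "finite B"
  shows "odd (card (sym_diff A B)) \<longleftrightarrow> odd (card A) \<noteq> odd (card B)"
proof -
  have "card A = card (A - B) + card (A \<inter> B)" "card B = card (B - A) + card (A \<inter> B)"
    using card_Int_Diff[OF assms(1), of B] card_Int_Diff[OF assms(2), of A] by (simp_all add: Int_commute)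
  moreover have "card (sym_diff A B) = card (A - B) + card (B - A)"
    using assms by (intro card_Un_disjoint) auto
  ultimately show ?thesis by simp presburger
qed

text \<open>Along each cycle of \<open>s\<close>, \<open>P\<close> switches on as often as off:
  \<open>s\<close> carries the points followed by a true value onto those with a true value, and the
  changes are the symmetric difference of these two sets of equal size.\<close>

lemma even_card_changes:
  fixes P :: "'a \<Rightarrow> bool"
  assumes "finite v" "bij_betw s v v"
  shows "even (card {d\<in>v. P d \<noteq> P (s d)})"
proof -
  have im: "s ` v = v" using assms(2) unfolding bij_betw_def by simp
  have "s ` {d\<in>v. P (s d)} = {d\<in>v. P d}"
  proof (intro set_eqI iffI)
    fix y assume "y \<in> {d\<in>v. P d}"
    moreover obtain x where "x \<in> v" "y = s x" using calculation im by (metis (no_types, lifting) imageE mem_Collect_eq)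
    ultimately show "y \<in> s ` {d\<in>v. P (s d)}" by simp
  next
    fix y assume "y \<in> s ` {d\<in>v. P (s d)}"
    then obtain x where "x \<in> v" "P (s x)" "y = s x" by blast
    then show "y \<in> {d\<in>v. P d}" using imageI[of x v s] im by simp
  qed
  moreover have "inj_on s {d\<in>v. P (s d)}"
    using assms(2) unfolding bij_betw_def by (elim conjE inj_on_subset) simp
  ultimately have "bij_betw s {d\<in>v. P (s d)} {d\<in>v. P d}" unfolding bij_betw_def by simp
  then have "card {d\<in>v. P (s d)} = card {d\<in>v. P d}" by (rule bij_betw_same_card)
  moreover have "{d\<in>v. P d \<noteq> P (s d)} = sym_diff {d\<in>v. P d} {d\<in>v. P (s d)}" by auto
  ultimately show ?thesis using odd_card_sym_diff[of "{d\<in>v. P d}" "{d\<in>v. P (s d)}"] assms(1)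
    by simp
qed

section \<open>Rotation systems and the Euler inequality\<close>

text \<open>\<open>alpha\<close> may have fixed points, so that maps and mobiles with their buds are
  treated together. Neither connectedness nor an Euler relation is assumed: both have to be proved
  for images and closures.\<close>

locale rotsys =
  fixes M :: "('h, 'z) prem_scheme"
  assumes finite_darts: "finite (darts M)"
    and alpha_closed: "d \<in> darts M \<Longrightarrow> alpha M d \<in> darts M"
    and alpha_alpha: "d \<in> darts M \<Longrightarrow> alpha M (alpha M d) = d"
    and sigma_bij: "bij_betw (sigma M) (darts M) (darts M)"
begin

lemma alpha_bij: "bij_betw (alpha M) (darts M) (darts M)"
  by (rule bij_betw_byWitness[where f'="alpha M"]) (auto simp: alpha_closed alpha_alpha)

lemma phi_bij: "bij_betw (sigma M \<circ> alpha M) (darts M) (darts M)"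
  using alpha_bij sigma_bij by (rule bij_betw_trans)

lemmas sigma_closed = bij_closed[OF finite_darts sigma_bij]
lemmas sigma_pre = bij_pre[OF finite_darts sigma_bij]
lemmas sigma_inj = bij_inj[OF finite_darts sigma_bij]

lemma alpha_inj: "x \<in> darts M \<Longrightarrow> y \<in> darts M \<Longrightarrow> alpha M x = alpha M y \<Longrightarrow> x = y"
  using alpha_alpha by metis

lemma vertex_self [simp]: "d \<in> vertex M d" by (simp add: vertex_def)
lemma face_self [simp]: "d \<in> face M d" by (simp add: face_def)
lemma vertex_sub: "d \<in> darts M \<Longrightarrow> vertex M d \<subseteq> darts M"
  unfolding vertex_def by (rule orb_subset[OF finite_darts sigma_bij])
lemma face_sub: "d \<in> darts M \<Longrightarrow> face M d \<subseteq> darts M"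
  unfolding face_def by (rule orb_subset[OF finite_darts phi_bij])
lemma vertex_sigma [simp]: "d \<in> darts M \<Longrightarrow> vertex M (sigma M d) = vertex M d"
  unfolding vertex_def using orb_succ[OF finite_darts sigma_bij] by blast
lemma face_sigma: "d \<in> darts M \<Longrightarrow> face M (sigma M d) = face M (alpha M d)"
  unfolding face_def using orb_succ[OF finite_darts phi_bij, of "alpha M d"]
  by (simp add: alpha_closed alpha_alpha)
lemma vertex_eq: "d \<in> darts M \<Longrightarrow> e \<in> vertex M d \<Longrightarrow> vertex M e = vertex M d"
  unfolding vertex_def using orb_eq[OF finite_darts sigma_bij] by blast
lemma vertex_eq_iff: "d \<in> darts M \<Longrightarrow> vertex M e = vertex M d \<longleftrightarrow> e \<in> vertex M d"
  using vertex_eq vertex_self by metis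
lemma face_eq: "d \<in> darts M \<Longrightarrow> e \<in> face M d \<Longrightarrow> face M e = face M d"
  unfolding face_def using orb_eq[OF finite_darts phi_bij] by blast
lemma vertex_finite: "d \<in> darts M \<Longrightarrow> finite (vertex M d)"
  using vertex_sub finite_darts finite_subset by blast

lemma face_inv:
  "e \<in> face M d \<Longrightarrow> d \<in> darts M \<Longrightarrow> (\<And>d. d \<in> darts M \<Longrightarrow> P (sigma M (alpha M d)) = P d) \<Longrightarrow> P e = P d"
  unfolding face_def by (rule orb_inv[OF finite_darts phi_bij]) auto

definition conn_rel :: "('h \<times> 'h) set" where
  "conn_rel = {(d, e). d \<in> darts M \<and> (e = alpha M d \<or> e = sigma M d)}"

lemma conn_sigma: "d \<in> darts M \<Longrightarrow> (d, sigma M d) \<in> conn_rel\<^sup>*"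
  and conn_alpha: "d \<in> darts M \<Longrightarrow> (d, alpha M d) \<in> conn_rel\<^sup>*"
  unfolding conn_rel_def by auto

lemma conn_vertex: "e \<in> vertex M d \<Longrightarrow> d \<in> darts M \<Longrightarrow> (d, e) \<in> conn_rel\<^sup>*"
  unfolding vertex_def
proof (induction rule: orb_induct)
  case (step z)
  then have "z \<in> darts M" using orb_subset[OF finite_darts sigma_bij] by blast
  then show ?case using conn_sigma step by (meson rtrancl_trans)
qed simp

lemma conn_sym: "(x, y) \<in> conn_rel\<^sup>* \<Longrightarrow> (y, x) \<in> conn_rel\<^sup>*"
proof (induction rule: rtrancl_induct)
  case (step y z)
  have y: "y \<in> darts M" using step unfolding conn_rel_def by auto
  have "(z, y) \<in> conn_rel\<^sup>*"
  proof (cases "z = alpha M y")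
    case True
    then show ?thesis using conn_alpha[of z] y by (simp add: alpha_closed alpha_alpha)
  next
    case False
    then have "z = sigma M y" using step unfolding conn_rel_def by auto
    moreover from this have "y \<in> vertex M z" using y by simp
    ultimately show ?thesis using conn_vertex sigma_closed y by blast
  qed
  then show ?case using step.IH by (rule rtrancl_trans)
qed simp

lemma connected_iff: "connected_prem M \<longleftrightarrow> (\<forall>x\<in>darts M. \<forall>y\<in>darts M. (x, y) \<in> conn_rel\<^sup>*)"
  unfolding connected_prem_def conn_rel_def ..

lemma connected_induct [consumes 3, case_names base alpha sigma]:
  assumes "connected_prem M" "x \<in> darts M" "y \<in> darts M" "P x"
    and "\<And>d. d \<in> darts M \<Longrightarrow> P d \<Longrightarrow> P (alpha M d)"
    and "\<And>d. d \<in> darts M \<Longrightarrow> P d \<Longrightarrow> P (sigma M d)"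
  shows "P y"
proof -
  have "(x, y) \<in> conn_rel\<^sup>*" using assms connected_iff by blast
  then show ?thesis
    by (induction rule: rtrancl_induct) (use assms in \<open>auto simp: conn_rel_def\<close>)
qed

section \<open>Edge sets, cycles and boundaries modulo 2\<close>

definition edge_sets :: "'h set set" where
  "edge_sets = {S. S \<subseteq> {d\<in>darts M. alpha M d \<noteq> d} \<and> alpha M ` S \<subseteq> S}"

text \<open>The boundary map over the two-element field, with \<open>sym_diff\<close> as addition.
  Edge sets contain both half-edges of an edge, so a loop contributes nothing at its vertex.\<close>

definition odd_vertices :: "'h set \<Rightarrow> 'h set set" where
  "odd_vertices S = {v \<in> vertex M ` darts M. odd (card (v \<inter> S))}"

definition cycle_space :: "'h set set" where
  "cycle_space = {S \<in> edge_sets. odd_vertices S = {}}"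

text \<open>A coboundary in the dual graph, whose vertices are the faces; in the map itself it is
  the boundary of the union of the faces in \<open>A\<close>.\<close>

definition coboundary :: "'h set set \<Rightarrow> 'h set" where
  "coboundary A = {d\<in>darts M. (face M d \<in> A) \<noteq> (face M (alpha M d) \<in> A)}"

lemma odd_vertices_sym_diff:
  assumes "S \<in> edge_sets" "T \<in> edge_sets"
  shows "odd_vertices (sym_diff S T) = sym_diff (odd_vertices S) (odd_vertices T)"
proof -
  have f: "finite S" "finite T" using assms finite_darts unfolding edge_sets_def
    by (auto intro: finite_subset)
  have "odd (card (v \<inter> sym_diff S T)) = (odd (card (v \<inter> S)) \<noteq> odd (card (v \<inter> T)))" for v
  proof -
    have "v \<inter> sym_diff S T = sym_diff (v \<inter> S) (v \<inter> T)" by auto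
    then show ?thesis using odd_card_sym_diff[of "v \<inter> S" "v \<inter> T"] f by simp
  qed
  then show ?thesis unfolding odd_vertices_def by blast
qed

lemma edge_sets_sym_diff:
  assumes "S \<in> edge_sets" "T \<in> edge_sets"
  shows "sym_diff S T \<in> edge_sets"
proof -
  have inv: "d \<in> darts M \<and> alpha M d \<noteq> d \<and> alpha M d \<in> U" if "U \<in> edge_sets" "d \<in> U" for U d
    using that unfolding edge_sets_def by auto
  have not: "alpha M d \<notin> U" if "U \<in> edge_sets" "d \<notin> U" "d \<in> darts M" for U d
    using inv[of U "alpha M d"] that alpha_alpha[of d] by auto
  show ?thesis unfolding edge_sets_def using inv[OF assms(1)] inv[OF assms(2)] not[OF assms(1)] not[OF assms(2)]
    by blast
qed

text \<open>An edge set is the union of the pairs \<open>{d, alpha M d}\<close> inside it, and these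
  pairs partition the non-buds; so there are at most as many edge sets as sets of pairs.\<close>

lemma card_edge_sets: "card edge_sets \<le> 2 ^ (card {d\<in>darts M. alpha M d \<noteq> d} div 2)"
proof -
  let ?N = "{d\<in>darts M. alpha M d \<noteq> d}"
  let ?e = "\<lambda>d. {d, alpha M d}"
  have fN: "finite ?N" using finite_darts by simp
  have aN: "d \<in> ?N \<Longrightarrow> alpha M d \<in> ?N" for d by (auto simp: alpha_closed alpha_alpha)
  have U: "\<Union> (?e ` S) = S" if "S \<in> edge_sets" for S
    using that unfolding edge_sets_def by auto
  have "2 * card (?e ` ?N) = card (\<Union> (?e ` ?N))"
  proof (rule card_partition)
    show "\<And>c. c \<in> ?e ` ?N \<Longrightarrow> card c = 2" by auto
    fix c1 c2 assume c: "c1 \<in> ?e ` ?N" "c2 \<in> ?e ` ?N" "c1 \<noteq> c2"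
    have *: "?e x = ?e y" if "x \<in> ?N" "y \<in> ?N" "z \<in> ?e x" "z \<in> ?e y" for x y z
    proof -
      have "?e z = ?e w" if "w \<in> ?N" "z \<in> ?e w" for w using that by (auto simp: alpha_alpha)
      then have "?e z = ?e x" "?e z = ?e y" using that by blast+
      then show ?thesis by simp
    qed
    show "c1 \<inter> c2 = {}"
    proof (rule ccontr)
      assume "c1 \<inter> c2 \<noteq> {}"
      then obtain z where "z \<in> c1" "z \<in> c2" by blast
      then show False using c * by blast
    qed
  qed (use fN in auto)
  moreover have "\<Union> (?e ` ?N) = ?N" using aN by auto
  ultimately have c: "card (?e ` ?N) = card ?N div 2" by simp
  have "inj_on ((`) ?e) edge_sets" by (rule inj_onI) (metis U)
  moreover have "((`) ?e) ` edge_sets \<subseteq> Pow (?e ` ?N)" unfolding edge_sets_def by auto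
  ultimately have "card edge_sets \<le> card (Pow (?e ` ?N))"
    using fN by (intro card_inj_on_le) auto
  then show ?thesis using c fN by (simp add: card_Pow)
qed

lemma finite_edge_sets: "finite edge_sets"
  unfolding edge_sets_def using finite_darts by simp

text \<open>The edges of a path from \<open>d0\<close> to \<open>d\<close>, counted modulo 2: each
  step across an edge adds it and moves the end. Discounting the base vertex removes the exception
  of a closed path.\<close>

lemma exists_path_set:
  assumes "connected_prem M" "d0 \<in> darts M" "d \<in> darts M"
  shows "\<exists>S\<in>edge_sets. odd_vertices S - {vertex M d0} = {vertex M d} - {vertex M d0}"
  using assms
proof (induction rule: connected_induct)
  case base
  then show ?case by (intro bexI[of _ "{}"]) (auto simp: odd_vertices_def edge_sets_def)
next
  case (alpha d)
  then obtain S where S: "S \<in> edge_sets"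
    "odd_vertices S - {vertex M d0} = {vertex M d} - {vertex M d0}" by auto
  show ?case
  proof (cases "alpha M d = d")
    case False
    let ?E = "{d, alpha M d}"
    have E: "?E \<in> edge_sets" using alpha False unfolding edge_sets_def
      by (auto simp: alpha_closed alpha_alpha)
    have ad: "alpha M d \<in> darts M" using alpha alpha_closed by simp
    have mem: "e \<in> vertex M x \<longleftrightarrow> vertex M x = vertex M e" if "x \<in> darts M" for x e
      using vertex_eq_iff[OF that, of e] by auto
    have "odd (card (vertex M x \<inter> ?E)) = (vertex M x \<in> sym_diff {vertex M d} {vertex M (alpha M d)})"
      if x: "x \<in> darts M" for x
    proof -
      define P Q where "P = (vertex M x = vertex M d)" and "Q = (vertex M x = vertex M (alpha M d))"
      have "d \<in> vertex M x \<longleftrightarrow> P" "alpha M d \<in> vertex M x \<longleftrightarrow> Q"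
        unfolding P_def Q_def by (simp_all add: mem[OF x])
      then have "vertex M x \<inter> ?E = (if P then {d} else {}) \<union> (if Q then {alpha M d} else {})" by auto
      then have "odd (card (vertex M x \<inter> ?E)) = (P \<noteq> Q)" using False by simp
      then show ?thesis unfolding P_def Q_def by simp blast
    qed
    then have "odd_vertices ?E = vertex M ` darts M \<inter> sym_diff {vertex M d} {vertex M (alpha M d)}"
      unfolding odd_vertices_def Int_def by (intro Collect_cong conj_cong refl) (elim imageE, simp)
    also have "\<dots> = sym_diff {vertex M d} {vertex M (alpha M d)}"
      using alpha(1) ad by (intro Int_absorb1) auto
    finally have E': "odd_vertices ?E = sym_diff {vertex M d} {vertex M (alpha M d)}" .
    have "sym_diff A (sym_diff B C) - Z = C - Z" if "A - Z = B - Z" for A B C Z :: "'h set set"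
      using that by blast
    from this[OF S(2)]
    have "odd_vertices (sym_diff S ?E) - {vertex M d0} = {vertex M (alpha M d)} - {vertex M d0}"
      unfolding odd_vertices_sym_diff[OF S(1) E] E' .
    then show ?thesis using edge_sets_sym_diff[OF S(1) E] by blast
  qed (use S in auto)
next
  case (sigma d)
  then show ?case by simp
qed

text \<open>Sums of paths from the base vertex; the boundary map thus has rank at least V -
  1.\<close>

lemma exists_odd_set:
  assumes "connected_prem M" "d0 \<in> darts M" "T \<subseteq> vertex M ` darts M - {vertex M d0}"
  shows "\<exists>S\<in>edge_sets. odd_vertices S - {vertex M d0} = T"
proof -
  have "finite T" using assms finite_darts by (meson finite_Diff finite_imageI finite_subset)
  then show ?thesis using assms(3)
  proof induction
    case empty
    then show ?case by (intro bexI[of _ "{}"]) (auto simp: odd_vertices_def edge_sets_def)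
  next
    case (insert v T)
    obtain S where S: "S \<in> edge_sets" "odd_vertices S - {vertex M d0} = T"
      using insert by auto
    obtain d where d: "d \<in> darts M" "v = vertex M d" "v \<noteq> vertex M d0" using insert(4) by auto
    obtain S' where S': "S' \<in> edge_sets" "odd_vertices S' - {vertex M d0} = {v} - {vertex M d0}"
      using exists_path_set[OF assms(1,2) d(1)] d(2) by auto
    have "sym_diff A B - Z = insert v T" if "A - Z = T" "B - Z = {v} - Z" "v \<notin> Z" for A B Z
    proof -
      have "x \<in> A \<and> x \<notin> Z \<longleftrightarrow> x \<in> T" "x \<in> B \<and> x \<notin> Z \<longleftrightarrow> x = v" for x
        using that(1) eqset_imp_iff[OF that(2), of x] that(3) by auto
      then show ?thesis using insert(2) by (intro set_eqI) (simp, metis)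
    qed
    from this[OF S(2) S'(2)] have "odd_vertices (sym_diff S S') - {vertex M d0} = insert v T"
      unfolding odd_vertices_sym_diff[OF S(1) S'(1)] using d by simp
    then show ?case using edge_sets_sym_diff[OF S(1) S'(1)] by blast
  qed
qed

text \<open>Rank and nullity by counting: with one edge set \<open>g T\<close> chosen for each
  boundary \<open>T\<close>, the sums of a cycle and some \<open>g T\<close> are distinct, since the
  boundary recovers \<open>T\<close> and then the cycle.\<close>

lemma card_cycle_space:
  assumes "connected_prem M" "d0 \<in> darts M"
  shows "card cycle_space * 2 ^ (card (vertex M ` darts M) - 1) \<le> card edge_sets"
proof -
  let ?V = "vertex M ` darts M - {vertex M d0}"
  have "\<forall>T\<in>Pow ?V. \<exists>S. S \<in> edge_sets \<and> odd_vertices S - {vertex M d0} = T"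
  proof
    fix T assume "T \<in> Pow ?V"
    then have "T \<subseteq> ?V" by (rule PowD)
    from exists_odd_set[OF assms this]
    show "\<exists>S. S \<in> edge_sets \<and> odd_vertices S - {vertex M d0} = T" by (elim bexE) (intro exI conjI)
  qed
  then obtain g where g: "\<And>T. T \<in> Pow ?V \<Longrightarrow> g T \<in> edge_sets"
    "\<And>T. T \<in> Pow ?V \<Longrightarrow> odd_vertices (g T) - {vertex M d0} = T" by metis
  let ?h = "\<lambda>(Z, T). sym_diff Z (g T)"
  have "inj_on ?h (cycle_space \<times> Pow ?V)"
  proof (rule inj_onI)
    fix p p' assume pp: "p \<in> cycle_space \<times> Pow ?V" "p' \<in> cycle_space \<times> Pow ?V" "?h p = ?h p'"
    obtain Z T Z' T' where p: "p = (Z, T)" "p' = (Z', T')" by (metis surj_pair)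
    have *: "Z \<in> cycle_space" "T \<in> Pow ?V" "Z' \<in> cycle_space" "T' \<in> Pow ?V"
      "sym_diff Z (g T) = sym_diff Z' (g T')" using pp p by auto
    have "odd_vertices (sym_diff Y (g U)) = odd_vertices (g U)" if "Y \<in> cycle_space" "U \<in> Pow ?V" for Y U
      using that odd_vertices_sym_diff[OF _ g(1)[OF that(2)], of Y] unfolding cycle_space_def by simp
    from this[OF *(1,2)] this[OF *(3,4)] have gT: "odd_vertices (g T) = odd_vertices (g T')"
      unfolding *(5) by (rule trans[OF sym])
    have "T = odd_vertices (g T) - {vertex M d0}" by (rule g(2)[OF *(2), symmetric])
    also have "\<dots> = T'" unfolding gT by (rule g(2)[OF *(4)])
    finally have "T = T'" .
    have "A = B" if "sym_diff A C = sym_diff B C" for A B C :: "'h set"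
      using that unfolding set_eq_iff by (simp, metis)
    then have "Z = Z'" using *(5) unfolding \<open>T = T'\<close> .
    then show "p = p'" using p \<open>T = T'\<close> by simp
  qed
  moreover have "?h p \<in> edge_sets" if "p \<in> cycle_space \<times> Pow ?V" for p
  proof -
    obtain Z T where "p = (Z, T)" by (cases p)
    then show ?thesis using that edge_sets_sym_diff[of Z "g T"] g(1)[of T] unfolding cycle_space_def by simp
  qed
  then have "?h ` (cycle_space \<times> Pow ?V) \<subseteq> edge_sets" by (rule image_subsetI)
  with calculation have "card (cycle_space \<times> Pow ?V) \<le> card edge_sets"
    using finite_edge_sets by (rule card_inj_on_le)
  moreover have "card ?V = card (vertex M ` darts M) - 1"
    using assms finite_darts by (simp add: card_Diff_singleton)
  ultimately show ?thesis using finite_darts by (simp add: card_cartesian_product card_Pow)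
qed

text \<open>By \<open>face_sigma\<close> the two sides of the edge of \<open>d\<close> are the faces
  of \<open>d\<close> and of \<open>sigma M d\<close>; so around a vertex the coboundary marks the
  changes of membership in \<open>A\<close>, an even number.\<close>

lemma coboundary_cycle: "coboundary A \<in> cycle_space"
proof -
  have "coboundary A \<in> edge_sets"
    unfolding coboundary_def edge_sets_def by (auto simp: alpha_closed alpha_alpha)
  moreover have "even (card (vertex M x \<inter> coboundary A))" if x: "x \<in> darts M" for x
  proof -
    have "vertex M x \<inter> coboundary A
        = {d \<in> vertex M x. (face M d \<in> A) \<noteq> (face M (sigma M d) \<in> A)}"
      unfolding coboundary_def using vertex_sub[OF x] face_sigma by auto
    moreover have "bij_betw (sigma M) (vertex M x) (vertex M x)"
      unfolding vertex_def using orb_bij[OF finite_darts sigma_bij x] .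
    ultimately show ?thesis using even_card_changes[OF vertex_finite[OF x]] by auto
  qed
  ultimately show ?thesis unfolding cycle_space_def odd_vertices_def by auto
qed

text \<open>The coboundary tells how membership changes across every edge, hence by connectedness
  fixes \<open>A\<close> up to complement; omitting the face of \<open>d0\<close> removes this
  freedom.\<close>

lemma coboundary_inj:
  assumes "connected_prem M" "d0 \<in> darts M"
  shows "inj_on coboundary (Pow (face M ` darts M - {face M d0}))"
proof (rule inj_onI)
  fix A B
  assume A: "A \<in> Pow (face M ` darts M - {face M d0})" and B: "B \<in> Pow (face M ` darts M - {face M d0})"
    and eq: "coboundary A = coboundary B"
  let ?P = "\<lambda>d. (face M d \<in> A) = (face M d \<in> B)"
  have al: "?P (alpha M d) = ?P d" if "d \<in> darts M" for d
    using eq that unfolding coboundary_def by blast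
  have "?P d" if "d \<in> darts M" for d
    using assms(1,2) that
  proof (induction rule: connected_induct)
    case base then show ?case using A B by auto
  next
    case alpha then show ?case using al by simp
  next
    case sigma then show ?case using al face_sigma by simp
  qed
  then show "A = B" using A B by blast
qed

lemma face_sets_le_cycle_space:
  assumes "connected_prem M" "d0 \<in> darts M"
  shows "2 ^ (card (face M ` darts M) - 1) \<le> card cycle_space"
    and "card cycle_space = 2 ^ (card (face M ` darts M) - 1) \<Longrightarrow> S \<in> cycle_space \<Longrightarrow>
      \<exists>A. S = coboundary A"
proof -
  let ?F = "face M ` darts M - {face M d0}"
  have cF: "card (coboundary ` Pow ?F) = 2 ^ (card (face M ` darts M) - 1)"
    using card_image[OF coboundary_inj[OF assms]] assms finite_darts
    by (simp add: card_Pow card_Diff_singleton)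
  have sub: "coboundary ` Pow ?F \<subseteq> cycle_space" using coboundary_cycle by auto
  have fin: "finite cycle_space" using finite_edge_sets unfolding cycle_space_def by simp
  show "2 ^ (card (face M ` darts M) - 1) \<le> card cycle_space"
    using card_mono[OF fin sub] cF by simp
  assume "card cycle_space = 2 ^ (card (face M ` darts M) - 1)" "S \<in> cycle_space"
  then have "coboundary ` Pow ?F = cycle_space" using card_seteq[OF fin sub] cF by simp
  then show "\<exists>A. S = coboundary A" using \<open>S \<in> cycle_space\<close> by blast
qed

theorem euler_le:
  assumes "connected_prem M" "darts M \<noteq> {}"
  shows "card (vertex M ` darts M) + card (face M ` darts M)
    \<le> card {d\<in>darts M. alpha M d \<noteq> d} div 2 + 2"
proof -
  obtain d0 where d0: "d0 \<in> darts M" using assms by auto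
  let ?V = "card (vertex M ` darts M)" and ?F = "card (face M ` darts M)"
    and ?E = "card {d\<in>darts M. alpha M d \<noteq> d} div 2"
  have "(2::nat) ^ (?F - 1) * 2 ^ (?V - 1) \<le> card cycle_space * 2 ^ (?V - 1)"
    using face_sets_le_cycle_space(1)[OF assms(1) d0] by simp
  also have "\<dots> \<le> card edge_sets" by (rule card_cycle_space[OF assms(1) d0])
  also have "\<dots> \<le> 2 ^ ?E" by (rule card_edge_sets)
  finally have "(2::nat) ^ (?F - 1 + (?V - 1)) \<le> 2 ^ ?E" by (simp add: power_add)
  then have "?F - 1 + (?V - 1) \<le> ?E" by (rule power_le_imp_le_exp[rotated]) simp
  then show ?thesis by simp
qed

theorem planar_cycle_coboundary:
  assumes "connected_prem M" "S \<in> cycle_space"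
    and "card (vertex M ` darts M) + card (face M ` darts M)
      = card {d\<in>darts M. alpha M d \<noteq> d} div 2 + 2"
  shows "\<exists>A. S = coboundary A"
proof (cases "darts M = {}")
  case True
  then show ?thesis using assms(2) unfolding cycle_space_def edge_sets_def coboundary_def by auto
next
  case False
  then obtain d0 where d0: "d0 \<in> darts M" by auto
  let ?V = "card (vertex M ` darts M)" and ?F = "card (face M ` darts M)"
    and ?E = "card {d\<in>darts M. alpha M d \<noteq> d} div 2"
  have pos: "?V \<ge> 1" "?F \<ge> 1" using d0 finite_darts by (auto simp: Suc_le_eq card_gt_0_iff)
  have "card cycle_space * 2 ^ (?V - 1) \<le> card edge_sets"
    by (rule card_cycle_space[OF assms(1) d0])
  also have "\<dots> \<le> 2 ^ ?E" by (rule card_edge_sets)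
  also have "?E = (?F - 1) + (?V - 1)" using assms(3) pos by linarith
  finally have "card cycle_space \<le> 2 ^ (?F - 1)" by (simp add: power_add)
  then have "card cycle_space = 2 ^ (?F - 1)"
    using face_sets_le_cycle_space(1)[OF assms(1) d0] by simp
  then show ?thesis using face_sets_le_cycle_space(2)[OF assms(1) d0] assms(2) by blast
qed

end

section \<open>The contour of a mobile\<close>

text \<open>Walking along the contour, white half-edges are opening and buds are closing parentheses:
  \<open>run M x b n\<close> holds if the contour word starting at \<open>x\<close> closes, after \<open>n\<close> steps and for the first
  time, one more parenthesis than it opens, and \<open>b\<close> is the bud which does so.\<close>

inductive run :: "('h, 'z) mobile_scheme \<Rightarrow> 'h \<Rightarrow> 'h \<Rightarrow> nat \<Rightarrow> bool" for M where
  bud: "alpha M x = x \<Longrightarrow> run M x x 1"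
| black: "\<lbrakk>alpha M x \<noteq> x; black M (alpha M x); run M (sigma M (alpha M x)) b n\<rbrakk> \<Longrightarrow> run M x b (Suc n)"
| white: "\<lbrakk>alpha M x \<noteq> x; \<not> black M (alpha M x); run M (sigma M (alpha M x)) b' n';
    run M (sigma M b') b n\<rbrakk> \<Longrightarrow> run M x b (Suc (n' + n))"

text \<open>The three rules exclude each other. The bud will be the partner of a white half-edge,
  and the length, equally determined, the rank that makes the parent relation of a closed mobile
  acyclic.\<close>

lemma run_unique: "run M x b n \<Longrightarrow> run M x c m \<Longrightarrow> b = c \<and> n = m"
proof (induction arbitrary: c m rule: run.induct)
  case (bud x)
  from bud.prems show ?case by (cases rule: run.cases) (use bud in auto)
next
  case (black x b n)
  from black.prems obtain n' where "run M (sigma M (alpha M x)) c n'" "m = Suc n'"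
    by (cases rule: run.cases) (use black.hyps in simp_all)
  then show ?case using black.IH by simp
next
  case (white x b' n' b n)
  from white.prems obtain d k' k where d: "run M (sigma M (alpha M x)) d k'" "run M (sigma M d) c k"
    "m = Suc (k' + k)"
    by (cases rule: run.cases) (use white.hyps in simp_all)
  have e: "b' = d \<and> n' = k'" by (rule white.IH(1)[OF d(1)])
  then have "run M (sigma M b') c k" using d(2) by simp
  from white.IH(2)[OF this] show ?case using e d(3) by simp
qed

lemma (in rotsys) funpow_sigma_closed: "d \<in> darts M \<Longrightarrow> (sigma M ^^ t) d \<in> darts M"
  by (induction t) (auto simp: sigma_closed)

lemma (in rotsys) funpow_sigma_inj:
  "d \<in> darts M \<Longrightarrow> e \<in> darts M \<Longrightarrow> (sigma M ^^ t) d = (sigma M ^^ t) e \<Longrightarrow> d = e"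
  by (induction t) (auto dest!: sigma_inj[rotated 2] simp: funpow_sigma_closed)

lemma (in rotsys) funpow_vertex: "(sigma M ^^ t) d \<in> vertex M d"
  unfolding vertex_def by (rule funpow_in_orb)

lemma (in rotsys) vertex_positive_power:
  assumes "d \<in> darts M" "e \<in> vertex M d"
  shows "\<exists>t>0. (sigma M ^^ t) d = e"
proof -
  have "e \<in> vertex M (sigma M d)" using assms by simp
  then obtain n where "e = (sigma M ^^ n) (sigma M d)" unfolding vertex_def orb_def by auto
  then have "(sigma M ^^ Suc n) d = e" by (simp add: funpow_swap1)
  then show ?thesis by blast
qed

text \<open>A run only crosses edges and rotates; the passage from \<open>b'\<close> to
  \<open>sigma M b'\<close> in rule \<open>white\<close> is a rotation too. Runs are thus paths
  inside one component.\<close>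

lemma run_connected:
  assumes "rotsys M" "run M x b n" "x \<in> darts M"
  shows "(x, b) \<in> (rotsys.conn_rel M)\<^sup>* \<and> b \<in> darts M"
proof -
  interpret rotsys M by fact
  have step: "(x, sigma M (alpha M x)) \<in> conn_rel\<^sup>*" if "x \<in> darts M" for x
    using conn_alpha[OF that] conn_sigma[OF alpha_closed[OF that]] by (rule rtrancl_trans)
  show ?thesis using assms(2,3)
  proof (induction rule: run.induct)
    case (bud x)
    then show ?case by simp
  next
    case (black x b n)
    have *: "sigma M (alpha M x) \<in> darts M" using black.prems alpha_closed sigma_closed by blast
    show ?case using rtrancl_trans[OF step[OF black.prems]] black.IH[OF *] by blast
  next
    case (white x b' n' b n)
    have *: "sigma M (alpha M x) \<in> darts M" using white.prems alpha_closed sigma_closed by blast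
    note 1 = white.IH(1)[OF *]
    have b': "sigma M b' \<in> darts M" using 1 sigma_closed by blast
    note 2 = white.IH(2)[OF b']
    have "(x, b') \<in> conn_rel\<^sup>*" using rtrancl_trans[OF step[OF white.prems]] 1 by blast
    moreover have "(b', sigma M b') \<in> conn_rel\<^sup>*" using conn_sigma 1 by blast
    ultimately show ?case using 2 by (meson rtrancl_trans)
  qed
qed

section \<open>Biorientations and their images\<close>

locale biori = rotsys B for B :: "('h, 'z) wbiori_scheme" +
  assumes alpha_ne: "d \<in> darts B \<Longrightarrow> alpha B d \<noteq> d"
begin

abbreviation "gap i t \<equiv> (\<forall>u. 0 < u \<longrightarrow> u < t \<longrightarrow> \<not> ingoing B ((sigma B ^^ u) i))"

text \<open>If the distances differed, the nearer of the two ingoing half-edges would lie inside the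
  gap of the other.\<close>

lemma gap_unique:
  assumes "i \<in> darts B" "j \<in> darts B" "ingoing B i" "ingoing B j" "0 < t" "0 < t'"
    "(sigma B ^^ t) i = (sigma B ^^ t') j" "gap i t" "gap j t'"
  shows "i = j"
proof -
  have *: "i = j" if "i \<in> darts B" "j \<in> darts B" "ingoing B i" "0 < t" "t \<le> t'"
    "(sigma B ^^ t) i = (sigma B ^^ t') j" "gap j t'" for i j t t'
  proof (cases "t = t'")
    case True
    with that(6) have "(sigma B ^^ t) i = (sigma B ^^ t) j" by simp
    then show ?thesis by (rule funpow_sigma_inj[OF that(1,2)])
  next
    case False
    have "(sigma B ^^ t') j = (sigma B ^^ t) ((sigma B ^^ (t' - t)) j)"
      using that(5) by (metis comp_apply funpow_add le_add_diff_inverse)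
    then have "i = (sigma B ^^ (t' - t)) j"
      using that funpow_sigma_inj funpow_sigma_closed by metis
    then show ?thesis using that False by auto
  qed
  show ?thesis
  proof (cases "t \<le> t'")
    case True
    then show ?thesis using *[of i j t t'] assms by blast
  next
    case False
    then have "t' \<le> t" by simp
    from *[OF assms(2,1,4,6) this assms(7)[symmetric] assms(8)] show ?thesis by (rule sym)
  qed
qed

text \<open>The parent of an ingoing half-edge \<open>c\<close> is the first ingoing half-edge strictly
  counterclockwise from \<open>alpha B c\<close> around the origin of the edge of \<open>c\<close>.\<close>

definition par :: "('h \<times> 'h) set" where
  "par = {(c, i). c \<in> darts B \<and> i \<in> darts B \<and> ingoing B c \<and> ingoing B i \<and>
     (\<exists>t>0. (sigma B ^^ t) i = alpha B c \<and> gap i t)}"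

lemma par_unique: "(c, i) \<in> par \<Longrightarrow> (c, j) \<in> par \<Longrightarrow> i = j"
  proof -
  assume "(c, i) \<in> par" "(c, j) \<in> par"
  then obtain t t' where "c \<in> darts B" "i \<in> darts B" "j \<in> darts B" "ingoing B i" "ingoing B j"
    "0 < t" "(sigma B ^^ t) i = alpha B c" "gap i t" "0 < t'" "(sigma B ^^ t') j = alpha B c" "gap j t'"
    unfolding par_def by auto
  then show ?thesis using gap_unique[of i j t t'] by simp
qed

lemma par_vertex: "(c, i) \<in> par \<Longrightarrow> alpha B c \<in> vertex B i"
  unfolding par_def using funpow_vertex by auto metis

lemma finite_par: "finite par"
proof (rule finite_subset)
  show "par \<subseteq> darts B \<times> darts B" unfolding par_def by auto
qed (simp add: finite_darts)

text \<open>The least clockwise distance from an ingoing half-edge to \<open>alpha B c\<close>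
  leaves no ingoing one in between. Distances are positive, so \<open>alpha B c\<close>, if ingoing
  itself, is a candidate only after a full turn.\<close>

lemma par_exists:
  assumes "c \<in> darts B" "ingoing B c" "j \<in> vertex B (alpha B c)" "ingoing B j"
  shows "\<exists>i. (c, i) \<in> par"
proof -
  let ?P = "\<lambda>n. 0 < n \<and> (\<exists>i\<in>darts B. ingoing B i \<and> (sigma B ^^ n) i = alpha B c)"
  have jD: "j \<in> darts B" using assms vertex_sub alpha_closed by blast
  have "vertex B j = vertex B (alpha B c)" using vertex_eq[OF alpha_closed[OF assms(1)] assms(3)] .
  then have "alpha B c \<in> vertex B j" by simp
  then obtain n where "?P n" using vertex_positive_power[OF jD] jD assms by blast
  define m where "m = (LEAST n. ?P n)"
  have m: "?P m" unfolding m_def by (rule LeastI) fact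
  then obtain i where i: "i \<in> darts B" "ingoing B i" "(sigma B ^^ m) i = alpha B c" by blast
  have "\<not> ingoing B ((sigma B ^^ u) i)" if u: "0 < u" "u < m" for u
  proof
    assume "ingoing B ((sigma B ^^ u) i)"
    moreover have "(sigma B ^^ (m - u)) ((sigma B ^^ u) i) = alpha B c"
      using i u by (metis comp_apply funpow_add le_add_diff_inverse2 less_imp_le)
    ultimately have "?P (m - u)" using u funpow_sigma_closed i by auto
    then have "m \<le> m - u" unfolding m_def by (rule Least_le)
    then show False using u by simp
  qed
  then show ?thesis using i m assms unfolding par_def by blast
qed

lemma nextIn_eqI:
  assumes "0 < t" "ingoing B ((sigma B ^^ t) h)" "gap h t"
  shows "nextIn (sigma B) (ingoing B) h = (sigma B ^^ t) h"
proof -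
  have "(LEAST k. k > 0 \<and> ingoing B ((sigma B ^^ k) h)) = t"
    by (rule Least_equality) (use assms in \<open>auto simp: not_less[symmetric]\<close>)
  then show ?thesis unfolding nextIn_def by simp
qed

lemma nextIn_exists:
  assumes "h \<in> darts B" "ingoing B h"
  obtains t where "0 < t" "nextIn (sigma B) (ingoing B) h = (sigma B ^^ t) h"
    "ingoing B ((sigma B ^^ t) h)" "gap h t"
proof -
  let ?P = "\<lambda>k. k > 0 \<and> ingoing B ((sigma B ^^ k) h)"
  obtain n where n: "?P n" using vertex_positive_power[OF assms(1) vertex_self] assms by metis
  define t where "t = (LEAST k. ?P k)"
  have "?P t" unfolding t_def by (rule LeastI) fact
  moreover have "gap h t" unfolding t_def using not_less_Least by blast
  ultimately show ?thesis using that[of t] unfolding nextIn_def t_def[symmetric] by blast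
qed

lemma nextIn_closed: "h \<in> darts B \<Longrightarrow> ingoing B h \<Longrightarrow>
    nextIn (sigma B) (ingoing B) h \<in> darts B \<and> ingoing B (nextIn (sigma B) (ingoing B) h)
    \<and> nextIn (sigma B) (ingoing B) h \<in> vertex B h"
  by (metis nextIn_exists funpow_sigma_closed funpow_vertex)

lemma nextIn_inj:
  assumes "h \<in> darts B" "ingoing B h" "g \<in> darts B" "ingoing B g"
    "nextIn (sigma B) (ingoing B) h = nextIn (sigma B) (ingoing B) g"
  shows "h = g"
proof -
  obtain t where t: "0 < t" "nextIn (sigma B) (ingoing B) h = (sigma B ^^ t) h" "gap h t"
    using nextIn_exists[OF assms(1,2)] .
  obtain t' where t': "0 < t'" "nextIn (sigma B) (ingoing B) g = (sigma B ^^ t') g" "gap g t'"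
    using nextIn_exists[OF assms(3,4)] .
  show ?thesis using gap_unique[OF assms(1,3,2,4) t(1) t'(1) _ t(3) t'(3)] t t' assms(5) by simp
qed

section \<open>The image of a biorientation as a rotation system\<close>

abbreviation "P \<equiv> Phi0 B"

lemma Phi0_darts: "darts P = Bl ` darts B \<union> Wh ` {h\<in>darts B. ingoing B h}"
  and Phi0_Bl_in [simp]: "Bl h \<in> darts P \<longleftrightarrow> h \<in> darts B"
  and Phi0_Wh_in [simp]: "Wh h \<in> darts P \<longleftrightarrow> h \<in> darts B \<and> ingoing B h"
  and Phi0_black [simp]: "black P (Bl h)" "\<not> black P (Wh h)"
  and Phi0_mweight [simp]: "mweight P (Bl h) = weight B (alpha B h)" "mweight P (Wh h) = weight B h"
  and Phi0_alpha_bud: "ingoing B (alpha B h) \<Longrightarrow> alpha P (Bl h) = Bl h"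
  and Phi0_alpha_1way: "\<not> ingoing B (alpha B h) \<Longrightarrow> ingoing B h \<Longrightarrow> alpha P (Bl h) = Wh h"
  and Phi0_alpha_0way: "\<not> ingoing B (alpha B h) \<Longrightarrow> \<not> ingoing B h \<Longrightarrow> alpha P (Bl h) = Bl (alpha B h)"
  and Phi0_alpha_Wh1: "\<not> ingoing B (alpha B h) \<Longrightarrow> alpha P (Wh h) = Bl h"
  and Phi0_alpha_Wh2: "ingoing B (alpha B h) \<Longrightarrow> alpha P (Wh h) = Wh (alpha B h)"
  and Phi0_sigma_Wh [simp]: "sigma P (Wh h) = Wh (nextIn (sigma B) (ingoing B) h)"
  unfolding Phi0_def by auto

text \<open>Around a black vertex the rotation is the inverse of the face permutation
  \<open>sigma B \<circ> alpha B\<close>; taking the argument in the form \<open>sigma B h\<close>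
  eliminates the inverse from the definition.\<close>

lemma Phi0_sigma_Bl: "h \<in> darts B \<Longrightarrow> sigma P (Bl (sigma B h)) = Bl (alpha B h)"
  unfolding Phi0_def using sigma_bij by (simp add: bij_betw_def)

lemma Phi0_cases:
  assumes "x \<in> darts P"
  obtains (black) h where "x = Bl h" "h \<in> darts B" | (white) h where "x = Wh h" "h \<in> darts B" "ingoing B h"
  using assms unfolding Phi0_darts by auto

lemma Phi0_rotsys: "rotsys P"
proof
  show "finite (darts P)" unfolding Phi0_darts using finite_darts by auto
  show "alpha P d \<in> darts P" if "d \<in> darts P" for d
    using that
  proof (cases rule: Phi0_cases)
    case (black h)
    then show ?thesis
      by (cases "ingoing B (alpha B h)"; cases "ingoing B h")
        (auto simp: Phi0_alpha_bud Phi0_alpha_1way Phi0_alpha_0way alpha_closed)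
  next
    case (white h)
    then show ?thesis
      by (cases "ingoing B (alpha B h)") (auto simp: Phi0_alpha_Wh1 Phi0_alpha_Wh2 alpha_closed)
  qed
  show "alpha P (alpha P d) = d" if "d \<in> darts P" for d
    using that
  proof (cases rule: Phi0_cases)
    case (black h)
    then show ?thesis
      by (cases "ingoing B (alpha B h)"; cases "ingoing B h")
        (auto simp: Phi0_alpha_bud Phi0_alpha_1way Phi0_alpha_0way Phi0_alpha_Wh1 alpha_alpha)
  next
    case (white h)
    then show ?thesis
      by (cases "ingoing B (alpha B h)")
        (auto simp: Phi0_alpha_Wh1 Phi0_alpha_Wh2 Phi0_alpha_1way alpha_alpha)
  qed
  have cl: "sigma P d \<in> darts P" if "d \<in> darts P" for d
    using that
  proof (cases rule: Phi0_cases)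
    case (black h)
    then obtain k where "k \<in> darts B" "sigma B k = h" using sigma_pre by blast
    then show ?thesis using black Phi0_sigma_Bl alpha_closed by auto
  next
    case (white h)
    then show ?thesis using nextIn_closed by auto
  qed
  have sBl: "\<exists>k\<in>darts B. sigma B k = h \<and> sigma P (Bl h) = Bl (alpha B k)" if "h \<in> darts B" for h
    using sigma_pre[OF that] Phi0_sigma_Bl by blast
  have "inj_on (sigma P) (darts P)"
  proof (rule inj_onI)
    fix x y assume xy: "x \<in> darts P" "y \<in> darts P" "sigma P x = sigma P y"
    show "x = y" using xy(1)
    proof (cases rule: Phi0_cases)
      case b: (black h)
      show ?thesis using xy(2)
      proof (cases rule: Phi0_cases)
        case (black g)
        obtain k where k: "k \<in> darts B" "sigma B k = h" "sigma P (Bl h) = Bl (alpha B k)"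
            using sBl[OF b(2)] by blast
          obtain k' where k': "k' \<in> darts B" "sigma B k' = g" "sigma P (Bl g) = Bl (alpha B k')"
            using sBl[OF black(2)] by blast
          have "Bl (alpha B k) = Bl (alpha B k')" using xy(3) unfolding b(1) black(1) k(3) k'(3) .
          then have "k = k'" using alpha_inj[OF k(1) k'(1)] by simp
          then have "h = g" using k(2) k'(2) by simp
          then show ?thesis unfolding b(1) black(1) by simp
      next
        case (white g)
        then show ?thesis using sBl[of h] b xy(3) by auto
      qed
    next
      case w: (white h)
      show ?thesis using xy(2)
      proof (cases rule: Phi0_cases)
        case (black g)
        then show ?thesis using sBl[of g] w xy(3) by auto
      next
        case (white g)
        then show ?thesis using w xy(3) nextIn_inj by auto
      qed
    qed
  qed
  moreover have "sigma P ` darts P \<subseteq> darts P" using cl by blast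
  ultimately show "bij_betw (sigma P) (darts P) (darts P)"
    using endo_inj_surj[of "darts P" "sigma P"] \<open>finite (darts P)\<close> by (simp add: bij_betw_def)
qed

sublocale Phi: rotsys P by (rule Phi0_rotsys)

text \<open>The contour behind \<open>Wh i\<close> turns counterclockwise about the vertex of
  \<open>i\<close>, from the next ingoing half-edge back to \<open>i\<close>, where it meets the bud
  \<open>Bl (alpha B i)\<close>. A half-edge on the way whose opposite is ingoing causes an
  excursion to that opposite, a child of \<open>i\<close>; well-founded induction on
  \<open>par\<close> brings it back.\<close>

lemma Phi0_run:
  assumes "acyclic par" "i \<in> darts B" "ingoing B i"
  shows "\<exists>n. run P (sigma P (Wh i)) (Bl (alpha B i)) n"
proof -
  have "wf par" using assms(1) finite_par finite_acyclic_wf by blast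
  then show ?thesis using assms(2,3)
  proof (induction i rule: wf_induct_rule)
    case (less i)
    obtain T where T: "0 < T" "nextIn (sigma B) (ingoing B) i = (sigma B ^^ T) i"
      "ingoing B ((sigma B ^^ T) i)" "gap i T"
      using nextIn_exists[OF less.prems] .
    let ?s = "\<lambda>t. (sigma B ^^ t) i"
    have sD: "?s t \<in> darts B" for t using funpow_sigma_closed less.prems by blast
    \<comment> \<open>Since nothing ingoing lies strictly between \<open>i\<close> and
      \<open>?s T\<close>, the half-edge \<open>i\<close> is the parent of the opposite of
      \<open>?s t\<close>.\<close>
    have child: "\<exists>n. run P (sigma P (Wh (alpha B (?s t)))) (Bl (?s t)) n"
      if "0 < t" "t \<le> T" "ingoing B (alpha B (?s t))" for t
    proof -
      have "(alpha B (?s t), i) \<in> par" unfolding par_def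
        using that sD T(4) less.prems by (auto simp: alpha_closed alpha_alpha intro!: exI[of _ t])
      from less.IH[OF this] show ?thesis using that sD by (auto simp: alpha_closed alpha_alpha)
    qed
    \<comment> \<open>Here \<open>t\<close> counts the positions still to be passed before
      \<open>i\<close>; at \<open>t = 0\<close> the contour stands at the closing bud.\<close>
    have "\<exists>n. run P (Bl (alpha B (?s t))) (Bl (alpha B i)) n" if "t < T" for t
      using that
    proof (induction t)
      case 0
      have "alpha P (Bl (alpha B i)) = Bl (alpha B i)"
        using less.prems by (simp add: Phi0_alpha_bud alpha_alpha)
      then show ?case using run.bud by fastforce
    next
      case (Suc t)
      then obtain n where n: "run P (Bl (alpha B (?s t))) (Bl (alpha B i)) n" by auto
      let ?k = "?s (Suc t)"
      have nk: "\<not> ingoing B ?k" using T(4) Suc.prems by blast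
      have sg: "sigma P (Bl ?k) = Bl (alpha B (?s t))" using Phi0_sigma_Bl[OF sD[of t]] by simp
      have ne: "Bl (alpha B ?k) \<noteq> Bl ?k" "Bl ?k \<noteq> Bl (alpha B ?k)" using alpha_ne[OF sD] by (metis mdart.inject(1))+
      have aa: "alpha B (alpha B ?k) = ?k" using alpha_alpha[OF sD] .
      show ?case
      proof (cases "ingoing B (alpha B ?k)")
        case False
        have "alpha P (Bl (alpha B ?k)) = Bl ?k"
          using Phi0_alpha_0way[of "alpha B ?k"] False nk aa by metis
        then show ?thesis using run.black[of P "Bl (alpha B ?k)" "Bl (alpha B i)" n] n sg ne by auto
      next
        case True
        have al: "alpha P (Bl (alpha B ?k)) = Wh (alpha B ?k)"
          using Phi0_alpha_1way[of "alpha B ?k"] True nk aa by metis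
        obtain m where m: "run P (sigma P (Wh (alpha B ?k))) (Bl ?k) m"
          using child[of "Suc t"] Suc.prems True by auto
        have "run P (Bl (alpha B ?k)) (Bl (alpha B i)) (Suc (m + n))"
          by (rule run.white[of P _ "Bl ?k"]) (use al m n sg in \<open>simp_all del: funpow.simps\<close>)
        then show ?thesis by blast
      qed
    qed
    \<comment> \<open>The contour starts at \<open>Wh (?s T)\<close>, as \<open>?s T\<close> is
      ingoing, and not at a black half-edge; one step, with an excursion if the edge is 2-way, leads
      to position \<open>T - 1\<close>.\<close>
    from this[of "T - 1"] T(1) obtain n where
      n: "run P (Bl (alpha B (?s (T - 1)))) (Bl (alpha B i)) n" by auto
    let ?j = "?s T"
    have "?j = sigma B (?s (T - 1))" using T(1) by (cases T) auto
    then have sg: "sigma P (Bl ?j) = Bl (alpha B (?s (T - 1)))" using Phi0_sigma_Bl[OF sD] by metis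
    show ?case
    proof (cases "ingoing B (alpha B ?j)")
      case False
      have "run P (Wh ?j) (Bl (alpha B i)) (Suc n)"
        by (rule run.black) (use Phi0_alpha_Wh1[OF False] sg n in simp_all)
      then show ?thesis using T(2) by auto
    next
      case True
      obtain m where m: "run P (sigma P (Wh (alpha B ?j))) (Bl ?j) m"
        using child[of T] T(1) True by auto
      have "run P (Wh ?j) (Bl (alpha B i)) (Suc (m + n))"
        by (rule run.white[of P _ "Bl ?j"])
          (use Phi0_alpha_Wh2[OF True] sg n m alpha_ne[OF sD[of T]] in simp_all)
      then show ?thesis using T(2) by auto
    qed
  qed
qed

text \<open>The local transformations sever edges, so connectedness of \<open>B\<close> is not
  inherited directly. The contour links \<open>Wh i\<close> to the bud
  \<open>Bl (alpha B i)\<close>, and thereby the two sides of every edge with an ingoing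
  half-edge.\<close>

lemma Phi0_connected:
  assumes "acyclic par" "connected_prem B"
  shows "connected_prem P"
proof -
  let ?R = "Phi.conn_rel\<^sup>*"
  have W: "(Wh i, Bl (alpha B i)) \<in> ?R" if i: "i \<in> darts B" "ingoing B i" for i
  proof -
    obtain n where "run P (sigma P (Wh i)) (Bl (alpha B i)) n" using Phi0_run[OF assms(1) i] by blast
    moreover have "Wh i \<in> darts P" using that by simp
    ultimately have "(sigma P (Wh i), Bl (alpha B i)) \<in> ?R"
      using run_connected[OF Phi0_rotsys] Phi.sigma_closed by blast
    with Phi.conn_sigma[OF \<open>Wh i \<in> darts P\<close>] show ?thesis by (rule rtrancl_trans)
  qed
  have A: "(Bl d, Bl (alpha B d)) \<in> ?R" if d: "d \<in> darts B" for d
  proof (cases "ingoing B (alpha B d)"; cases "ingoing B d")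
    assume i: "\<not> ingoing B (alpha B d)" "\<not> ingoing B d"
    show ?thesis using Phi.conn_alpha[of "Bl d"] d Phi0_alpha_0way[OF i] by simp
  next
    assume i: "\<not> ingoing B (alpha B d)" "ingoing B d"
    have "(Bl d, Wh d) \<in> ?R" using Phi.conn_alpha[of "Bl d"] d Phi0_alpha_1way[OF i] by simp
    then show ?thesis using W[OF d i(2)] by (rule rtrancl_trans)
  next
    assume i: "ingoing B (alpha B d)" "\<not> ingoing B d"
    let ?e = "alpha B d"
    have e: "?e \<in> darts B" "alpha B ?e = d" using d by (simp_all add: alpha_closed alpha_alpha)
    have "(Bl ?e, Wh ?e) \<in> ?R"
      using Phi.conn_alpha[of "Bl ?e"] e Phi0_alpha_1way[of ?e] i by simp
    moreover have "(Wh ?e, Bl d) \<in> ?R" using W[of ?e] e i by simp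
    ultimately have "(Bl ?e, Bl d) \<in> ?R" by (rule rtrancl_trans)
    then show ?thesis by (rule Phi.conn_sym)
  next
    assume i: "ingoing B (alpha B d)" "ingoing B d"
    let ?e = "alpha B d"
    have e: "?e \<in> darts B" "alpha B ?e = d" using d by (simp_all add: alpha_closed alpha_alpha)
    have "(Wh d, Wh ?e) \<in> ?R" using Phi.conn_alpha[of "Wh d"] d i Phi0_alpha_Wh2[OF i(1)] by simp
    moreover have "(Wh ?e, Bl d) \<in> ?R" using W[of ?e] e i by simp
    ultimately have "(Wh d, Bl d) \<in> ?R" by (rule rtrancl_trans)
    from Phi.conn_sym[OF this] W[OF d i(2)] show ?thesis by (rule rtrancl_trans)
  qed
  have S: "(Bl d, Bl (sigma B d)) \<in> ?R" if d: "d \<in> darts B" for d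
  proof -
    have "(Bl (sigma B d), Bl (alpha B d)) \<in> ?R"
      using Phi.conn_sigma[of "Bl (sigma B d)"] Phi0_sigma_Bl[OF d] sigma_closed[OF d] by simp
    from A[OF d] Phi.conn_sym[OF this] show ?thesis by (rule rtrancl_trans)
  qed
  have BB: "(Bl x, Bl y) \<in> ?R" if "x \<in> darts B" "y \<in> darts B" for x y
    using assms(2) that by (induction rule: connected_induct) (auto intro: rtrancl_trans A S)
  have "\<exists>h\<in>darts B. (x, Bl h) \<in> ?R" if "x \<in> darts P" for x
    using that
  proof (cases rule: Phi0_cases)
    case (white h)
    then show ?thesis using W alpha_closed by blast
  qed auto
  then show ?thesis unfolding Phi.connected_iff using BB Phi.conn_sym by (meson rtrancl_trans)
qed

section \<open>Vertices, edges and excess of the image\<close>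

lemma Phi0_vertex_Bl:
  assumes "h \<in> darts B"
  shows "vertex P (Bl h) = Bl ` face B h"
proof -
  have sBl: "\<exists>k\<in>darts B. sigma B k = h \<and> sigma P (Bl h) = Bl (alpha B k)" if "h \<in> darts B" for h
    using sigma_pre[OF that] Phi0_sigma_Bl by blast
  have "y \<in> Bl ` face B h" if "y \<in> vertex P (Bl h)" for y
    using that unfolding vertex_def
  proof (induction rule: orb_induct)
    case (step z)
    then obtain g where g: "z = Bl g" "g \<in> face B h" by blast
    then have "g \<in> darts B" using face_sub assms by blast
    with sBl obtain k where k: "k \<in> darts B" "sigma B k = g" "sigma P z = Bl (alpha B k)"
      using g by blast
    have "face B (alpha B k) = face B h" using k face_sigma face_eq[OF assms g(2)] by metis
    then have "alpha B k \<in> face B h" using face_self by metis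
    then show ?case using k(3) by simp
  qed simp
  moreover have "vertex P (Bl g) = vertex P (Bl h)" if "g \<in> face B h" for g
  proof (rule face_inv[OF that assms, of "\<lambda>g. vertex P (Bl g)"])
    fix d assume d: "d \<in> darts B"
    have "sigma P (Bl (sigma B (alpha B d))) = Bl d"
      using Phi0_sigma_Bl[of "alpha B d"] d by (simp add: alpha_closed alpha_alpha)
    then show "vertex P (Bl (sigma B (alpha B d))) = vertex P (Bl d)"
      using Phi.vertex_sigma[of "Bl (sigma B (alpha B d))"] d by (simp add: alpha_closed sigma_closed)
  qed
  ultimately show ?thesis using Phi.vertex_self by blast
qed

lemma Phi0_vertex_Wh:
  assumes "h \<in> darts B" "ingoing B h"
  shows "vertex P (Wh h) = Wh ` {x \<in> vertex B h. ingoing B x}"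
proof -
  have sub: "y \<in> Wh ` {x \<in> vertex B h. ingoing B x}" if "y \<in> vertex P (Wh h)" for y
    using that unfolding vertex_def[of P]
  proof (induction rule: orb_induct)
    case (step z)
    then obtain g where g: "z = Wh g" "g \<in> vertex B h" "ingoing B g" by blast
    then have gD: "g \<in> darts B" using vertex_sub assms by blast
    note n = nextIn_closed[OF gD g(3)]
    then have "nextIn (sigma B) (ingoing B) g \<in> vertex B h"
      using vertex_eq[OF assms(1) g(2)] by simp
    then show ?case using n g(1) by simp
  qed (use assms in simp)
  \<comment> \<open>Strong induction on the distance \<open>n\<close>: the first ingoing half-edge
    clockwise from \<open>h\<close> lies at some \<open>T \<le> n\<close> and is the successor of
    \<open>Wh h\<close> in \<open>P\<close>.\<close>
  have same: "vertex P (Wh ((sigma B ^^ n) h)) = vertex P (Wh h)"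
    if "ingoing B ((sigma B ^^ n) h)" for n using assms that
  proof (induction n arbitrary: h rule: less_induct)
    case (less n)
    show ?case
    proof (cases "n = 0")
      case False
      obtain T where T: "0 < T" "nextIn (sigma B) (ingoing B) h = (sigma B ^^ T) h"
        "ingoing B ((sigma B ^^ T) h)" "gap h T"
        using nextIn_exists[OF less.prems(1,2)] .
      have "T \<le> n" using T(4) False less.prems(3) by (meson gr0I not_less)
      then have e: "(sigma B ^^ n) h = (sigma B ^^ (n - T)) ((sigma B ^^ T) h)"
        by (metis comp_apply funpow_add le_add_diff_inverse2)
      have "vertex P (Wh ((sigma B ^^ n) h)) = vertex P (Wh ((sigma B ^^ T) h))"
        unfolding e
        by (rule less.IH) (use T False less.prems e funpow_sigma_closed in auto)
      also have "\<dots> = vertex P (sigma P (Wh h))" using T(2) by simp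
      also have "\<dots> = vertex P (Wh h)" using less.prems by (intro Phi.vertex_sigma) simp
      finally show ?thesis .
    qed simp
  qed
  have "Wh x \<in> vertex P (Wh h)" if x: "x \<in> vertex B h" "ingoing B x" for x
    proof -
    obtain n where "x = (sigma B ^^ n) h" using x(1) unfolding vertex_def orb_def by blast
    then have "vertex P (Wh x) = vertex P (Wh h)" using same x(2) by blast
    then show ?thesis using Phi.vertex_self by metis
  qed
  with sub show ?thesis by blast
qed

text \<open>A vertex with no ingoing half-edge carries no \<open>Wh\<close> and disappears from the
  image; this is how the root-vertex gets deleted.\<close>

lemma Phi0_card_vertices:
  "card (vertex P ` darts P)
    = card (face B ` darts B) + card {v \<in> vertex B ` darts B. \<exists>x\<in>v. ingoing B x}"
proof -
  let ?V = "{v \<in> vertex B ` darts B. \<exists>x\<in>v. ingoing B x}"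
  let ?g = "\<lambda>v. Wh ` {x \<in> v. ingoing B x}"
  have "vertex P ` (Bl ` darts B) = (`) Bl ` face B ` darts B"
    unfolding image_image by (rule image_cong) (simp_all add: Phi0_vertex_Bl)
  moreover have "vertex P ` (Wh ` {h\<in>darts B. ingoing B h}) = ?g ` ?V"
  proof -
    have "vertex P ` (Wh ` {h\<in>darts B. ingoing B h}) = ?g ` vertex B ` {h\<in>darts B. ingoing B h}"
      unfolding image_image by (rule image_cong) (simp_all add: Phi0_vertex_Wh)
    moreover have "vertex B ` {h\<in>darts B. ingoing B h} = ?V"
    proof (intro equalityI subsetI)
      fix v assume "v \<in> ?V"
      then obtain d x where d: "d \<in> darts B" "v = vertex B d" and x: "x \<in> v" "ingoing B x" by auto
      have "x \<in> darts B" using vertex_sub[OF d(1)] x(1) d(2) by auto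
      moreover have "v = vertex B x" using vertex_eq[OF d(1), of x] x(1) d(2) by simp
      ultimately show "v \<in> vertex B ` {h\<in>darts B. ingoing B h}" using x(2) by blast
    next
      fix v assume "v \<in> vertex B ` {h\<in>darts B. ingoing B h}"
      then obtain h where h: "h \<in> darts B" "ingoing B h" "v = vertex B h" by blast
      then have "h \<in> v" by simp
      with h show "v \<in> ?V" by blast
    qed
    ultimately show ?thesis by simp
  qed
  ultimately have eq: "vertex P ` darts P = (`) Bl ` face B ` darts B \<union> ?g ` ?V"
    unfolding Phi0_darts by (simp add: image_Un)
  have fin: "finite (face B ` darts B)" "finite ?V" using finite_darts by auto
  have 1: "card ((`) Bl ` face B ` darts B) = card (face B ` darts B)"
    by (intro card_image inj_on_image) (simp add: inj_on_def)
  have "inj_on ?g ?V"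
  proof (rule inj_onI)
    fix v w assume v: "v \<in> ?V" and w: "w \<in> ?V" and eq: "?g v = ?g w"
    then obtain x where x: "x \<in> v" "ingoing B x" by blast
    then have "Wh x \<in> ?g w" using eq by blast
    then have "x \<in> w" by auto
    obtain d e where "d \<in> darts B" "v = vertex B d" "e \<in> darts B" "w = vertex B e" using v w by blast
    then show "v = w" using vertex_eq x(1) \<open>x \<in> w\<close> by metis
  qed
  then have 2: "card (?g ` ?V) = card ?V" by (rule card_image)
  have "(`) Bl ` face B ` darts B \<inter> ?g ` ?V = {}"
  proof (rule ccontr)
    assume "\<not> ?thesis"
    then obtain d v where "Bl ` face B d = ?g v" by blast
    then have "Bl d \<in> ?g v" using face_self by blast
    then show False by blast
  qed
  then show ?thesis unfolding eq using fin 1 2 by (subst card_Un_disjoint) auto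
qed

lemma card_alpha_image: "card {h\<in>darts B. Q (alpha B h)} = card {h\<in>darts B. Q h}"
proof (rule bij_betw_same_card)
  show "bij_betw (alpha B) {h\<in>darts B. Q (alpha B h)} {h\<in>darts B. Q h}"
    by (rule bij_betw_byWitness[where f'="alpha B"]) (auto simp: alpha_closed alpha_alpha)
qed

lemma Phi0_nonbuds:
  "{d\<in>darts P. alpha P d \<noteq> d} = Bl ` {h\<in>darts B. \<not> ingoing B (alpha B h)} \<union> Wh ` {h\<in>darts B. ingoing B h}"
proof -
  have "Bl h \<in> darts P \<and> alpha P (Bl h) \<noteq> Bl h \<longleftrightarrow> h \<in> darts B \<and> \<not> ingoing B (alpha B h)" for h
    using alpha_ne[of h]
    by (cases "ingoing B (alpha B h)"; cases "ingoing B h")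
      (auto simp: Phi0_alpha_bud Phi0_alpha_1way Phi0_alpha_0way)
  moreover have "Wh h \<in> darts P \<and> alpha P (Wh h) \<noteq> Wh h \<longleftrightarrow> h \<in> darts B \<and> ingoing B h" for h
    using alpha_ne[of h]
    by (cases "ingoing B (alpha B h)") (auto simp: Phi0_alpha_Wh1 Phi0_alpha_Wh2)
  ultimately have "x \<in> darts P \<and> alpha P x \<noteq> x \<longleftrightarrow> x \<in> Bl ` {h\<in>darts B. \<not> ingoing B (alpha B h)} \<union> Wh ` {h\<in>darts B. ingoing B h}" for x
    by (cases x) auto
  then show ?thesis by blast
qed

text \<open>Each edge leaves one edge in the image: black-white if 1-way, black-black if 0-way,
  white-white if 2-way.\<close>

lemma Phi0_card_nonbuds: "card {d\<in>darts P. alpha P d \<noteq> d} = card (darts B)"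
proof -
  let ?I = "{h\<in>darts B. ingoing B h}" and ?O = "{h\<in>darts B. \<not> ingoing B (alpha B h)}"
  have f: "finite ?I" "finite ?O" using finite_darts by auto
  have "card (Bl ` ?O \<union> Wh ` ?I) = card (Bl ` ?O) + card (Wh ` ?I)"
    using f by (intro card_Un_disjoint) auto
  also have "\<dots> = card ?O + card ?I" by (simp add: card_image inj_on_def)
  also have "card ?O = card {h\<in>darts B. \<not> ingoing B h}" by (rule card_alpha_image)
  also have "\<dots> + card ?I = card ({h\<in>darts B. \<not> ingoing B h} \<union> ?I)"
    using finite_darts by (intro card_Un_disjoint[symmetric]) auto
  also have "{h\<in>darts B. \<not> ingoing B h} \<union> ?I = darts B" by auto
  finally show ?thesis unfolding Phi0_nonbuds .
qed

text \<open>Every ingoing half-edge \<open>h\<close> gives one white end of an edge and one bud,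
  \<open>Bl (alpha B h)\<close>. A white-white edge has two white ends, which is why the excess
  counts it twice.\<close>

lemma Phi0_excess: "excess P = 0"
proof -
  let ?I = "{h\<in>darts B. ingoing B h}" and ?II = "{h\<in>darts B. ingoing B h \<and> ingoing B (alpha B h)}"
    and ?IO = "{h\<in>darts B. ingoing B h \<and> \<not> ingoing B (alpha B h)}"
  have m: "x \<in> {d\<in>darts P. alpha P d \<noteq> d} \<longleftrightarrow>
    x \<in> Bl ` {h\<in>darts B. \<not> ingoing B (alpha B h)} \<union> Wh ` {h\<in>darts B. ingoing B h}" for x
    unfolding Phi0_nonbuds ..
  have "x \<in> darts P \<and> alpha P x \<noteq> x \<and> black P x \<and> \<not> black P (alpha P x) \<longleftrightarrow> x \<in> Bl ` ?IO" for x
  proof (cases x)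
    case (Bl h)
    then show ?thesis using m[of x]
      by (cases "ingoing B h") (auto simp: Phi0_alpha_0way Phi0_alpha_1way)
  qed auto
  then have 1: "{d\<in>darts P. alpha P d \<noteq> d \<and> black P d \<and> \<not> black P (alpha P d)} = Bl ` ?IO" by blast
  have "x \<in> darts P \<and> alpha P x \<noteq> x \<and> \<not> black P x \<and> \<not> black P (alpha P x) \<longleftrightarrow> x \<in> Wh ` ?II" for x
  proof (cases x)
    case (Wh h)
    then show ?thesis using m[of x]
      by (cases "ingoing B (alpha B h)") (auto simp: Phi0_alpha_Wh1 Phi0_alpha_Wh2)
  qed auto
  then have 2: "{d\<in>darts P. alpha P d \<noteq> d \<and> \<not> black P d \<and> \<not> black P (alpha P d)} = Wh ` ?II" by blast
  have "x \<in> darts P \<and> alpha P x = x \<longleftrightarrow> x \<in> Bl ` {h\<in>darts B. ingoing B (alpha B h)}" for x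
  proof (cases x)
    case (Bl h)
    then show ?thesis using m[of x] by auto
  next
    case (Wh h)
    then show ?thesis using m[of x] by auto
  qed
  then have 3: "{d\<in>darts P. alpha P d = d} = Bl ` {h\<in>darts B. ingoing B (alpha B h)}" by blast
  have "card ?I = card (?IO \<union> ?II)" by (rule arg_cong[of _ _ card]) auto
  also have "\<dots> = card ?IO + card ?II" using finite_darts by (intro card_Un_disjoint) auto
  finally show ?thesis unfolding excess_def 1 2 3
    using card_alpha_image[of "ingoing B"] by (simp add: card_image inj_on_def)
qed

lemma Phi0_mobile:
  assumes "acyclic par" "connected_prem B" "darts B \<noteq> {}"
    and "card (face B ` darts B) + card {v \<in> vertex B ` darts B. \<exists>x\<in>v. ingoing B x}
      = card (darts B) div 2 + 1"
  shows "is_mobile P"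
proof -
  have "black P (sigma P d) = black P d" if "d \<in> darts P" for d
    using that
  proof (cases rule: Phi0_cases)
    case (black h)
    then obtain k where "k \<in> darts B" "sigma B k = h" using sigma_pre by blast
    then show ?thesis using black Phi0_sigma_Bl by auto
  qed simp
  moreover have "black P d" if "d \<in> darts P" "alpha P d = d" for d
  proof (cases d)
    case (Wh h)
    then have "Wh h \<in> {d\<in>darts P. alpha P d \<noteq> d}" using that unfolding Phi0_nonbuds by auto
    then show ?thesis using that Wh by blast
  qed simp
  moreover have "\<exists>d\<in>darts P. alpha P d \<noteq> d"
  proof -
    have "card {d\<in>darts P. alpha P d \<noteq> d} \<noteq> 0"
      unfolding Phi0_card_nonbuds using assms(3) finite_darts by simp
    then have "{d\<in>darts P. alpha P d \<noteq> d} \<noteq> {}" by (metis card.empty)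
    then show ?thesis by blast
  qed
  ultimately show ?thesis
    unfolding is_mobile_def Phi0_card_vertices Phi0_card_nonbuds
    using Phi.finite_darts Phi.alpha_bij Phi.alpha_alpha Phi.sigma_bij
      Phi0_connected[OF assms(1,2)] assms(4) by auto
qed

end

lemma biori_of_planemap: "is_planemap B \<Longrightarrow> biori B"
  unfolding is_planemap_def biori_def rotsys_def biori_axioms_def by (auto simp: bij_betw_def)

section \<open>Circuits in plane maps\<close>

lemma bij_betw_Suc_mod: "bij_betw (\<lambda>i. Suc i mod n) {..<n} {..<n}"
proof -
  have "inj_on (\<lambda>i. Suc i mod n) {..<n}"
  proof (rule inj_onI)
    fix i j assume "i \<in> {..<n}" "j \<in> {..<n}" "Suc i mod n = Suc j mod n"
    then show "i = j" by (cases "Suc i = n"; cases "Suc j = n") auto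
  qed
  moreover have "(\<lambda>i. Suc i mod n) ` {..<n} \<subseteq> {..<n}" by auto
  ultimately show ?thesis unfolding bij_betw_def using endo_inj_surj[of "{..<n}"] by blast
qed

context biori
begin

text \<open>Kirchhoff's law for a flow in which \<open>n d\<close> counts the traversals of an edge
  away from the vertex of \<open>d\<close>; opposite traversals are recorded separately and do not
  cancel.\<close>

definition conserved :: "('h \<Rightarrow> nat) \<Rightarrow> bool" where
  "conserved n \<longleftrightarrow> (\<forall>d\<in>darts B. (\<Sum>x\<in>vertex B d. n x) = (\<Sum>x\<in>vertex B d. n (alpha B x)))"

lemma conserved_diff:
  assumes "conserved n" "conserved c" "\<And>d. d \<in> darts B \<Longrightarrow> n d = n' d + c d"
  shows "conserved n'"
  unfolding conserved_def
proof
  fix d assume d: "d \<in> darts B"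
  have v: "x \<in> darts B" if "x \<in> vertex B d" for x using vertex_sub[OF d] that by blast
  have "(\<Sum>x\<in>vertex B d. n x) = (\<Sum>x\<in>vertex B d. n' x) + (\<Sum>x\<in>vertex B d. c x)"
    unfolding sum.distrib[symmetric] by (rule sum.cong) (simp_all add: v assms(3))
  moreover have "(\<Sum>x\<in>vertex B d. n (alpha B x))
      = (\<Sum>x\<in>vertex B d. n' (alpha B x)) + (\<Sum>x\<in>vertex B d. c (alpha B x))"
    unfolding sum.distrib[symmetric] by (rule sum.cong) (simp_all add: v alpha_closed assms(3))
  ultimately show "(\<Sum>x\<in>vertex B d. n' x) = (\<Sum>x\<in>vertex B d. n' (alpha B x))"
    using assms(1,2) d unfolding conserved_def by fastforce
qed

lemma conserved_indicator:
  assumes "\<And>d. d \<in> darts B \<Longrightarrow> card {x \<in> vertex B d. x \<in> C} = card {x \<in> vertex B d. alpha B x \<in> C}"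
  shows "conserved (\<lambda>d. if d \<in> C then 1 else 0)"
  unfolding conserved_def
proof
  fix d assume d: "d \<in> darts B"
  have "(\<Sum>x\<in>vertex B d. if Q x then 1 else 0::nat) = card {x \<in> vertex B d. Q x}" for Q
    using vertex_finite[OF d] by (simp add: sum.If_cases Int_def)
  then show "(\<Sum>x\<in>vertex B d. if x \<in> C then 1 else 0::nat) = (\<Sum>x\<in>vertex B d. if alpha B x \<in> C then 1 else 0)"
    using assms[OF d] by simp
qed

definition closed_walk :: "'h list \<Rightarrow> bool" where
  "closed_walk cs \<longleftrightarrow> cs \<noteq> [] \<and> set cs \<subseteq> darts B \<and>
     (\<forall>i<length cs. cs ! (Suc i mod length cs) \<in> vertex B (alpha B (cs ! i)))"

text \<open>The cyclic shift of indices matches each arrival at the vertex with the departure that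
  follows it.\<close>

lemma closed_walk_balanced:
  assumes "closed_walk cs" "distinct cs" "d \<in> darts B"
  shows "card {x \<in> vertex B d. x \<in> set cs} = card {x \<in> vertex B d. alpha B x \<in> set cs}"
proof -
  let ?n = "length cs" and ?v = "vertex B d"
  have csD: "i < ?n \<Longrightarrow> cs ! i \<in> darts B" for i using assms(1) unfolding closed_walk_def by auto
  have inj: "inj_on ((!) cs) I" if "I \<subseteq> {..<?n}" for I
    using inj_on_nth[OF assms(2), of I] that by blast
  have "{x \<in> ?v. x \<in> set cs} = (!) cs ` {i. i < ?n \<and> cs ! i \<in> ?v}"
    by (auto simp: in_set_conv_nth)
  then have "card {x \<in> ?v. x \<in> set cs} = card {i. i < ?n \<and> cs ! i \<in> ?v}"
    using card_image[OF inj, of "{i. i < ?n \<and> cs ! i \<in> ?v}"] by fastforce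
  also have "\<dots> = card {i. i < ?n \<and> cs ! (Suc i mod ?n) \<in> ?v}"
  proof -
    have eq: "(\<lambda>i. Suc i mod ?n) ` {..<?n} = {..<?n}" using bij_betw_Suc_mod[of ?n] by (simp add: bij_betw_def)
    have *: "\<exists>i<?n. Suc i mod ?n = j" if "j < ?n" for j
    proof -
      have "j \<in> (\<lambda>i. Suc i mod ?n) ` {..<?n}" unfolding eq using that by simp
      then show ?thesis by auto
    qed
    have "{i. i < ?n \<and> cs ! i \<in> ?v} = (\<lambda>i. Suc i mod ?n) ` {i. i < ?n \<and> cs ! (Suc i mod ?n) \<in> ?v}"
    proof (intro equalityI subsetI)
      fix j assume j: "j \<in> {i. i < ?n \<and> cs ! i \<in> ?v}"
      then obtain i where "i < ?n" "Suc i mod ?n = j" using * by blast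
      then show "j \<in> (\<lambda>i. Suc i mod ?n) ` {i. i < ?n \<and> cs ! (Suc i mod ?n) \<in> ?v}"
        using j by (intro image_eqI[of _ _ i]) auto
    next
      fix j assume "j \<in> (\<lambda>i. Suc i mod ?n) ` {i. i < ?n \<and> cs ! (Suc i mod ?n) \<in> ?v}"
      then obtain i where "i < ?n" "cs ! (Suc i mod ?n) \<in> ?v" "j = Suc i mod ?n" by blast
      moreover have "Suc i mod ?n < ?n" using calculation(1) mod_less_divisor[of ?n "Suc i"] by linarith
      ultimately show "j \<in> {i. i < ?n \<and> cs ! i \<in> ?v}" by simp
    qed
    moreover have "inj_on (\<lambda>i. Suc i mod ?n) {i. i < ?n \<and> cs ! (Suc i mod ?n) \<in> ?v}"
      using bij_betw_Suc_mod[of ?n] unfolding bij_betw_def by (elim conjE inj_on_subset) auto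
    ultimately show ?thesis using card_image by fastforce
  qed
  also have "\<dots> = card {i. i < ?n \<and> alpha B (cs ! i) \<in> ?v}"
  proof -
    have "cs ! (Suc i mod ?n) \<in> ?v \<longleftrightarrow> alpha B (cs ! i) \<in> ?v" if i: "i < ?n" for i
    proof -
      have "cs ! (Suc i mod ?n) \<in> vertex B (alpha B (cs ! i))"
        using assms(1) i unfolding closed_walk_def by blast
      then have "vertex B (cs ! (Suc i mod ?n)) = vertex B (alpha B (cs ! i))"
        using vertex_eq alpha_closed csD[OF i] by blast
      then show ?thesis unfolding vertex_eq_iff[OF assms(3), symmetric] by simp
    qed
    then show ?thesis by (intro arg_cong[of _ _ card]) auto
  qed
  also have "\<dots> = card {x \<in> ?v. alpha B x \<in> set cs}"
  proof -
    have "{x \<in> ?v. alpha B x \<in> set cs} = (\<lambda>i. alpha B (cs ! i)) ` {i. i < ?n \<and> alpha B (cs ! i) \<in> ?v}"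
    proof (intro equalityI subsetI)
      fix x assume x: "x \<in> {x \<in> ?v. alpha B x \<in> set cs}"
      then obtain i where i: "i < ?n" "alpha B x = cs ! i" by (auto simp: in_set_conv_nth)
      have "x \<in> darts B" using x vertex_sub[OF assms(3)] by blast
      then have "x = alpha B (cs ! i)" using i(2) alpha_alpha by metis
      then show "x \<in> (\<lambda>i. alpha B (cs ! i)) ` {i. i < ?n \<and> alpha B (cs ! i) \<in> ?v}" using i(1) x by blast
    next
      fix x assume "x \<in> (\<lambda>i. alpha B (cs ! i)) ` {i. i < ?n \<and> alpha B (cs ! i) \<in> ?v}"
      then obtain i where i: "i < ?n" "x = alpha B (cs ! i)" "x \<in> ?v" by blast
      then show "x \<in> {x \<in> ?v. alpha B x \<in> set cs}" using alpha_alpha[OF csD[OF i(1)]] by simp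
    qed
    moreover have "inj_on (\<lambda>i. alpha B (cs ! i)) {i. i < ?n \<and> alpha B (cs ! i) \<in> ?v}"
    proof (rule inj_onI)
      fix i j assume i: "i \<in> {i. i < ?n \<and> alpha B (cs ! i) \<in> ?v}" and j: "j \<in> {i. i < ?n \<and> alpha B (cs ! i) \<in> ?v}"
        and e: "alpha B (cs ! i) = alpha B (cs ! j)"
      have "cs ! i = cs ! j" using alpha_inj[OF _ _ e] csD i j by simp
      then show "i = j" using i j assms(2) by (simp add: nth_eq_iff_index_eq)
    qed
    ultimately show ?thesis using card_image by fastforce
  qed
  finally show ?thesis .
qed

lemma circuit_closed_walk:
  assumes "is_circuit B cs"
  shows "closed_walk cs" "distinct cs"
  using assms unfolding is_circuit_def closed_walk_def by (auto simp: distinct_map)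

lemma circuit_cycle_space:
  assumes "is_circuit B cs"
  shows "set cs \<union> alpha B ` set cs \<in> cycle_space"
proof -
  let ?C = "set cs" let ?S = "?C \<union> alpha B ` ?C"
  have C: "?C \<subseteq> darts B" "\<And>x. x \<in> ?C \<Longrightarrow> alpha B x \<notin> ?C"
    using assms unfolding is_circuit_def by auto
  have in_img: "x \<in> alpha B ` ?C \<longleftrightarrow> alpha B x \<in> ?C" if "x \<in> darts B" for x
  proof
    assume "x \<in> alpha B ` ?C"
    then obtain y where "y \<in> ?C" "x = alpha B y" by blast
    then show "alpha B x \<in> ?C" using C(1) alpha_alpha by (metis subsetD)
  next
    assume "alpha B x \<in> ?C"
    then show "x \<in> alpha B ` ?C" using alpha_alpha[OF that] by (metis imageI)
  qed
  have S_sub: "x \<in> darts B" if "x \<in> ?S" for x using that C(1) alpha_closed by auto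
  have "?S \<in> edge_sets"
    unfolding edge_sets_def using S_sub alpha_ne C(1) alpha_alpha by (auto simp: image_iff)
  moreover have "even (card (vertex B d \<inter> ?S))" if d: "d \<in> darts B" for d
  proof -
    let ?v = "vertex B d"
    have vD: "x \<in> darts B" if "x \<in> ?v" for x using vertex_sub[OF d] that by blast
    have "?v \<inter> ?S = {x \<in> ?v. x \<in> ?C} \<union> {x \<in> ?v. alpha B x \<in> ?C}" using in_img vD by auto
    also have "card \<dots> = card {x \<in> ?v. x \<in> ?C} + card {x \<in> ?v. alpha B x \<in> ?C}"
      using vertex_finite[OF d] C(2) by (intro card_Un_disjoint) auto
    finally show ?thesis
      using closed_walk_balanced[OF circuit_closed_walk[OF assms] d] by simp
  qed
  ultimately show ?thesis unfolding cycle_space_def odd_vertices_def by auto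
qed

lemma planemap_euler:
  assumes "is_planemap B"
  shows "card (vertex B ` darts B) + card (face B ` darts B)
      = card {d\<in>darts B. alpha B d \<noteq> d} div 2 + 2"
proof -
  have eq: "{d\<in>darts B. alpha B d \<noteq> d} = darts B" using alpha_ne by auto
  have "int (card (vertex B ` darts B)) - int (card (darts B) div 2) + int (card (face B ` darts B)) = 2"
    using assms unfolding is_planemap_def by blast
  then show ?thesis unfolding eq by linarith
qed

section \<open>The right side of a circuit\<close>

definition right_region :: "'h list \<Rightarrow> 'h set" where
  "right_region cs = {x. (alpha B (hd cs), x) \<in> (dual_rel B cs)\<^sup>*}"

lemma right_region_face:
  assumes "d \<in> darts B" "e \<in> darts B" "face B d = face B e"
  shows "d \<in> right_region cs \<longleftrightarrow> e \<in> right_region cs"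
proof -
  have "e \<in> face B d" unfolding assms(3) by simp
  moreover have "d \<in> face B e" unfolding assms(3)[symmetric] by simp
  ultimately have "(d, e) \<in> dual_rel B cs" "(e, d) \<in> dual_rel B cs"
    unfolding dual_rel_def using assms(1,2) by simp_all
  then show ?thesis unfolding right_region_def by (auto intro: rtrancl_into_rtrancl)
qed

lemma right_region_edge:
  assumes "d \<in> darts B" "d \<notin> set cs" "alpha B d \<notin> set cs"
  shows "d \<in> right_region cs \<longleftrightarrow> alpha B d \<in> right_region cs"
proof -
  have "(d, alpha B d) \<in> dual_rel B cs" "(alpha B d, d) \<in> dual_rel B cs"
    unfolding dual_rel_def using assms by (auto simp: alpha_closed alpha_alpha)
  then show ?thesis unfolding right_region_def by (auto intro: rtrancl_into_rtrancl)
qed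

lemma right_region_sigma:
  assumes "d \<in> darts B"
  shows "sigma B d \<in> right_region cs \<longleftrightarrow> alpha B d \<in> right_region cs"
  using assms by (intro right_region_face) (simp_all add: sigma_closed alpha_closed face_sigma)

lemma ccw_iff_right_region:
  assumes "is_circuit B cs" "f \<in> darts B"
  shows "ccw_wrt B (face B f) cs \<longleftrightarrow> f \<in> right_region cs"
proof
  assume "ccw_wrt B (face B f) cs"
  then obtain x where x: "x \<in> face B f" "x \<in> right_region cs"
    unfolding ccw_wrt_def right_region_def by blast
  have "x \<in> darts B" using face_sub[OF assms(2)] x(1) by blast
  from right_region_face[OF assms(2) this face_eq[OF assms(2) x(1), symmetric]]
  show "f \<in> right_region cs" using x(2) by blast
next
  assume "f \<in> right_region cs"
  then show "ccw_wrt B (face B f) cs" unfolding ccw_wrt_def right_region_def using face_self by blast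
qed

text \<open>From one edge of the circuit to the next, the right side is carried through the sector
  between the arriving half-edge \<open>a\<close> and the departing half-edge \<open>k\<close>,
  which contains no other edge of the circuit.\<close>

lemma right_region_circuit:
  assumes "is_circuit B cs" "k \<in> set cs"
  shows "alpha B k \<in> right_region cs"
proof -
  let ?n = "length cs"
  have cs: "cs \<noteq> []" "set cs \<subseteq> darts B" "distinct (map (vertex B) cs)"
    "\<And>i. i < ?n \<Longrightarrow> cs ! (Suc i mod ?n) \<in> vertex B (alpha B (cs ! i))"
    using assms(1) unfolding is_circuit_def by auto
  have csD: "i < ?n \<Longrightarrow> cs ! i \<in> darts B" for i using cs(2) by auto
  have vinj: "i = j" if "i < ?n" "j < ?n" "vertex B (cs ! i) = vertex B (cs ! j)" for i j
    using cs(3) that by (simp add: distinct_conv_nth) blast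
  have "alpha B (cs ! i) \<in> right_region cs" if "i < ?n" for i
    using that
  proof (induction i)
    case 0
    then show ?case unfolding right_region_def using cs(1) by (simp add: hd_conv_nth)
  next
    case (Suc i)
    define k a where "k = cs ! Suc i" and "a = alpha B (cs ! i)"
    have kD: "k \<in> darts B" and aD: "a \<in> darts B"
      unfolding k_def a_def using csD Suc.prems alpha_closed by simp_all
    have aR: "a \<in> right_region cs" using Suc unfolding a_def by simp
    have "k \<in> vertex B a" using cs(4)[of i] Suc.prems unfolding k_def a_def by simp
    then have va: "vertex B k = vertex B a" using vertex_eq[OF aD] by blast
    then have "a \<in> vertex B k" by simp
    then have ex: "\<exists>t. 0 < t \<and> (sigma B ^^ t) k = a" using vertex_positive_power[OF kD] by blast
    define t where "t = (LEAST t. 0 < t \<and> (sigma B ^^ t) k = a)"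
    have t: "0 < t" "(sigma B ^^ t) k = a" unfolding t_def using LeastI_ex[OF ex] by auto
    have tmin: "(sigma B ^^ u) k \<noteq> a" if "0 < u" "u < t" for u
      using not_less_Least[of u "\<lambda>t. 0 < t \<and> (sigma B ^^ t) k = a"] that unfolding t_def by blast
    \<comment> \<open>A further departure or arrival in the sector would be a second visit to the
      vertex; a return to \<open>k\<close> or \<open>a\<close> themselves is excluded by the
      minimality of \<open>t\<close>.\<close>
    have off: "(sigma B ^^ u) k \<notin> set cs \<and> alpha B ((sigma B ^^ u) k) \<notin> set cs" if u: "0 < u" "u < t" for u
    proof -
      let ?x = "(sigma B ^^ u) k"
      have xD: "?x \<in> darts B" using funpow_sigma_closed[OF kD] .
      have vx: "vertex B ?x = vertex B k" using vertex_eq[OF kD funpow_vertex] .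
      have "?x \<notin> set cs"
      proof
        assume "?x \<in> set cs"
        then obtain j where j: "j < ?n" "?x = cs ! j" by (auto simp: in_set_conv_nth)
        then have "j = Suc i" using vinj[of j "Suc i"] Suc.prems vx unfolding k_def by simp
        then have "?x = k" using j unfolding k_def by simp
        have "(sigma B ^^ (t - u)) ?x = a"
          using t(2) u by (metis comp_apply funpow_add le_add_diff_inverse2 less_imp_le)
        then show False using tmin[of "t - u"] u \<open>?x = k\<close> by simp
      qed
      moreover have "alpha B ?x \<notin> set cs"
      proof
        assume "alpha B ?x \<in> set cs"
        then obtain j where j: "j < ?n" "alpha B ?x = cs ! j" by (auto simp: in_set_conv_nth)
        then have ax: "alpha B (cs ! j) = ?x" using alpha_alpha[OF xD] by simp
        have "vertex B (cs ! (Suc j mod ?n)) = vertex B ?x"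
          using cs(4)[OF j(1)] vertex_eq[OF xD] unfolding ax by blast
        then have "Suc j mod ?n = Suc i mod ?n"
          using vinj[of "Suc j mod ?n" "Suc i"] Suc.prems vx mod_less_divisor[of ?n "Suc j"] cs(1)
          unfolding k_def by simp
        then have "j = i" using bij_betw_Suc_mod[of ?n] j(1) Suc.prems
          unfolding bij_betw_def inj_on_def by simp
        then show False using ax tmin[OF u] unfolding a_def by simp
      qed
      ultimately show ?thesis by blast
    qed
    have "(sigma B ^^ u) k \<in> right_region cs" if "1 \<le> u" "u \<le> t" for u
      using that(2,1)
    proof (induction u rule: inc_induct)
      case base
      then show ?case using t(2) aR by simp
    next
      case (step u)
      let ?x = "(sigma B ^^ u) k"
      have xD: "?x \<in> darts B" using funpow_sigma_closed[OF kD] .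
      have "sigma B ?x \<in> right_region cs" using step by simp
      then have "alpha B ?x \<in> right_region cs" using right_region_sigma[OF xD] by blast
      moreover have "?x \<notin> set cs" "alpha B ?x \<notin> set cs" using off[of u] step by auto
      ultimately show ?case using right_region_edge[OF xD] by blast
    qed
    from this[of 1] have "sigma B k \<in> right_region cs" using t(1) by simp
    then show ?case using right_region_sigma[OF kD] unfolding k_def by blast
  qed
  then show ?thesis using assms(2) by (auto simp: in_set_conv_nth)
qed

text \<open>The Jordan curve theorem for circuits; this is where planarity enters.\<close>

lemma right_region_left:
  assumes "is_planemap B" "is_circuit B cs" "k \<in> set cs"
  shows "k \<notin> right_region cs"
proof
  assume k: "k \<in> right_region cs"
  have C: "set cs \<subseteq> darts B" using assms(2) unfolding is_circuit_def by auto
  have conn: "connected_prem B" using assms(1) unfolding is_planemap_def by blast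
  \<comment> \<open>Planarity makes the circuit the boundary of a set \<open>A\<close> of faces.
    Membership in \<open>A\<close> is constant along dual paths that avoid the circuit, yet differs
    on the two sides of \<open>k\<close>.\<close>
  obtain A where A: "set cs \<union> alpha B ` set cs = coboundary A"
    using planar_cycle_coboundary[OF conn circuit_cycle_space[OF assms(2)] planemap_euler[OF assms(1)]] by blast
  have "(face B x \<in> A) = (face B (alpha B (hd cs)) \<in> A)" if "x \<in> right_region cs" for x
    using that unfolding right_region_def mem_Collect_eq
  proof (induction rule: rtrancl_induct)
    case (step y z)
    have D: "y \<in> darts B" "z \<in> darts B" using step(2) unfolding dual_rel_def by auto
    show ?case
    proof (cases "z \<in> face B y")
      case True
      show ?thesis unfolding face_eq[OF D(1) True] by (rule step.IH)
    next
      case False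
      then have z: "z = alpha B y" "y \<notin> set cs" "z \<notin> set cs" using step(2) unfolding dual_rel_def by auto
      have "y \<notin> alpha B ` set cs"
      proof
        assume "y \<in> alpha B ` set cs"
        then obtain w where "w \<in> set cs" "y = alpha B w" by blast
        then show False using z alpha_alpha[of w] C by auto
      qed
      then have "y \<notin> set cs \<union> alpha B ` set cs" using z(2) by simp
      then have "y \<notin> coboundary A" unfolding A .
      then have "(face B y \<in> A) = (face B z \<in> A)" using D(1) z(1) unfolding coboundary_def by simp
      then show ?thesis using step.IH by simp
    qed
  qed simp
  then have "(face B k \<in> A) = (face B (alpha B k) \<in> A)"
    using k right_region_circuit[OF assms(2,3)] by blast
  moreover have "k \<in> coboundary A" unfolding A[symmetric] using assms(3) by simp
  ultimately show False unfolding coboundary_def by blast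
qed

text \<open>Following successors in a finite set must repeat, which gives a closed walk; a shortest
  closed walk in \<open>S\<close> visits no vertex twice, as the stretch between two visits would be
  shorter.\<close>

lemma exists_circuit:
  assumes "S \<subseteq> darts B" "S \<noteq> {}" "\<And>d. d \<in> S \<Longrightarrow> \<exists>e\<in>S. e \<in> vertex B (alpha B d)"
    and "\<And>d. d \<in> S \<Longrightarrow> alpha B d \<notin> S" "\<And>d. d \<in> S \<Longrightarrow> ingoing B (alpha B d)"
  shows "\<exists>cs. is_circuit B cs \<and> set cs \<subseteq> S"
proof -
  obtain f where f: "\<And>d. d \<in> S \<Longrightarrow> f d \<in> S" "\<And>d. d \<in> S \<Longrightarrow> f d \<in> vertex B (alpha B d)"
    using assms(3) by metis
  obtain x0 where x0: "x0 \<in> S" using assms(2) by blast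
  have fS: "(f ^^ i) x \<in> S" if "x \<in> S" for i x by (induction i) (auto simp: f(1) that)
  have "finite S" using assms(1) finite_darts finite_subset by blast
  then have "\<not> inj (\<lambda>i. (f ^^ i) x0)"
    using fS[OF x0] finite_imageD[of "\<lambda>i. (f ^^ i) x0" UNIV] finite_subset[of "range (\<lambda>i. (f ^^ i) x0)" S]
      infinite_UNIV_nat by blast
  then obtain a b where ab: "(f ^^ a) x0 = (f ^^ b) x0" "a \<noteq> b" unfolding inj_def by blast
  obtain i j where ij: "(f ^^ i) x0 = (f ^^ j) x0" "i < j"
    using ab by (metis nat_neq_iff)
  define y m where "y = (f ^^ i) x0" and "m = j - i"
  have y: "y \<in> S" "m > 0" "(f ^^ m) y = y"
    unfolding y_def m_def using fS[OF x0] ij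
    by (simp_all del: funpow.simps) (metis comp_apply funpow_add le_add_diff_inverse2 less_imp_le)
  let ?W = "\<lambda>cs. closed_walk cs \<and> set cs \<subseteq> S"
  have "?W (map (\<lambda>i. (f ^^ i) y) [0..<m])"
  proof -
    have "(f ^^ (Suc u mod m)) y \<in> vertex B (alpha B ((f ^^ u) y))" if "u < m" for u
    proof -
      have "(f ^^ (Suc u mod m)) y = f ((f ^^ u) y)"
      proof (cases "Suc u = m")
        case True
        then show ?thesis using y(3) by (auto simp: True[symmetric])
      qed (use that in simp)
      then show ?thesis using f(2)[OF fS[OF y(1)]] by simp
    qed
    then show ?thesis unfolding closed_walk_def using y fS[OF y(1)] assms(1) by auto
  qed
  then obtain cs where cs: "?W cs" "\<And>ds. ?W ds \<Longrightarrow> length cs \<le> length ds"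
    using ex_has_least_nat[of ?W _ length] by blast
  have step: "cs ! (Suc u mod length cs) \<in> vertex B (alpha B (cs ! u))" if "u < length cs" for u
    using cs(1) that unfolding closed_walk_def by blast
  have csD: "cs ! u \<in> darts B" if "u < length cs" for u using cs(1) assms(1) that by (meson nth_mem subsetD)
  have no: False if "i < j" "j < length cs" "vertex B (cs ! i) = vertex B (cs ! j)" for i j
  proof -
    \<comment> \<open>The stretch from position \<open>i\<close> to just before \<open>j\<close>:
      its last half-edge leads to the vertex of \<open>cs ! j\<close>, which is that of
      \<open>cs ! i\<close>, so it closes up.\<close>
    define ds where "ds = take (j - i) (drop i cs)"
    have len: "length ds = j - i" unfolding ds_def using that by simp
    have nth: "ds ! u = cs ! (i + u)" if "u < j - i" for u
      unfolding ds_def using that \<open>j < length cs\<close> by simp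
    have "ds ! (Suc u mod length ds) \<in> vertex B (alpha B (ds ! u))" if u: "u < length ds" for u
    proof -
      have iu: "Suc (i + u) < length cs" using u len that(1) \<open>j < length cs\<close> by simp
      have st: "cs ! Suc (i + u) \<in> vertex B (alpha B (ds ! u))"
        using step[of "i + u"] iu nth[of u] u len by simp
      show ?thesis
      proof (cases "Suc u = j - i")
        case True
        then have "Suc (i + u) = j" by simp
        then have "cs ! j \<in> vertex B (alpha B (ds ! u))" using st by simp
        moreover have aD: "alpha B (ds ! u) \<in> darts B"
          using alpha_closed[OF csD[of "i + u"]] iu nth[of u] u len by simp
        ultimately have "vertex B (cs ! j) = vertex B (alpha B (ds ! u))" by (intro vertex_eq)
        with \<open>vertex B (cs ! i) = vertex B (cs ! j)\<close> have "vertex B (cs ! i) = vertex B (alpha B (ds ! u))" by (rule trans)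
        then have "cs ! i \<in> vertex B (alpha B (ds ! u))" using vertex_self by metis
        then show ?thesis using True len nth[of 0] \<open>i < j\<close> by simp
      next
        case False
        then show ?thesis using st nth[of "Suc u"] u len by simp
      qed
    qed
    moreover have "set ds \<subseteq> set cs" unfolding ds_def by (meson set_take_subset set_drop_subset subset_trans)
    moreover have "ds \<noteq> []" using len that(1) by auto
    ultimately have "?W ds" using cs(1) assms(1) unfolding closed_walk_def by blast
    then show False using cs(2) len that(1,2) by fastforce
  qed
  have "distinct (map (vertex B) cs)"
    unfolding distinct_conv_nth using no by (auto simp: linorder_neq_iff)
  then have "is_circuit B cs" unfolding is_circuit_def
    using cs(1) step assms(4,5) unfolding closed_walk_def by (meson nth_mem subset_iff)
  then show ?thesis using cs(1) by blast
qed

section \<open>Minimality makes the parent relation acyclic\<close>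

text \<open>A directed circulation is a sum of circuits and of edges traversed back and forth, so it is the
  coboundary of a function on the faces (written as a function on half-edges).  If no circuit is
  counterclockwise, each circuit contributes \<open>0\<close> on its left and \<open>-1\<close> on its right.\<close>

lemma circulation_potential:
  assumes "is_planemap B" "f \<in> darts B" "minimal_wrt B (face B f)"
    and "conserved n" "\<And>d. d \<in> darts B \<Longrightarrow> n d > 0 \<Longrightarrow> ingoing B (alpha B d)"
  shows "\<exists>g :: 'h \<Rightarrow> int. g f = 0 \<and> (\<forall>d\<in>darts B. g d \<le> 0 \<and> g (sigma B d) = g (alpha B d)
    \<and> g d - g (alpha B d) = int (n d) - int (n (alpha B d)))"
  using assms(4,5)
proof (induction "\<Sum>d\<in>darts B. n d" arbitrary: n rule: less_induct)
  case less
  note cons = less.prems(1) and ing = less.prems(2)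
  have smaller: "(\<Sum>d\<in>darts B. n' d) < (\<Sum>d\<in>darts B. n d)"
    if "\<And>d. d \<in> darts B \<Longrightarrow> n d = n' d + c d" "x \<in> darts B" "c x > 0" for n' c x
    using finite_darts that by (intro sum_strict_mono_ex1) auto
  show ?case
  proof (cases "\<exists>d\<in>darts B. n d > 0")
    case False
    then show ?thesis by (intro exI[of _ "\<lambda>_. 0"]) (auto simp: alpha_closed)
  next
    case pos: True
    show ?thesis
    proof (cases "\<exists>x\<in>darts B. n x > 0 \<and> n (alpha B x) > 0")
      case True
      \<comment> \<open>An edge traversed both ways: dropping one traversal in each direction
        preserves conservation and the net flow, so the potential of the rest serves
        unchanged.\<close>
      then obtain x where x: "x \<in> darts B" "n x > 0" "n (alpha B x) > 0" by blast
      define c :: "'h \<Rightarrow> nat" where "c = (\<lambda>d. if d \<in> {x, alpha B x} then 1 else 0)"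
      have sw: "alpha B d \<in> {x, alpha B x} \<longleftrightarrow> d \<in> {x, alpha B x}" if "d \<in> darts B" for d
        using that x(1) alpha_alpha by (metis insert_iff singletonD)
      then have ca: "c (alpha B d) = c d" if "d \<in> darts B" for d unfolding c_def using that by simp
      define n' where "n' = (\<lambda>d. n d - c d)"
      have nd: "n d = n' d + c d" for d unfolding n'_def c_def using x by auto
      have "conserved c" unfolding c_def
      proof (rule conserved_indicator)
        fix d assume d: "d \<in> darts B"
        have "x' \<in> vertex B d \<Longrightarrow> x' \<in> darts B" for x' using vertex_sub[OF d] by blast
        then show "card {y \<in> vertex B d. y \<in> {x, alpha B x}} = card {y \<in> vertex B d. alpha B y \<in> {x, alpha B x}}"
          using sw by (intro arg_cong[of _ _ card] Collect_cong conj_cong) simp_all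
      qed
      then have "conserved n'" using conserved_diff[OF cons] nd by blast
      moreover have "(\<Sum>d\<in>darts B. n' d) < (\<Sum>d\<in>darts B. n d)"
        by (rule smaller[of n' c x]) (use nd x(1) in \<open>simp_all add: c_def\<close>)
      moreover have "ingoing B (alpha B d)" if "d \<in> darts B" "n' d > 0" for d
        using that ing[of d] unfolding n'_def by simp
      ultimately obtain g :: "'h \<Rightarrow> int" where g: "g f = 0" "\<And>d. d \<in> darts B \<Longrightarrow> g d \<le> 0"
        "\<And>d. d \<in> darts B \<Longrightarrow> g (sigma B d) = g (alpha B d)"
        "\<And>d. d \<in> darts B \<Longrightarrow> g d - g (alpha B d) = int (n' d) - int (n' (alpha B d))"
        using less.hyps[of n'] by blast
      have "g d - g (alpha B d) = int (n d) - int (n (alpha B d))" if "d \<in> darts B" for d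
        using g(4)[OF that] nd[of d] nd[of "alpha B d"] ca[OF that] by simp
      then show ?thesis using g(1-3) by blast
    next
      case False
      \<comment> \<open>No edge is used in both directions any more, so the support contains no two
        opposite half-edges and a circuit can be split off.\<close>
      define S where "S = {d\<in>darts B. n d > 0}"
      have "\<exists>e\<in>S. e \<in> vertex B (alpha B d)" if "d \<in> S" for d
      proof -
        have d: "d \<in> darts B" "n d > 0" using that unfolding S_def by auto
        let ?v = "vertex B (alpha B d)"
        have "n (alpha B (alpha B d)) \<le> (\<Sum>x\<in>?v. n (alpha B x))"
          using vertex_finite[OF alpha_closed[OF d(1)]] by (intro member_le_sum) auto
        then have "(\<Sum>x\<in>?v. n x) > 0"
          using cons d alpha_alpha[OF d(1)] alpha_closed[OF d(1)] unfolding conserved_def by fastforce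
        then have "\<not> (\<forall>x\<in>?v. n x = 0)" using sum.neutral[of ?v n] by linarith
        then obtain e where "e \<in> ?v" "n e > 0" by auto
        then show ?thesis unfolding S_def using vertex_sub[OF alpha_closed[OF d(1)]] by blast
      qed
      moreover have "alpha B d \<notin> S" if "d \<in> S" for d using that False unfolding S_def by auto
      moreover have "ingoing B (alpha B d)" if "d \<in> S" for d using that ing unfolding S_def by auto
      ultimately obtain cs where cs: "is_circuit B cs" "set cs \<subseteq> S"
        using exists_circuit[of S] pos unfolding S_def by blast
      have csD: "set cs \<subseteq> darts B" using cs(2) unfolding S_def by auto
      have csne: "cs \<noteq> []" and csa: "\<And>d. d \<in> set cs \<Longrightarrow> alpha B d \<notin> set cs"
        using cs(1) unfolding is_circuit_def by auto
      define c :: "'h \<Rightarrow> nat" where "c = (\<lambda>d. if d \<in> set cs then 1 else 0)"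
      define n' where "n' = (\<lambda>d. n d - c d)"
      have nd: "n d = n' d + c d" for d unfolding n'_def c_def using cs(2) unfolding S_def by auto
      have "conserved c" unfolding c_def
        by (rule conserved_indicator) (rule closed_walk_balanced[OF circuit_closed_walk[OF cs(1)]])
      then have "conserved n'" using conserved_diff[OF cons] nd by blast
      moreover have "(\<Sum>d\<in>darts B. n' d) < (\<Sum>d\<in>darts B. n d)"
        by (rule smaller[of n' c "hd cs"]) (use nd csne csD in \<open>auto simp: c_def\<close>)
      moreover have "ingoing B (alpha B d)" if "d \<in> darts B" "n' d > 0" for d
        using that ing[of d] unfolding n'_def by simp
      ultimately obtain g :: "'h \<Rightarrow> int" where g: "g f = 0" "\<And>d. d \<in> darts B \<Longrightarrow> g d \<le> 0"
        "\<And>d. d \<in> darts B \<Longrightarrow> g (sigma B d) = g (alpha B d)"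
        "\<And>d. d \<in> darts B \<Longrightarrow> g d - g (alpha B d) = int (n' d) - int (n' (alpha B d))"
        using less.hyps[of n'] by blast
      let ?R = "right_region cs"
      \<comment> \<open>Subtracting 1 on the right, rather than adding 1 on the left, keeps the
        value at \<open>f\<close> equal to 0, because \<open>f\<close> is not on the right.\<close>
      define r :: "'h \<Rightarrow> int" where "r = (\<lambda>d. if d \<in> ?R then -1 else 0)"
      have "f \<notin> ?R" using assms(3) cs(1) ccw_iff_right_region[OF cs(1) assms(2)]
        unfolding minimal_wrt_def by blast
      then have "r f = 0" unfolding r_def by simp
      have r_sigma: "r (sigma B d) = r (alpha B d)" if "d \<in> darts B" for d
        unfolding r_def using right_region_sigma[OF that] by simp
      have r_jump: "r d - r (alpha B d) = int (c d) - int (c (alpha B d))" if d: "d \<in> darts B" for d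
      proof -
        consider "d \<in> set cs" | "alpha B d \<in> set cs" | "d \<notin> set cs" "alpha B d \<notin> set cs" by blast
        then show ?thesis
        proof cases
          case 1
          then show ?thesis unfolding r_def c_def
            using csa right_region_circuit[OF cs(1)] right_region_left[OF assms(1) cs(1)] by simp
        next
          case 2
          then show ?thesis unfolding r_def c_def
            using csa[OF 2] right_region_circuit[OF cs(1) 2] right_region_left[OF assms(1) cs(1) 2]
            by (simp add: alpha_alpha[OF d])
        next
          case 3
          then show ?thesis unfolding r_def c_def using right_region_edge[OF d 3] by simp
        qed
      qed
      have "g d + r d - (g (alpha B d) + r (alpha B d)) = int (n d) - int (n (alpha B d))" if "d \<in> darts B" for d
        using g(4)[OF that] r_jump[OF that] nd[of d] nd[of "alpha B d"] by simp
      moreover have "g d + r d \<le> 0" if "d \<in> darts B" for d using g(2)[OF that] unfolding r_def by simp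
      ultimately show ?thesis using g(1,3) r_sigma \<open>r f = 0\<close>
        by (intro exI[of _ "\<lambda>d. g d + r d"]) simp
    qed
  qed
qed

theorem acyclic_par:
  assumes "inB0 B"
  shows "acyclic par"
proof -
  have pm: "is_planemap B" and rD: "root B \<in> darts B"
    and src: "\<And>d. d \<in> vertex B (root B) \<Longrightarrow> \<not> ingoing B d"
    and acc: "\<And>d. d \<in> darts B \<Longrightarrow> (root B, d) \<in> (acc_rel B)\<^sup>*"
    using assms unfolding inB0_def by auto
  obtain f where f: "f \<in> vertex B (root B)" "minimal_wrt B (face B f)"
    using assms unfolding inB0_def by auto
  \<comment> \<open>The half-edges on all cycles of \<open>par\<close> together. Parents are unique
    and \<open>C\<close> is finite, so the parent map \<open>p\<close> permutes
    \<open>C\<close>.\<close>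
  define C where "C = {j. (j, j) \<in> par\<^sup>+}"
  have parD: "c \<in> darts B" "i \<in> darts B" "ingoing B c" "ingoing B i" if "(c, i) \<in> par" for c i
    using that unfolding par_def by auto
  have C_succ: "\<exists>i. (c, i) \<in> par \<and> i \<in> C" if "c \<in> C" for c
  proof -
    have "(c, c) \<in> par\<^sup>+" using that unfolding C_def by simp
    then obtain i where i: "(c, i) \<in> par" "(i, c) \<in> par\<^sup>*" by (meson tranclD)
    then have "(i, i) \<in> par\<^sup>+" by (meson rtrancl_into_trancl1)
    then show ?thesis using i(1) unfolding C_def by blast
  qed
  have C_pred: "\<exists>c. (c, i) \<in> par \<and> c \<in> C" if "i \<in> C" for i
  proof -
    have "(i, i) \<in> par\<^sup>+" using that unfolding C_def by simp
    then obtain c where c: "(i, c) \<in> par\<^sup>*" "(c, i) \<in> par" by (meson tranclD2)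
    then have "(c, c) \<in> par\<^sup>+" by (meson rtrancl_into_trancl2)
    then show ?thesis using c(2) unfolding C_def by blast
  qed
  have CD: "c \<in> darts B" "ingoing B c" if "c \<in> C" for c using C_succ[OF that] parD by auto
  have finC: "finite C" using CD finite_darts by (meson finite_subset subsetI)
  obtain p where p: "\<And>c. c \<in> C \<Longrightarrow> (c, p c) \<in> par" "\<And>c. c \<in> C \<Longrightarrow> p c \<in> C" using C_succ by metis
  have "p ` C = C"
  proof (intro equalityI subsetI)
    fix i assume "i \<in> C"
    then obtain c where "(c, i) \<in> par" "c \<in> C" using C_pred by blast
    then have "p c = i" using p(1) par_unique by blast
    then show "i \<in> p ` C" using \<open>c \<in> C\<close> by blast
  qed (use p(2) in auto)
  then have pinj: "inj_on p C" using finC by (simp add: eq_card_imp_inj_on)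
  have p_vertex: "vertex B (p c) = vertex B (alpha B c)" if "c \<in> C" for c
    using par_vertex[OF p(1)[OF that]] vertex_eq CD(1)[OF p(2)[OF that]] by metis
  \<comment> \<open>One traversal of the edge of each \<open>c \<in> C\<close>, from its origin at
    \<open>alpha B c\<close> towards \<open>c\<close>; this direction is allowed because
    \<open>c\<close> is ingoing.\<close>
  define n :: "'h \<Rightarrow> nat" where "n = (\<lambda>d. if d \<in> alpha B ` C then 1 else 0)"
  have aC: "d \<in> alpha B ` C \<longleftrightarrow> alpha B d \<in> C" if d: "d \<in> darts B" for d
  proof
    assume "d \<in> alpha B ` C"
    then obtain c where c: "c \<in> C" "d = alpha B c" by blast
    then show "alpha B d \<in> C" using alpha_alpha[OF CD(1)[OF c(1)]] by simp
  next
    assume "alpha B d \<in> C"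
    then show "d \<in> alpha B ` C" using alpha_alpha[OF d] by (metis imageI)
  qed
  have n_eq: "n d = (if alpha B d \<in> C then 1 else 0)" if "d \<in> darts B" for d
    unfolding n_def using aC[OF that] by simp
  \<comment> \<open>A departure \<open>x\<close> with \<open>alpha B x \<in> C\<close> is paired
    with the arrival \<open>p (alpha B x)\<close> at the same vertex.\<close>
  have bal: "bij_betw (\<lambda>x. p (alpha B x)) {x \<in> vertex B d. x \<in> alpha B ` C} {x \<in> vertex B d. alpha B x \<in> alpha B ` C}"
    if d: "d \<in> darts B" for d
    unfolding bij_betw_def
  proof
    have vD: "x \<in> darts B" if "x \<in> vertex B d" for x using vertex_sub[OF d] that by blast
    show "inj_on (\<lambda>x. p (alpha B x)) {x \<in> vertex B d. x \<in> alpha B ` C}"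
    proof (rule inj_onI)
      fix x y assume x: "x \<in> {x \<in> vertex B d. x \<in> alpha B ` C}" and y: "y \<in> {x \<in> vertex B d. x \<in> alpha B ` C}"
        and e: "p (alpha B x) = p (alpha B y)"
      have "alpha B x \<in> C" "alpha B y \<in> C" "x \<in> darts B" "y \<in> darts B" using x y vD aC by auto
      then show "x = y" using pinj e alpha_inj unfolding inj_on_def by blast
    qed
    have in2: "y \<in> {x \<in> vertex B d. alpha B x \<in> alpha B ` C} \<longleftrightarrow> y \<in> vertex B d \<and> y \<in> C" for y
      using vD[of y] aC[of "alpha B y"] alpha_closed[of y] alpha_alpha[of y] by auto
    show "(\<lambda>x. p (alpha B x)) ` {x \<in> vertex B d. x \<in> alpha B ` C} = {x \<in> vertex B d. alpha B x \<in> alpha B ` C}"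
    proof (intro equalityI subsetI)
      fix y assume "y \<in> (\<lambda>x. p (alpha B x)) ` {x \<in> vertex B d. x \<in> alpha B ` C}"
      then obtain x where x: "x \<in> vertex B d" "x \<in> alpha B ` C" "y = p (alpha B x)" by blast
      then have ax: "alpha B x \<in> C" using aC[OF vD[OF x(1)]] by blast
      have "vertex B y = vertex B d"
        using p_vertex[OF ax] alpha_alpha[OF vD[OF x(1)]] vertex_eq[OF d x(1)] x(3) by simp
      then have "y \<in> vertex B d" using vertex_self by metis
      then show "y \<in> {x \<in> vertex B d. alpha B x \<in> alpha B ` C}" unfolding in2 using p(2)[OF ax] x(3) by blast
    next
      fix y assume "y \<in> {x \<in> vertex B d. alpha B x \<in> alpha B ` C}"
      then have y: "y \<in> vertex B d" "y \<in> C" unfolding in2 by auto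
      then obtain c where c: "c \<in> C" "y = p c" using \<open>p ` C = C\<close> by blast
      have "vertex B (alpha B c) = vertex B d" using p_vertex[OF c(1)] c(2) vertex_eq[OF d y(1)] by simp
      then have "alpha B c \<in> vertex B d" using vertex_self by metis
      then show "y \<in> (\<lambda>x. p (alpha B x)) ` {x \<in> vertex B d. x \<in> alpha B ` C}"
        using c alpha_alpha[OF CD(1)[OF c(1)]] by (intro image_eqI[of _ _ "alpha B c"]) simp_all
    qed
  qed
  then have "conserved n" unfolding n_def
    by (intro conserved_indicator) (rule bij_betw_same_card)
  moreover have "ingoing B (alpha B d)" if "d \<in> darts B" "n d > 0" for d
    using that n_eq CD(2) by (auto split: if_splits)
  moreover have fD: "f \<in> darts B" using f(1) vertex_sub[OF rD] by blast
  ultimately obtain g :: "'h \<Rightarrow> int" where g: "g f = 0" "\<And>d. d \<in> darts B \<Longrightarrow> g d \<le> 0"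
    "\<And>d. d \<in> darts B \<Longrightarrow> g (sigma B d) = g (alpha B d)"
    "\<And>d. d \<in> darts B \<Longrightarrow> g d - g (alpha B d) = int (n d) - int (n (alpha B d))"
    using circulation_potential[OF pm _ f(2), of n] by blast
  have n_al: "n (alpha B d) = (if d \<in> C then 1 else 0)" if "d \<in> darts B" for d
    using n_eq[OF alpha_closed[OF that]] alpha_alpha[OF that] by simp
  define touched where "touched = (\<lambda>d. d \<in> C \<or> alpha B d \<in> C)"
  have g_al: "g (alpha B d) = g d" if "d \<in> darts B" "\<not> touched d" for d
    using g(4)[OF that(1)] that n_al[OF that(1)] n_eq[OF that(1)] unfolding touched_def by simp
  have g_const: "g y = g x" if x: "x \<in> darts B" "\<And>z. z \<in> vertex B x \<Longrightarrow> \<not> touched z" and y: "y \<in> vertex B x" for x y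
    using y unfolding vertex_def
  proof (induction rule: orb_induct)
    case (step z)
    have z: "z \<in> vertex B x" using step.hyps unfolding vertex_def .
    then have zD: "z \<in> darts B" using vertex_sub[OF x(1)] by blast
    show ?case using g(3)[OF zD] g_al[OF zD x(2)[OF z]] step.IH by simp
  qed simp
  have touched_C: "\<exists>j. j \<in> C \<and> j \<in> vertex B x" if "touched x" "x \<in> darts B" for x
  proof (cases "x \<in> C")
    case False
    then have "alpha B x \<in> C" using that(1) unfolding touched_def by blast
    then have "p (alpha B x) \<in> C" "vertex B (p (alpha B x)) = vertex B x"
      using p(2) p_vertex[of "alpha B x"] alpha_alpha[OF that(2)] by auto
    then show ?thesis using vertex_self by metis
  qed (use vertex_self in blast)
  \<comment> \<open>The invariant along directed paths from the root-vertex: they stay at potential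
    0 and visit only vertices that the walk avoids.\<close>
  define good where "good = (\<lambda>x. g x = 0 \<and> (\<forall>z\<in>vertex B x. \<not> touched z))"
  have "good x" if "(root B, x) \<in> (acc_rel B)\<^sup>*" for x
    using that
  proof (induction rule: rtrancl_induct)
    case base
    have "\<not> touched z" if z: "z \<in> vertex B (root B)" for z
    proof
      assume "touched z"
      moreover have "z \<in> darts B" using vertex_sub[OF rD] z by blast
      ultimately obtain j where "j \<in> C" "j \<in> vertex B z" using touched_C by blast
      then show False using src vertex_eq[OF rD z] CD(2) by blast
    qed
    then show ?case unfolding good_def using g_const[OF rD _ f(1)] g(1) by auto
  next
    case (step x y)
    have xy: "x \<in> darts B" "y \<in> darts B" "y \<in> vertex B x \<or> y = alpha B x \<and> ingoing B y"
      using step(2) unfolding acc_rel_def by auto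
    have gx: "g x = 0" "\<And>z. z \<in> vertex B x \<Longrightarrow> \<not> touched z" using step.IH unfolding good_def by auto
    show ?case
    proof (cases "y \<in> vertex B x")
      case True
      then show ?thesis unfolding good_def using g_const[OF xy(1) gx(2) True] gx vertex_eq[OF xy(1) True] by auto
    next
      case False
      then have y: "y = alpha B x" "ingoing B y" using xy(3) by auto
      have nx: "\<not> touched x" using gx(2) vertex_self by blast
      then have ny: "\<not> touched y" unfolding touched_def y(1) using alpha_alpha[OF xy(1)] by auto
      have gy: "g y = 0" unfolding y(1) using g_al[OF xy(1) nx] gx(1) by simp
      have "\<not> touched z" if z: "z \<in> vertex B y" for z
      proof
        assume tz: "touched z"
        let ?s = "\<lambda>u. (sigma B ^^ u) y"
        have sD: "?s u \<in> darts B" for u by (rule funpow_sigma_closed[OF xy(2)])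
        have ex: "\<exists>u. touched (?s u)" using z tz unfolding vertex_def orb_def by blast
        \<comment> \<open>The first half-edge of the walk met clockwise from the arrival
          \<open>y\<close>. The potential is still 0 there, since it only changes across edges of
          the walk.\<close>
        define u where "u = (LEAST u. touched (?s u))"
        have tu: "touched (?s u)" unfolding u_def by (rule LeastI_ex[OF ex])
        have before: "\<not> touched (?s v)" if "v < u" for v
          using not_less_Least that unfolding u_def by blast
        have u0: "u > 0" using tu ny by (cases u) auto
        have gs: "g (?s v) = 0" if "v \<le> u" for v
          using that
        proof (induction v)
          case (Suc v)
          then show ?case using g(3)[OF sD[of v]] g_al[OF sD[of v] before[of v]] by simp
        qed (use gy in simp)
        let ?e = "?s u"
        show False
        \<comment> \<open>If \<open>?e\<close> is a departure, the parent of
          \<open>alpha B ?e\<close> is the first ingoing half-edge counterclockwise from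
          \<open>?e\<close>. Either it is met from \<open>y\<close> before \<open>?e\<close>, though
          it belongs to the walk, or the ingoing \<open>y\<close> lies in its gap; both are
          impossible.\<close>
        proof (cases "alpha B ?e \<in> C")
          case True
          then obtain t where t: "0 < t" "(sigma B ^^ t) (p (alpha B ?e)) = ?e" "gap (p (alpha B ?e)) t"
            using p(1)[OF True] alpha_alpha[OF sD[of u]] unfolding par_def by auto
          let ?q = "p (alpha B ?e)"
          have q: "?q \<in> C" "?q \<in> darts B" using p(2)[OF True] CD(1) by auto
          show False
          proof (cases "t \<le> u")
            case True
            then have "(sigma B ^^ t) (?s (u - t)) = (sigma B ^^ t) ?q"
              using t(2) by (metis comp_apply funpow_add le_add_diff_inverse)
            then have "?s (u - t) = ?q" using funpow_sigma_inj[OF sD q(2)] by blast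
            then show False using before[of "u - t"] u0 t(1) q(1) unfolding touched_def by simp
          next
            case False
            then have "(sigma B ^^ u) y = (sigma B ^^ u) ((sigma B ^^ (t - u)) ?q)"
              using t(2) by (metis comp_apply funpow_add le_add_diff_inverse nat_le_linear)
            then have "y = (sigma B ^^ (t - u)) ?q"
              using funpow_sigma_inj[OF xy(2) funpow_sigma_closed[OF q(2)]] by blast
            moreover have "0 < t - u" "t - u < t" using False u0 by auto
            ultimately show False using t(3)[rule_format, of "t - u"] y(2) by metis
          qed
        next
          case False
          then have "?e \<in> C" using tu unfolding touched_def by blast
          \<comment> \<open>If \<open>?e\<close> is an arrival, turning past it crosses the walk
            from its right to its left, and the potential rises from 0 to 1.\<close>
          then have "g (alpha B ?e) = 1"
            using g(4)[OF sD[of u]] n_eq[OF sD[of u]] n_al[OF sD[of u]] False gs[of u] by simp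
          then show False using g(2)[OF alpha_closed[OF sD[of u]]] by simp
        qed
      qed
      then show ?thesis unfolding good_def using gy by blast
    qed
  qed
  then have "c \<notin> C" for c
    using acc[OF CD(1)] vertex_self unfolding good_def touched_def by blast
  then show ?thesis unfolding C_def acyclic_def by blast
qed

end

section \<open>Isomorphisms of mobiles\<close>

locale mobile_map = rotsys M for M :: "('a, 'z) mobile_scheme" +
  fixes M' :: "('b, 'y) mobile_scheme" and \<psi> :: "'a \<Rightarrow> 'b"
  assumes map_bij: "bij_betw \<psi> (darts M) (darts M')"
    and map_alpha: "d \<in> darts M \<Longrightarrow> alpha M' (\<psi> d) = \<psi> (alpha M d)"
    and map_sigma: "d \<in> darts M \<Longrightarrow> sigma M' (\<psi> d) = \<psi> (sigma M d)"
    and map_black: "d \<in> darts M \<Longrightarrow> black M' (\<psi> d) = black M d"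
    and map_weight: "d \<in> darts M \<Longrightarrow> alpha M d \<noteq> d \<Longrightarrow> mweight M' (\<psi> d) = mweight M d"
begin

lemma map_inj: "x \<in> darts M \<Longrightarrow> y \<in> darts M \<Longrightarrow> \<psi> x = \<psi> y \<Longrightarrow> x = y"
  using map_bij unfolding bij_betw_def inj_on_def by simp

lemma map_image: "darts M' = \<psi> ` darts M"
  using map_bij unfolding bij_betw_def by simp

lemma map_closed: "d \<in> darts M \<Longrightarrow> \<psi> d \<in> darts M'"
  unfolding map_image by simp

lemma map_fixed: "d \<in> darts M \<Longrightarrow> alpha M' (\<psi> d) = \<psi> d \<longleftrightarrow> alpha M d = d"
  using map_alpha map_inj[OF alpha_closed] by auto

lemma map_iso: "mobile_iso M M'"
  unfolding mobile_iso_def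
  using map_bij map_alpha map_sigma map_black map_weight by (intro exI[of _ \<psi>]) simp

lemma map_run:
  assumes "run M x b n" "x \<in> darts M"
  shows "run M' (\<psi> x) (\<psi> b) n"
  using assms
proof (induction rule: run.induct)
  case (bud x)
  then show ?case using map_alpha run.bud by metis
next
  case (black x b n)
  have D: "alpha M x \<in> darts M" "sigma M (alpha M x) \<in> darts M"
    using black.prems alpha_closed sigma_closed by auto
  show ?case
  proof (rule run.black)
    show "run M' (sigma M' (alpha M' (\<psi> x))) (\<psi> b) n"
      using black.IH[OF D(2)] map_alpha[OF black.prems] map_sigma[OF D(1)] by simp
  qed (use black.hyps black.prems map_fixed map_alpha map_black[OF D(1)] in simp_all)
next
  case (white x b' n' b n)
  have D: "alpha M x \<in> darts M" "sigma M (alpha M x) \<in> darts M"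
    using white.prems alpha_closed sigma_closed by auto
  have "b' \<in> darts M" using run_connected[OF rotsys_axioms white.hyps(3) D(2)] by blast
  show ?case
  proof (rule run.white)
    show "run M' (sigma M' (alpha M' (\<psi> x))) (\<psi> b') n'"
      using white.IH(1)[OF D(2)] map_alpha[OF white.prems] map_sigma[OF D(1)] by simp
    show "run M' (sigma M' (\<psi> b')) (\<psi> b) n"
      using white.IH(2)[OF sigma_closed] map_sigma \<open>b' \<in> darts M\<close> by simp
  qed (use white.hyps white.prems map_fixed map_alpha map_black[OF D(1)] in simp_all)
qed

lemma map_rotsys: "rotsys M'"
proof
  show "finite (darts M')" unfolding map_image using finite_darts by simp
  show "alpha M' d \<in> darts M'" if "d \<in> darts M'" for d
    using that unfolding map_image by (auto simp: map_alpha alpha_closed)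
  show "alpha M' (alpha M' d) = d" if "d \<in> darts M'" for d
    using that unfolding map_image by (auto simp: map_alpha alpha_closed alpha_alpha)
  have "inj_on (sigma M') (darts M')"
  proof (rule inj_onI)
    fix x y assume "x \<in> darts M'" "y \<in> darts M'" and e: "sigma M' x = sigma M' y"
    then obtain u v where u: "u \<in> darts M" "x = \<psi> u" and v: "v \<in> darts M" "y = \<psi> v"
      unfolding map_image by blast
    have "\<psi> (sigma M u) = \<psi> (sigma M v)" using e u v map_sigma by simp
    then have "sigma M u = sigma M v" using map_inj sigma_closed u v by blast
    then show "x = y" using sigma_inj u v by blast
  qed
  moreover have "sigma M' ` darts M' \<subseteq> darts M'"
    unfolding map_image by (auto simp: map_sigma sigma_closed)
  ultimately show "bij_betw (sigma M') (darts M') (darts M')"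
    using endo_inj_surj \<open>finite (darts M')\<close> by (simp add: bij_betw_def)
qed

lemma map_vertex:
  assumes "d \<in> darts M"
  shows "vertex M' (\<psi> d) = \<psi> ` vertex M d"
proof -
  have "(sigma M' ^^ n) (\<psi> d) = \<psi> ((sigma M ^^ n) d)" for n
    by (induction n) (simp_all add: map_sigma funpow_sigma_closed assms)
  then show ?thesis unfolding vertex_def orb_def by auto
qed

lemma map_card:
  assumes "\<And>d. d \<in> darts M \<Longrightarrow> Q' (\<psi> d) = Q d"
  shows "card {d\<in>darts M'. Q' d} = card {d\<in>darts M. Q d}"
proof -
  have "{d\<in>darts M'. Q' d} = \<psi> ` {d\<in>darts M. Q d}" unfolding map_image using assms by auto
  moreover have "inj_on \<psi> {d\<in>darts M. Q d}" using map_inj by (auto simp: inj_on_def)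
  ultimately show ?thesis by (simp add: card_image)
qed

lemma map_mobile:
  assumes "is_mobile M"
  shows "is_mobile M'" "excess M' = excess M"
proof -
  interpret M': rotsys M' by (rule map_rotsys)
  have "connected_prem M'"
    unfolding M'.connected_iff
  proof (intro ballI)
    fix x y assume "x \<in> darts M'" "y \<in> darts M'"
    then obtain u v where u: "u \<in> darts M" "x = \<psi> u" and v: "v \<in> darts M" "y = \<psi> v"
      unfolding map_image by blast
    have "connected_prem M" using assms unfolding is_mobile_def by blast
    then have "(\<psi> u, \<psi> v) \<in> M'.conn_rel\<^sup>*" using u(1) v(1)
    proof (induction rule: connected_induct)
      case (alpha d)
      then show ?case using M'.conn_alpha[OF map_closed] map_alpha rtrancl_trans by metis
    next
      case (sigma d)
      then show ?case using M'.conn_sigma[OF map_closed] map_sigma rtrancl_trans by metis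
    qed simp
    then show "(x, y) \<in> M'.conn_rel\<^sup>*" using u v by simp
  qed
  moreover have "card (vertex M' ` darts M') = card (vertex M ` darts M)"
  proof -
    have "vertex M' ` darts M' = (`) \<psi> ` vertex M ` darts M"
      unfolding map_image image_image by (rule image_cong) (simp_all add: map_vertex)
    moreover have "inj_on \<psi> (\<Union> (vertex M ` darts M))"
      by (rule inj_onI) (use map_inj vertex_sub in blast)
    ultimately show ?thesis by (simp add: card_image inj_on_image)
  qed
  moreover have "\<exists>d\<in>darts M'. alpha M' d \<noteq> d"
    using assms map_fixed unfolding is_mobile_def map_image by blast
  moreover have "card {d\<in>darts M'. alpha M' d \<noteq> d} = card {d\<in>darts M. alpha M d \<noteq> d}"
    by (rule map_card) (simp add: map_fixed)
  moreover have "black M' (sigma M' d) = black M' d" if "d \<in> darts M'" for d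
  proof -
    obtain u where u: "u \<in> darts M" "d = \<psi> u" using \<open>d \<in> darts M'\<close> unfolding map_image by blast
    have "black M (sigma M u) = black M u" using assms u(1) unfolding is_mobile_def by blast
    then show ?thesis using u map_sigma map_black sigma_closed by simp
  qed
  moreover have "black M' d" if d: "d \<in> darts M'" "alpha M' d = d" for d
  proof -
    obtain u where u: "u \<in> darts M" "d = \<psi> u" using d(1) unfolding map_image by blast
    then have "black M u" using assms d(2) map_fixed unfolding is_mobile_def by auto
    then show ?thesis using u map_black by simp
  qed
  ultimately show "is_mobile M'" using assms
      M'.finite_darts M'.alpha_bij M'.alpha_alpha M'.sigma_bij unfolding is_mobile_def by simp
  have bl: "black M' (\<psi> d) = black M d" "black M' (alpha M' (\<psi> d)) = black M (alpha M d)"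
    if "d \<in> darts M" for d
    using that map_black map_alpha alpha_closed by simp_all
  have "card {d\<in>darts M'. alpha M' d \<noteq> d \<and> black M' d \<and> \<not> black M' (alpha M' d)}
      = card {d\<in>darts M. alpha M d \<noteq> d \<and> black M d \<and> \<not> black M (alpha M d)}"
    by (rule map_card) (simp add: map_fixed bl)
  moreover have "card {d\<in>darts M'. alpha M' d \<noteq> d \<and> \<not> black M' d \<and> \<not> black M' (alpha M' d)}
      = card {d\<in>darts M. alpha M d \<noteq> d \<and> \<not> black M d \<and> \<not> black M (alpha M d)}"
    by (rule map_card) (simp add: map_fixed bl)
  moreover have "card {d\<in>darts M'. alpha M' d = d} = card {d\<in>darts M. alpha M d = d}"
    by (rule map_card) (simp add: map_fixed)
  ultimately show "excess M' = excess M" unfolding excess_def by simp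
qed

lemma map_inverse: "mobile_map M' M (inv_into (darts M) \<psi>)"
proof -
  have inv: "inv_into (darts M) \<psi> (\<psi> d) = d" if "d \<in> darts M" for d
    using that map_bij unfolding bij_betw_def by simp
  show ?thesis
  proof (rule mobile_map.intro[OF map_rotsys], unfold_locales)
    show "bij_betw (inv_into (darts M) \<psi>) (darts M') (darts M)"
      using map_bij by (rule bij_betw_inv_into)
    fix d assume "d \<in> darts M'" "alpha M' d \<noteq> d"
    then obtain u where "u \<in> darts M" "d = \<psi> u" "alpha M' (\<psi> u) \<noteq> \<psi> u" unfolding map_image by blast
    then show "mweight M (inv_into (darts M) \<psi> d) = mweight M' d"
      using inv map_fixed map_weight by simp
  qed (auto simp: map_image map_alpha map_sigma map_black inv alpha_closed sigma_closed)
qed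

end

lemma mobile_mapE:
  assumes "rotsys M" "mobile_iso M M'"
  obtains \<psi> where "mobile_map M M' \<psi>"
proof -
  obtain \<psi> where "bij_betw \<psi> (darts M) (darts M')"
    "\<forall>d\<in>darts M. \<psi> (alpha M d) = alpha M' (\<psi> d) \<and> \<psi> (sigma M d) = sigma M' (\<psi> d) \<and>
        black M' (\<psi> d) = black M d \<and> (alpha M d \<noteq> d \<longrightarrow> mweight M' (\<psi> d) = mweight M d)"
    using assms(2) unfolding mobile_iso_def by blast
  then have "mobile_map M M' \<psi>"
    by (intro mobile_map.intro assms(1) mobile_map_axioms.intro) auto
  then show ?thesis by (rule that)
qed

lemma mobile_map_trans:
  assumes "mobile_map M M' \<psi>" "mobile_map M' M'' \<chi>"
  shows "mobile_map M M'' (\<chi> \<circ> \<psi>)"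
proof -
  interpret A: mobile_map M M' \<psi> by fact
  interpret B: mobile_map M' M'' \<chi> by fact
  show ?thesis
  proof (unfold_locales, goal_cases)
    case 1
    show ?case using A.map_bij B.map_bij by (rule bij_betw_trans)
  next
    case (5 d)
    then have "alpha M' (\<psi> d) \<noteq> \<psi> d" using A.map_fixed by blast
    then show ?case using B.map_weight[OF A.map_closed] A.map_weight 5 by simp
  qed (simp_all add: A.map_closed A.map_alpha A.map_sigma A.map_black
      B.map_alpha B.map_sigma B.map_black)
qed

lemma rotsys_of_mobile: "is_mobile M \<Longrightarrow> rotsys M"
  unfolding is_mobile_def rotsys_def by (auto simp: bij_betw_def)

section \<open>The image of a source-biorientation determines it\<close>

context biori
begin

text \<open>The last edge by which a directed path enters the vertex ends in an ingoing
  half-edge.\<close>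

lemma ingoing_at_nonroot:
  assumes "inB0 B" "d \<in> darts B" "d \<notin> vertex B (root B)"
  shows "\<exists>j\<in>vertex B d. ingoing B j"
proof -
  have rD: "root B \<in> darts B" using assms(1) unfolding inB0_def by auto
  have "(root B, d) \<in> (acc_rel B)\<^sup>*" using assms(1,2) unfolding inB0_def by auto
  then have "d \<in> vertex B (root B) \<or> (\<exists>j\<in>vertex B d. ingoing B j)"
  proof (induction rule: rtrancl_induct)
    case (step x y)
    have xy: "x \<in> darts B" "y \<in> vertex B x \<or> y = alpha B x \<and> ingoing B y"
      using step(2) unfolding acc_rel_def by auto
    show ?case
    proof (cases "y \<in> vertex B x")
      case True
      then have e: "vertex B y = vertex B x" by (rule vertex_eq[OF xy(1)])
      have "vertex B y = vertex B (root B) \<Longrightarrow> y \<in> vertex B (root B)" using vertex_self by metis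
      then show ?thesis using step.IH vertex_eq[OF rD] e by metis
    next
      case False
      then show ?thesis using xy(2) vertex_self by blast
    qed
  qed simp
  then show ?thesis using assms(3) by blast
qed

text \<open>Only the root-vertex lacks an ingoing half-edge, so Euler's relation becomes (V - 1) + F
  = E + 1, that of a tree with V - 1 white and F black vertices.\<close>

theorem Phi0_mobile_of_inB0:
  assumes "inB0 B"
  shows "is_mobile P"
proof -
  have pm: "is_planemap B" and rD: "root B \<in> darts B"
    and src: "\<And>d. d \<in> vertex B (root B) \<Longrightarrow> \<not> ingoing B d"
    using assms unfolding inB0_def by auto
  let ?V = "vertex B ` darts B"
  have eq: "{v \<in> ?V. \<exists>x\<in>v. ingoing B x} = ?V - {vertex B (root B)}"
  proof (intro equalityI subsetI)
    fix v assume v: "v \<in> ?V - {vertex B (root B)}"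
    then obtain d where d: "d \<in> darts B" "v = vertex B d" by blast
    then have "d \<notin> vertex B (root B)" using v vertex_eq[OF rD, of d] by auto
    then show "v \<in> {v \<in> ?V. \<exists>x\<in>v. ingoing B x}"
      using ingoing_at_nonroot[OF assms d(1)] d by blast
  qed (use src in blast)
  have "card {v \<in> ?V. \<exists>x\<in>v. ingoing B x} = card ?V - 1"
    unfolding eq using rD finite_darts by (simp add: card_Diff_singleton)
  moreover have "card ?V > 0" using rD finite_darts by (auto simp: card_gt_0_iff)
  moreover have "int (card ?V) - int (card (darts B) div 2) + int (card (face B ` darts B)) = 2"
    "connected_prem B" "darts B \<noteq> {}"
    using pm unfolding is_planemap_def by blast+
  ultimately show ?thesis by (intro Phi0_mobile acyclic_par assms) auto
qed

lemma Phi0_alpha_Bl_white: "alpha P (Bl h) = Wh k \<Longrightarrow> h = k \<and> ingoing B h \<and> \<not> ingoing B (alpha B h)"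
  by (cases "ingoing B (alpha B h)"; cases "ingoing B h")
    (auto simp: Phi0_alpha_bud Phi0_alpha_1way Phi0_alpha_0way)

lemma Phi0_alpha_Wh_white: "alpha P (Wh h) = Wh k \<Longrightarrow> k = alpha B h"
  by (cases "ingoing B (alpha B h)") (auto simp: Phi0_alpha_Wh1 Phi0_alpha_Wh2)

lemma Phi0_alpha_Bl_black: "alpha P (Bl h) = Bl k \<Longrightarrow> k \<noteq> h \<Longrightarrow> k = alpha B h"
  by (cases "ingoing B (alpha B h)"; cases "ingoing B h")
    (auto simp: Phi0_alpha_bud Phi0_alpha_1way Phi0_alpha_0way)

end

text \<open>Every half-edge \<open>h\<close> gives one \<open>Bl h\<close>, so \<open>\<psi>\<close>
  induces a map \<open>\<chi>\<close> of half-edges. Face rotations and 0-way edges are visible in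
  the image; for the other edges \<open>alpha\<close> is recovered from the matching.\<close>

lemma biori_iso_of_mobile_iso:
  assumes "inB0 B" "inB0 B'" "mobile_iso (Phi0 B) (Phi0 B')"
  shows "biori_iso B B'"
proof -
  interpret B: biori B using assms(1) unfolding inB0_def by (intro biori_of_planemap) blast
  interpret B': biori B' using assms(2) unfolding inB0_def by (intro biori_of_planemap) blast
  obtain \<psi> where "mobile_map (Phi0 B) (Phi0 B') \<psi>" using mobile_mapE[OF B.Phi0_rotsys assms(3)] .
  then interpret mobile_map "Phi0 B" "Phi0 B'" \<psi> .
  have "\<exists>k. \<psi> (Bl h) = Bl k \<and> k \<in> darts B'" if "h \<in> darts B" for h
  proof -
    have "\<psi> (Bl h) \<in> darts (Phi0 B')" "black (Phi0 B') (\<psi> (Bl h))"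
      using that map_closed[of "Bl h"] map_black[of "Bl h"] by simp_all
    then show ?thesis by (cases "\<psi> (Bl h)") auto
  qed
  then obtain \<chi> where \<chi>: "\<And>h. h \<in> darts B \<Longrightarrow> \<psi> (Bl h) = Bl (\<chi> h)" "\<And>h. h \<in> darts B \<Longrightarrow> \<chi> h \<in> darts B'"
    by metis
  have wh: "\<exists>k. \<psi> (Wh i) = Wh k \<and> k \<in> darts B' \<and> ingoing B' k" if "i \<in> darts B" "ingoing B i" for i
  proof -
    have "\<psi> (Wh i) \<in> darts (Phi0 B')" "\<not> black (Phi0 B') (\<psi> (Wh i))"
      using that map_closed[of "Wh i"] map_black[of "Wh i"] by simp_all
    then show ?thesis by (cases "\<psi> (Wh i)") auto
  qed
  text \<open>Since the matching of white half-edges with buds can be read off the contour, it is preserved.\<close>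
  have matching: "\<chi> (alpha B i) = alpha B' k"
    if i: "i \<in> darts B" "ingoing B i" and k: "\<psi> (Wh i) = Wh k" "k \<in> darts B'" "ingoing B' k" for i k
  proof -
    obtain n where n: "run (Phi0 B) (sigma (Phi0 B) (Wh i)) (Bl (alpha B i)) n"
      using B.Phi0_run[OF B.acyclic_par[OF assms(1)] i] by blast
    have WD: "Wh i \<in> darts (Phi0 B)" using i by simp
    have "run (Phi0 B') (sigma (Phi0 B') (Wh k)) (Bl (\<chi> (alpha B i))) n"
      using map_run[OF n B.Phi.sigma_closed[OF WD]] map_sigma[OF WD] k(1) \<chi>(1)[OF B.alpha_closed[OF i(1)]]
      by simp
    moreover obtain m where "run (Phi0 B') (sigma (Phi0 B') (Wh k)) (Bl (alpha B' k)) m"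
      using B'.Phi0_run[OF B'.acyclic_par[OF assms(2)] k(2,3)] by blast
    ultimately have "Bl (\<chi> (alpha B i)) = Bl (alpha B' k)" using run_unique by fast
    then show ?thesis by simp
  qed
  have W: "\<psi> (Wh i) = Wh (\<chi> i) \<and> ingoing B' (\<chi> i)" if i: "i \<in> darts B" "ingoing B i" for i
  proof -
    obtain k where k: "\<psi> (Wh i) = Wh k" "k \<in> darts B'" "ingoing B' k" using wh[OF i] by blast
    show ?thesis
    proof (cases "ingoing B (alpha B i)")
      case False
      have "alpha (Phi0 B') (Bl (\<chi> i)) = Wh k"
        using map_alpha[of "Bl i"] i \<chi>(1)[OF i(1)] B.Phi0_alpha_1way[OF False i(2)] k(1) by simp
      then have "\<chi> i = k" using B'.Phi0_alpha_Bl_white by blast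
      then show ?thesis using k by simp
    next
      case True
      have eD: "alpha B i \<in> darts B" using i(1) by (rule B.alpha_closed)
      obtain k' where k': "\<psi> (Wh (alpha B i)) = Wh k'" "k' \<in> darts B'" "ingoing B' k'"
        using wh[OF eD True] by blast
      have "alpha (Phi0 B') (Wh k) = Wh k'"
        using map_alpha[of "Wh i"] i B.Phi0_alpha_Wh2[OF True] k(1) k'(1) by simp
      then have "k' = alpha B' k" by (rule B'.Phi0_alpha_Wh_white)
      \<comment> \<open>For a 2-way edge \<open>Bl i\<close> is a bud and not joined to
        \<open>Wh i\<close>. But \<open>Wh i\<close> is joined to \<open>Wh (alpha B i)\<close>,
        whose matching bud is \<open>Bl i\<close>.\<close>
      moreover have "\<chi> i = alpha B' k'" using matching[OF eD True k'] B.alpha_alpha[OF i(1)] by simp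
      ultimately have "\<chi> i = k" using B'.alpha_alpha[OF k(2)] by simp
      then show ?thesis using k by simp
    qed
  qed
  have al_in: "\<chi> (alpha B i) = alpha B' (\<chi> i)" if "i \<in> darts B" "ingoing B i" for i
    using matching[OF that] W[OF that] \<chi>(2)[OF that(1)] by blast
  have al: "\<chi> (alpha B h) = alpha B' (\<chi> h)" if h: "h \<in> darts B" for h
  proof (cases "ingoing B h"; cases "ingoing B (alpha B h)")
    assume n: "\<not> ingoing B h" "\<not> ingoing B (alpha B h)"
    have "alpha (Phi0 B') (Bl (\<chi> h)) = Bl (\<chi> (alpha B h))"
      using map_alpha[of "Bl h"] h \<chi>(1) B.alpha_closed[OF h] B.Phi0_alpha_0way[OF n(2,1)] by simp
    moreover have "\<chi> (alpha B h) \<noteq> \<chi> h"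
      using map_inj[of "Bl (alpha B h)" "Bl h"] \<chi>(1) h B.alpha_closed[OF h] B.alpha_ne[OF h] by auto
    ultimately show ?thesis by (rule B'.Phi0_alpha_Bl_black)
  next
    assume n: "\<not> ingoing B h" "ingoing B (alpha B h)"
    have "\<chi> h = alpha B' (\<chi> (alpha B h))"
      using al_in[OF B.alpha_closed[OF h] n(2)] B.alpha_alpha[OF h] by simp
    then show ?thesis using B'.alpha_alpha[OF \<chi>(2)[OF B.alpha_closed[OF h]]] by simp
  qed (use al_in[OF h] in simp_all)
  have \<chi>_inj: "x = y" if "x \<in> darts B" "y \<in> darts B" "\<chi> x = \<chi> y" for x y
    using map_inj[of "Bl x" "Bl y"] \<chi>(1) that by simp
  have ing: "ingoing B' (\<chi> h) = ingoing B h" if h: "h \<in> darts B" for h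
  proof
    assume "ingoing B' (\<chi> h)"
    then have "Wh (\<chi> h) \<in> darts (Phi0 B')" using \<chi>(2)[OF h] by simp
    then obtain y where y: "y \<in> darts (Phi0 B)" "\<psi> y = Wh (\<chi> h)" unfolding map_image by auto
    show "ingoing B h" using y(1)
    proof (cases rule: B.Phi0_cases)
      case (black g)
      then show ?thesis using \<chi>(1) y(2) by simp
    next
      case (white i)
      then have "\<chi> i = \<chi> h" using W y(2) by simp
      then show ?thesis using \<chi>_inj white h by blast
    qed
  qed (use W[OF h] in simp)
  have si: "\<chi> (sigma B h) = sigma B' (\<chi> h)" if h: "h \<in> darts B" for h
  proof -
    have sD: "sigma B h \<in> darts B" using h by (rule B.sigma_closed)
    have "sigma (Phi0 B') (Bl (\<chi> (sigma B h))) = Bl (\<chi> (alpha B h))"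
      using map_sigma[of "Bl (sigma B h)"] sD \<chi>(1)[OF sD] \<chi>(1)[OF B.alpha_closed[OF h]] B.Phi0_sigma_Bl[OF h]
      by simp
    also have "\<dots> = sigma (Phi0 B') (Bl (sigma B' (\<chi> h)))"
      using B'.Phi0_sigma_Bl[OF \<chi>(2)[OF h]] al[OF h] by simp
    finally have "Bl (\<chi> (sigma B h)) = Bl (sigma B' (\<chi> h))"
      by (rule B'.Phi.sigma_inj[rotated 2]) (simp_all add: \<chi>(2) sD B'.sigma_closed h)
    then show ?thesis by simp
  qed
  \<comment> \<open>Weights of buds are not compared. The weight at \<open>h\<close> is read at
    \<open>Wh h\<close> if \<open>h\<close> is ingoing, and otherwise at
    \<open>Bl (alpha B h)\<close>, which is then no bud.\<close>
  have wt: "weight B' (\<chi> h) = weight B h" if h: "h \<in> darts B" for h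
  proof (cases "ingoing B h")
    case True
    have "Wh h \<in> {d\<in>darts (Phi0 B). alpha (Phi0 B) d \<noteq> d}" unfolding B.Phi0_nonbuds using h True by auto
    then have "mweight (Phi0 B') (\<psi> (Wh h)) = mweight (Phi0 B) (Wh h)" using map_weight by blast
    then show ?thesis using W[OF h True] by simp
  next
    case False
    let ?e = "alpha B h"
    have e: "?e \<in> darts B" "alpha B ?e = h" using h by (simp_all add: B.alpha_closed B.alpha_alpha)
    have "Bl ?e \<in> {d\<in>darts (Phi0 B). alpha (Phi0 B) d \<noteq> d}" unfolding B.Phi0_nonbuds using e False by auto
    then have "mweight (Phi0 B') (\<psi> (Bl ?e)) = mweight (Phi0 B) (Bl ?e)" using map_weight by blast
    then show ?thesis using \<chi>(1)[OF e(1)] e(2) al[OF e(1)] by simp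
  qed
  have "bij_betw \<chi> (darts B) (darts B')"
    unfolding bij_betw_def
  proof
    show "inj_on \<chi> (darts B)" using \<chi>_inj by (rule inj_onI)
    show "\<chi> ` darts B = darts B'"
    proof (intro equalityI subsetI)
      fix k assume "k \<in> darts B'"
      then have "Bl k \<in> darts (Phi0 B')" by simp
      then obtain y where y: "y \<in> darts (Phi0 B)" "\<psi> y = Bl k" unfolding map_image by auto
      show "k \<in> \<chi> ` darts B" using y(1)
      proof (cases rule: B.Phi0_cases)
        case (black g)
        then show ?thesis using \<chi>(1) y(2) by auto
      next
        case (white i)
        then show ?thesis using W y(2) by auto
      qed
    qed (use \<chi>(2) in blast)
  qed
  \<comment> \<open>The mobile does not record the root-vertex, but it is the only vertex without
    ingoing half-edges, a property that \<open>\<chi>\<close> preserves.\<close>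
  moreover have "\<chi> (root B) \<in> vertex B' (root B')"
  proof (rule ccontr)
    assume n: "\<chi> (root B) \<notin> vertex B' (root B')"
    have rD: "root B \<in> darts B" using assms(1) unfolding inB0_def by blast
    obtain j where j: "j \<in> vertex B' (\<chi> (root B))" "ingoing B' j"
      using B'.ingoing_at_nonroot[OF assms(2) \<chi>(2)[OF rD] n] by blast
    have "(sigma B' ^^ t) (\<chi> (root B)) = \<chi> ((sigma B ^^ t) (root B))" for t
      by (induction t) (simp_all add: si B.funpow_sigma_closed[OF rD])
    then obtain t where "j = \<chi> ((sigma B ^^ t) (root B))" using j(1) unfolding vertex_def orb_def by auto
    then have "ingoing B ((sigma B ^^ t) (root B))"
      using ing[OF B.funpow_sigma_closed[OF rD]] j(2) by simp
    then show False using assms(1) B.funpow_vertex unfolding inB0_def by blast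
  qed
  ultimately show ?thesis unfolding biori_iso_def using al si ing wt by (intro exI[of _ \<chi>]) simp
qed

lemma mobile_iso_of_biori_iso:
  assumes "biori B" "biori B'" "biori_iso B B'"
  shows "mobile_iso (Phi0 B) (Phi0 B')"
proof -
  interpret B: biori B by fact
  interpret B': biori B' by fact
  obtain \<psi> where bij: "bij_betw \<psi> (darts B) (darts B')"
    and hom: "\<And>d. d \<in> darts B \<Longrightarrow> \<psi> (alpha B d) = alpha B' (\<psi> d)"
      "\<And>d. d \<in> darts B \<Longrightarrow> \<psi> (sigma B d) = sigma B' (\<psi> d)"
      "\<And>d. d \<in> darts B \<Longrightarrow> ingoing B' (\<psi> d) = ingoing B d"
      "\<And>d. d \<in> darts B \<Longrightarrow> weight B' (\<psi> d) = weight B d"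
    using assms(3) unfolding biori_iso_def by blast
  have cl: "\<psi> d \<in> darts B'" if "d \<in> darts B" for d using bij that unfolding bij_betw_def by blast
  have inj: "inj_on \<psi> (darts B)" and im: "\<psi> ` darts B = darts B'" using bij unfolding bij_betw_def by auto
  let ?f = "map_mdart \<psi>"
  have ia: "ingoing B' (alpha B' (\<psi> h)) = ingoing B (alpha B h)" if "h \<in> darts B" for h
    using that hom(1,3) B.alpha_closed by metis
  have al: "alpha (Phi0 B') (?f x) = ?f (alpha (Phi0 B) x)" if "x \<in> darts (Phi0 B)" for x
    using that
  proof (cases rule: B.Phi0_cases)
    case (black h)
    then show ?thesis using ia[of h] hom(3)[of h] hom(1)[of h]
      by (cases "ingoing B (alpha B h)"; cases "ingoing B h")
        (simp_all add: B.Phi0_alpha_bud B.Phi0_alpha_1way B.Phi0_alpha_0way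
          B'.Phi0_alpha_bud B'.Phi0_alpha_1way B'.Phi0_alpha_0way)
  next
    case (white h)
    then show ?thesis using ia[of h] hom(3)[of h] hom(1)[of h]
      by (cases "ingoing B (alpha B h)")
        (simp_all add: B.Phi0_alpha_Wh1 B.Phi0_alpha_Wh2 B'.Phi0_alpha_Wh1 B'.Phi0_alpha_Wh2)
  qed
  have pow: "(sigma B' ^^ t) (\<psi> h) = \<psi> ((sigma B ^^ t) h)" if "h \<in> darts B" for h t
    by (induction t) (simp_all add: hom(2) B.funpow_sigma_closed[OF that])
  have sg: "sigma (Phi0 B') (?f x) = ?f (sigma (Phi0 B) x)" if "x \<in> darts (Phi0 B)" for x
    using that
  proof (cases rule: B.Phi0_cases)
    case (black h)
    then obtain k where k: "k \<in> darts B" "sigma B k = h" using B.sigma_pre by blast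
    have "sigma (Phi0 B') (Bl (\<psi> h)) = Bl (alpha B' (\<psi> k))"
      using B'.Phi0_sigma_Bl[OF cl[OF k(1)]] hom(2)[OF k(1)] k(2) by simp
    moreover have "sigma (Phi0 B) (Bl h) = Bl (alpha B k)" using B.Phi0_sigma_Bl[OF k(1)] k(2) by simp
    ultimately show ?thesis using black hom(1)[OF k(1)] by simp
  next
    case (white h)
    obtain t where t: "0 < t" "nextIn (sigma B) (ingoing B) h = (sigma B ^^ t) h"
      "ingoing B ((sigma B ^^ t) h)" "B.gap h t"
      using B.nextIn_exists[OF white(2,3)] .
    have ig: "ingoing B' ((sigma B' ^^ u) (\<psi> h)) = ingoing B ((sigma B ^^ u) h)" for u
      using pow[OF white(2)] hom(3)[OF B.funpow_sigma_closed[OF white(2)]] by simp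
    have "nextIn (sigma B') (ingoing B') (\<psi> h) = (sigma B' ^^ t) (\<psi> h)"
      using t ig by (intro B'.nextIn_eqI) simp_all
    then show ?thesis using white t(2) pow[OF white(2)] by simp
  qed
  have "bij_betw ?f (darts (Phi0 B)) (darts (Phi0 B'))"
    unfolding bij_betw_def
  proof
    show "inj_on ?f (darts (Phi0 B))"
      proof (rule inj_onI)
      fix x y assume "x \<in> darts (Phi0 B)" "y \<in> darts (Phi0 B)" "?f x = ?f y"
      then show "x = y"
        by (cases x; cases y) (simp_all add: inj_on_eq_iff[OF inj])
    qed
    have "\<psi> ` {h \<in> darts B. ingoing B h} = {h \<in> darts B'. ingoing B' h}"
      proof (intro equalityI subsetI)
      fix k assume "k \<in> {h \<in> darts B'. ingoing B' h}"
      then obtain h where "h \<in> darts B" "k = \<psi> h" "ingoing B' (\<psi> h)" unfolding im[symmetric] by auto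
      then show "k \<in> \<psi> ` {h \<in> darts B. ingoing B h}" using hom(3) by blast
    qed (use cl hom(3) in auto)
    moreover have "?f ` Wh ` X = Wh ` \<psi> ` X" "?f ` Bl ` X = Bl ` \<psi> ` X" for X
      by (simp_all add: image_image)
    ultimately show "?f ` darts (Phi0 B) = darts (Phi0 B')"
      unfolding B.Phi0_darts B'.Phi0_darts image_Un by (simp add: im)
  qed
  moreover have "black (Phi0 B') (?f x) = black (Phi0 B) x" "mweight (Phi0 B') (?f x) = mweight (Phi0 B) x"
    if "x \<in> darts (Phi0 B)" for x
    using that by (cases rule: B.Phi0_cases; simp add: hom(1)[symmetric] hom(4) B.alpha_closed)+
  ultimately show ?thesis unfolding mobile_iso_def using al sg by (intro exI[of _ ?f]) simp
qed

section \<open>Recognizing source-biorientations by their image\<close>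

context biori
begin

text \<open>Forgetting the constructors turns each step in \<open>P\<close> into a path in
  \<open>B\<close>: \<open>alpha P\<close> stays on one edge, \<open>sigma P\<close> moves within a
  face or a vertex.\<close>

lemma connected_of_Phi0:
  assumes "connected_prem P"
  shows "connected_prem B"
proof -
  define proj :: "'h mdart \<Rightarrow> 'h" where "proj = (\<lambda>x. case x of Bl h \<Rightarrow> h | Wh h \<Rightarrow> h)"
  have "(x, proj y) \<in> conn_rel\<^sup>*" if "x \<in> darts B" "y \<in> darts P" for x y
  proof -
    have "Bl x \<in> darts P" using that(1) by simp
    from assms this that(2) show ?thesis
    proof (induction rule: Phi.connected_induct)
      case (alpha y)
      have "(proj y, proj (alpha P y)) \<in> conn_rel\<^sup>*" using alpha(1)
      proof (cases rule: Phi0_cases)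
        case (black h)
        then show ?thesis using conn_alpha[of h]
          by (cases "ingoing B (alpha B h)"; cases "ingoing B h")
            (simp_all add: proj_def Phi0_alpha_bud Phi0_alpha_1way Phi0_alpha_0way)
      next
        case (white h)
        then show ?thesis using conn_alpha[of h]
          by (cases "ingoing B (alpha B h)") (simp_all add: proj_def Phi0_alpha_Wh1 Phi0_alpha_Wh2)
      qed
      with alpha(2) show ?case by (rule rtrancl_trans)
    next
      case (sigma y)
      have "(proj y, proj (sigma P y)) \<in> conn_rel\<^sup>*" using sigma(1)
      proof (cases rule: Phi0_cases)
        case (black h)
        then obtain k where k: "k \<in> darts B" "sigma B k = h" using sigma_pre by blast
        have "(h, k) \<in> conn_rel\<^sup>*" using conn_sym[OF conn_sigma[OF k(1)]] unfolding k(2) .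
        then have "(h, alpha B k) \<in> conn_rel\<^sup>*" using conn_alpha[OF k(1)] by (rule rtrancl_trans)
        then show ?thesis using black Phi0_sigma_Bl[OF k(1)] k(2) unfolding proj_def by simp
      next
        case (white h)
        then show ?thesis unfolding proj_def using conn_vertex nextIn_closed by simp
      qed
      with sigma(2) show ?case by (rule rtrancl_trans)
    qed (simp add: proj_def)
  qed
  then show ?thesis unfolding connected_iff proj_def by (metis Phi0_Bl_in mdart.simps(5))
qed

text \<open>Chains of parents end. At the origin of an ingoing half-edge without parent nothing is
  ingoing, since by \<open>par_exists\<close> any such half-edge would provide a parent.\<close>

lemma exists_source:
  assumes "acyclic par" "darts B \<noteq> {}"
  shows "\<exists>r\<in>darts B. \<forall>d\<in>vertex B r. \<not> ingoing B d"
proof (cases "\<exists>i\<in>darts B. ingoing B i")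
  case False
  then show ?thesis using assms(2) vertex_sub by blast
next
  case True
  have "wf (par\<inverse>)" using assms(1) finite_par by (rule finite_acyclic_wf_converse[rotated])
  moreover obtain i0 where "i0 \<in> {i\<in>darts B. ingoing B i}" using True by blast
  ultimately obtain i where i: "i \<in> darts B" "ingoing B i"
    and max: "\<And>j. (j, i) \<in> par\<inverse> \<Longrightarrow> j \<notin> {i\<in>darts B. ingoing B i}"
    by (rule wfE_min) blast
  have "\<not> ingoing B d" if d: "d \<in> vertex B (alpha B i)" for d
  proof
    assume "ingoing B d"
    then obtain j where "(i, j) \<in> par" using par_exists[OF i d] by blast
    then show False using max[of j] unfolding par_def by auto
  qed
  then show ?thesis using alpha_closed[OF i(1)] by blast
qed

text \<open>Walking counterclockwise around a vertex from the left side of a circuit, the next ingoing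
  half-edge is still on the left or on the circuit; so on the left side of a counterclockwise circuit
  the iterated parents never reach the source.\<close>

lemma left_side_rotate:
  assumes "is_circuit B cs" "d \<in> darts B" "sigma B d \<notin> right_region cs"
  shows "alpha B d \<notin> right_region cs" "d \<notin> set cs"
    "alpha B d \<in> set cs \<longrightarrow> ingoing B d" "alpha B d \<notin> set cs \<Longrightarrow> d \<notin> right_region cs"
proof -
  show a: "alpha B d \<notin> right_region cs" using right_region_sigma[OF assms(2)] assms(3) by blast
  show b: "d \<notin> set cs" using right_region_circuit[OF assms(1)] a by blast
  show "alpha B d \<in> set cs \<longrightarrow> ingoing B d"
  proof
    assume "alpha B d \<in> set cs"
    then obtain i where "i < length cs" "cs ! i = alpha B d" by (auto simp: in_set_conv_nth)
    then have "ingoing B (alpha B (alpha B d))" using assms(1) unfolding is_circuit_def by metis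
    then show "ingoing B d" using alpha_alpha[OF assms(2)] by simp
  qed
  show "alpha B d \<notin> set cs \<Longrightarrow> d \<notin> right_region cs" using right_region_edge[OF assms(2) b] a by blast
qed

text \<open>Positions are descended from \<open>s\<close>. Inside the gap all half-edges are
  outgoing, so no arrival of the circuit is met, and the turn cannot leave the left side.\<close>

lemma left_side_walk:
  assumes "is_circuit B cs" "x \<in> darts B" "(sigma B ^^ s) x \<notin> right_region cs" "gap x s"
    "1 \<le> u" "u \<le> s"
  shows "(sigma B ^^ u) x \<notin> right_region cs"
  using assms(6,5)
proof (induction u rule: inc_induct)
  case (step u)
  have D: "(sigma B ^^ u) x \<in> darts B" by (rule funpow_sigma_closed[OF assms(2)])
  have "sigma B ((sigma B ^^ u) x) \<notin> right_region cs" using step by simp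
  note r = left_side_rotate[OF assms(1) D this]
  have "\<not> ingoing B ((sigma B ^^ u) x)" using assms(4) step by simp
  then show ?case using r by blast
qed (rule assms(3))

text \<open>With I the number of vertices having an ingoing half-edge, the tree relation says F + I
  = E + 1. The source gives V \<ge> I + 1 and the Euler inequality V \<le> I + 1; equality yields
  genus 0 and a unique source, at which all chains of parents end.\<close>

theorem inB0_of_Phi0:
  assumes mob: "is_mobile P" and acyc: "acyclic par" and rD: "root B \<in> darts B"
    and src: "\<And>d. d \<in> vertex B (root B) \<Longrightarrow> \<not> ingoing B d"
  shows "inB0 B"
proof -
  let ?V = "vertex B ` darts B" and ?F = "face B ` darts B"
  let ?I = "{v \<in> ?V. \<exists>x\<in>v. ingoing B x}"
  have conn: "connected_prem B" using mob unfolding is_mobile_def by (intro connected_of_Phi0) blast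
  have e: "{d\<in>darts B. alpha B d \<noteq> d} = darts B" using alpha_ne by auto
  have 1: "card ?V + card ?F \<le> card (darts B) div 2 + 2"
    using euler_le[OF conn] rD unfolding e by blast
  have 2: "card ?F + card ?I = card (darts B) div 2 + 1"
    using mob unfolding is_mobile_def Phi0_card_vertices Phi0_card_nonbuds by blast
  have sub: "?I \<subseteq> ?V - {vertex B (root B)}" using src by blast
  have finV: "finite ?V" using finite_darts by simp
  have cV: "card (?V - {vertex B (root B)}) = card ?V - 1" "card ?V \<ge> 1"
    using rD finV by (auto simp: card_Diff_singleton Suc_le_eq card_gt_0_iff)
  have "card ?I \<le> card (?V - {vertex B (root B)})" using sub finV by (intro card_mono) auto
  then have 3: "card ?V = card ?I + 1" using 1 2 cV by linarith
  have "?I = ?V - {vertex B (root B)}" using sub finV 3 cV by (intro card_subset_eq) auto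
  then have unique: "\<exists>j\<in>vertex B d. ingoing B j" if "d \<in> darts B" "d \<notin> vertex B (root B)" for d
    using that vertex_self by blast
  have "int (card ?V) - int (card (darts B) div 2) + int (card ?F) = 2" using 2 3 by linarith
  then have pm: "is_planemap B"
    unfolding is_planemap_def using finite_darts rD alpha_bij alpha_alpha alpha_ne sigma_bij conn by auto
  have wf: "wf (par\<inverse>)" using acyc finite_par by (rule finite_acyclic_wf_converse[rotated])
  have root_acc: "(root B, d) \<in> (acc_rel B)\<^sup>*" if "d \<in> vertex B (root B)" for d
    using that vertex_sub[OF rD] rD unfolding acc_rel_def by auto
  \<comment> \<open>Parents come earlier on the way from the root-vertex: the parent of
    \<open>i\<close> enters the vertex from which the edge of \<open>i\<close> departs.\<close>
  have ing_acc: "(root B, i) \<in> (acc_rel B)\<^sup>*" if "i \<in> darts B" "ingoing B i" for i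
    using wf that
  proof (induction i rule: wf_induct_rule)
    case (less i)
    have aD: "alpha B i \<in> darts B" using less.prems alpha_closed by blast
    have st: "(alpha B i, i) \<in> acc_rel B"
      unfolding acc_rel_def using less.prems aD alpha_alpha by simp
    have "(root B, alpha B i) \<in> (acc_rel B)\<^sup>*"
    proof (cases "alpha B i \<in> vertex B (root B)")
      case False
      then obtain j where "j \<in> vertex B (alpha B i)" "ingoing B j" using unique[OF aD] by blast
      then obtain p where p: "(i, p) \<in> par" using par_exists[OF less.prems] by blast
      have pD: "p \<in> darts B" "ingoing B p" using p unfolding par_def by auto
      have "(root B, p) \<in> (acc_rel B)\<^sup>*" using less.IH[OF _ pD] p by blast
      moreover have "(p, alpha B i) \<in> acc_rel B"
        unfolding acc_rel_def using pD aD par_vertex[OF p] by simp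
      ultimately show ?thesis by (rule rtrancl_into_rtrancl)
    qed (rule root_acc)
    then show ?case using st by (rule rtrancl_into_rtrancl)
  qed
  have acc: "(root B, d) \<in> (acc_rel B)\<^sup>*" if d: "d \<in> darts B" for d
  proof (cases "d \<in> vertex B (root B)")
    case False
    then obtain j where j: "j \<in> vertex B d" "ingoing B j" using unique[OF d] by blast
    have jD: "j \<in> darts B" using vertex_sub[OF d] j(1) by blast
    have "d \<in> vertex B j" using vertex_eq[OF d j(1)] by simp
    then have "(j, d) \<in> acc_rel B" unfolding acc_rel_def using d jD by simp
    with ing_acc[OF jD j(2)] show ?thesis by (rule rtrancl_into_rtrancl)
  qed (rule root_acc)
  have "minimal_wrt B (face B (root B))"
    unfolding minimal_wrt_def
  proof
    assume "\<exists>cs. is_circuit B cs \<and> ccw_wrt B (face B (root B)) cs"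
    then obtain cs where cs: "is_circuit B cs" and rR: "root B \<in> right_region cs"
      using ccw_iff_right_region[OF _ rD] by blast
    let ?R = "right_region cs"
    \<comment> \<open>Either the circuit itself traverses the edge towards \<open>i\<close>, or both
      sides of the edge avoid the right region. In both cases \<open>alpha B i\<close> is off that
      region, and turning counterclockwise from it passes the property on to the parent.\<close>
    define left where "left = (\<lambda>i. i \<in> darts B \<and> ingoing B i \<and>
      (alpha B i \<in> set cs \<or> (i \<notin> ?R \<and> alpha B i \<notin> ?R)))"
    have "\<not> left i" for i
      using wf
    proof (induction i rule: wf_induct_rule)
      case (less i)
      show ?case
      proof
        assume l: "left i"
        then have iD: "i \<in> darts B" "ingoing B i" unfolding left_def by auto
        have aD: "alpha B i \<in> darts B" using alpha_closed[OF iD(1)] .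
        have aR: "alpha B i \<notin> ?R" using l right_region_left[OF pm cs] unfolding left_def by blast
        show False
        proof (cases "alpha B i \<in> vertex B (root B)")
          case True
          then obtain s where s: "s > 0" "(sigma B ^^ s) (root B) = alpha B i"
            using vertex_positive_power[OF rD] by blast
          \<comment> \<open>At the source nothing is ingoing, so the turn continues to
            \<open>root B\<close> itself and would place it on the left.\<close>
          have "gap (root B) s" using src funpow_vertex by blast
          then have "(sigma B ^^ 1) (root B) \<notin> ?R"
            using left_side_walk[OF cs rD, of s 1] s aR by simp
          then have "root B \<notin> ?R"
            using left_side_rotate[OF cs rD] src[OF vertex_self] by auto
          then show False using rR by blast
        next
          case False
          then obtain j where "j \<in> vertex B (alpha B i)" "ingoing B j" using unique[OF aD] by blast
          then obtain p where p: "(i, p) \<in> par" using par_exists[OF iD] by blast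
          then obtain s where s: "s > 0" "(sigma B ^^ s) p = alpha B i" "gap p s"
            and pD: "p \<in> darts B" "ingoing B p" unfolding par_def by auto
          have "(sigma B ^^ 1) p \<notin> ?R" using left_side_walk[OF cs pD(1), of s 1] s aR by simp
          then have "left p" unfolding left_def using left_side_rotate[OF cs pD(1)] pD by auto
          then show False using less.IH[of p] p by blast
        qed
      qed
    qed
    moreover have "left (alpha B (hd cs))"
    proof -
      have h: "hd cs \<in> set cs" "hd cs = cs ! 0" "0 < length cs" "hd cs \<in> darts B"
        using cs unfolding is_circuit_def by (auto simp: hd_conv_nth)
      then have "ingoing B (alpha B (hd cs))" using cs unfolding is_circuit_def by auto
      then show ?thesis unfolding left_def using h alpha_closed alpha_alpha by simp
    qed
    ultimately show False by blast
  qed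
  then show ?thesis unfolding inB0_def using pm rD src acc vertex_self by blast
qed

end

section \<open>Matching the contour of a mobile\<close>

locale mobile0 = rotsys M for M :: "('h, 'z) mobile_scheme" +
  assumes mobile: "is_mobile M" and excess0: "excess M = 0"
begin

lemma black_sigma: "d \<in> darts M \<Longrightarrow> black M (sigma M d) = black M d"
  and bud_black: "d \<in> darts M \<Longrightarrow> alpha M d = d \<Longrightarrow> black M d"
  using mobile unfolding is_mobile_def by auto

definition phi where "phi d = sigma M (alpha M d)"

lemma face_phi: "face M d = orb phi d"
  unfolding face_def phi_def[abs_def] comp_def ..

lemma phi_closed: "d \<in> darts M \<Longrightarrow> phi d \<in> darts M"
  by (simp add: phi_def sigma_closed alpha_closed)

lemma phi_inj: "d \<in> darts M \<Longrightarrow> e \<in> darts M \<Longrightarrow> phi d = phi e \<Longrightarrow> d = e"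
  unfolding phi_def using sigma_inj alpha_inj alpha_closed by blast

lemma phi_pow_closed: "d \<in> darts M \<Longrightarrow> (phi ^^ n) d \<in> darts M"
  by (induction n) (simp_all add: phi_closed)

lemma phi_pow_inj: "d \<in> darts M \<Longrightarrow> e \<in> darts M \<Longrightarrow> (phi ^^ n) d = (phi ^^ n) e \<Longrightarrow> d = e"
proof (induction n)
  case (Suc n)
  have "(phi ^^ n) d = (phi ^^ n) e"
    by (rule phi_inj) (use Suc.prems phi_pow_closed in auto)
  then show ?case using Suc by blast
qed simp

text \<open>A mobile has V = E + 1, so V + F \<le> E + 2 leaves a single face: the contour visits
  every half-edge.\<close>

lemma one_face: "x \<in> darts M \<Longrightarrow> y \<in> darts M \<Longrightarrow> y \<in> face M x"
proof -
  assume D: "x \<in> darts M" "y \<in> darts M"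
  have "connected_prem M" "card (vertex M ` darts M) = card {d\<in>darts M. alpha M d \<noteq> d} div 2 + 1"
    using mobile unfolding is_mobile_def by blast+
  moreover have "darts M \<noteq> {}" using D by blast
  ultimately have "card (face M ` darts M) \<le> 1"
    using euler_le by linarith
  moreover have "finite (face M ` darts M)" using finite_darts by simp
  ultimately have all: "\<forall>a\<in>face M ` darts M. \<forall>b\<in>face M ` darts M. a = b"
    using card_le_Suc0_iff_eq[of "face M ` darts M"] unfolding One_nat_def by blast
  have "face M x = face M y" by (rule all[rule_format]) (use D in simp_all)
  then show ?thesis using face_self by metis
qed

text \<open>An opening parenthesis is charged to the step that crosses an edge towards a white end,
  so the white half-edge concerned is \<open>alpha M d\<close>.\<close>

definition val :: "'h \<Rightarrow> int" where
  "val d = (if alpha M d = d then - 1 else if black M (alpha M d) then 0 else 1)"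

primrec csum :: "nat \<Rightarrow> 'h \<Rightarrow> int" where
  "csum 0 x = 0"
| "csum (Suc t) x = val x + csum t (phi x)"

lemma csum_add: "csum (s + t) x = csum s x + csum t ((phi ^^ s) x)"
  by (induction s arbitrary: x) (simp_all add: funpow_swap1)

lemma csum_sum: "csum t x = (\<Sum>i<t. val ((phi ^^ i) x))"
proof (induction t)
  case (Suc t)
  have "csum (Suc t) x = csum t x + csum 1 ((phi ^^ t) x)" using csum_add[of t 1 x] by simp
  then show ?case using Suc by simp
qed simp

text \<open>The positive terms of the excess together count the half-edges with white opposite,
  hence the white half-edges; excess zero says that there are as many of them as buds.\<close>

lemma card_white_buds: "card {d\<in>darts M. \<not> black M d} = card {d\<in>darts M. alpha M d = d}"
  and sum_val: "(\<Sum>d\<in>darts M. val d) = 0"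
proof -
  let ?A = "{d\<in>darts M. alpha M d \<noteq> d \<and> black M d \<and> \<not> black M (alpha M d)}"
  let ?C = "{d\<in>darts M. alpha M d \<noteq> d \<and> \<not> black M d \<and> \<not> black M (alpha M d)}"
  let ?U = "{d\<in>darts M. alpha M d \<noteq> d \<and> \<not> black M (alpha M d)}"
  let ?N = "{d\<in>darts M. alpha M d = d}"
  have "card ?U = card (?A \<union> ?C)" by (rule arg_cong[of _ _ card]) auto
  also have "\<dots> = card ?A + card ?C" using finite_darts by (intro card_Un_disjoint) auto
  finally have U: "card ?U = card ?N" using excess0 unfolding excess_def by simp
  have "bij_betw (alpha M) ?U {d\<in>darts M. \<not> black M d}"
    by (rule bij_betw_byWitness[where f'="alpha M"])
      (use bud_black in \<open>auto simp: alpha_closed alpha_alpha\<close>)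
  from bij_betw_same_card[OF this] U show "card {d\<in>darts M. \<not> black M d} = card ?N" by (rule trans[OF sym])
  have "val d = (if d \<in> ?U then 1 else 0) - (if d \<in> ?N then 1 else 0)" if "d \<in> darts M" for d
    unfolding val_def using that by simp
  then have "(\<Sum>d\<in>darts M. val d) = (\<Sum>d\<in>darts M. (if d \<in> ?U then 1 else 0) - (if d \<in> ?N then 1 else 0))"
    by (rule sum.cong[OF refl])
  also have "\<dots> = int (card ?U) - int (card ?N)"
    using finite_darts by (simp add: sum_subtractf sum.If_cases Int_def conj_commute)
  finally show "(\<Sum>d\<in>darts M. val d) = 0" using U by simp
qed

text \<open>With a single face, one period of the contour meets each half-edge exactly once and has
  the total sum 0. The form \<open>Suc k\<close> lets the first letter be split off.\<close>

lemma full_turn: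
  assumes "x \<in> darts M"
  shows "\<exists>k. csum (Suc k) x = 0"
proof -
  have "x \<in> face M (phi x)" using one_face[OF phi_closed[OF assms] assms] .
  then obtain m where "x = (phi ^^ m) (phi x)" unfolding face_phi orb_def by blast
  then have ex: "\<exists>k. 0 < k \<and> (phi ^^ k) x = x" by (intro exI[of _ "Suc m"]) (simp add: funpow_swap1)
  define k where "k = (LEAST k. 0 < k \<and> (phi ^^ k) x = x)"
  have k: "0 < k" "(phi ^^ k) x = x" unfolding k_def using LeastI_ex[OF ex] by auto
  have kmin: "(phi ^^ j) x \<noteq> x" if "0 < j" "j < k" for j
    using not_less_Least[of j "\<lambda>k. 0 < k \<and> (phi ^^ k) x = x"] that unfolding k_def by blast
  have no: False if "i < j" "j < k" "(phi ^^ i) x = (phi ^^ j) x" for i j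
  proof -
    have "(phi ^^ j) x = (phi ^^ i) ((phi ^^ (j - i)) x)"
      using that(1) by (metis comp_apply funpow_add le_add_diff_inverse less_imp_le)
    then have "(phi ^^ (j - i)) x = x"
      using that(3) phi_pow_inj[OF phi_pow_closed[OF assms] assms] by metis
    then show False using kmin[of "j - i"] that(1,2) by simp
  qed
  have inj: "inj_on (\<lambda>i. (phi ^^ i) x) {..<k}"
  proof (rule inj_onI)
    fix i j assume "i \<in> {..<k}" "j \<in> {..<k}" "(phi ^^ i) x = (phi ^^ j) x"
    then show "i = j" using no[of i j] no[of j i] by (cases i j rule: linorder_cases) auto
  qed
  have im: "(\<lambda>i. (phi ^^ i) x) ` {..<k} = darts M"
  proof (intro equalityI subsetI)
    fix y assume "y \<in> darts M"
    then obtain m where "y = (phi ^^ m) x"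
      using one_face[OF assms] unfolding face_phi orb_def by blast
    then have "y = (phi ^^ (m mod k)) x" using funpow_mod_eq[OF k(2)] by metis
    moreover have "m mod k < k" using k(1) by simp
    ultimately show "y \<in> (\<lambda>i. (phi ^^ i) x) ` {..<k}" by blast
  qed (use phi_pow_closed[OF assms] in blast)
  have "csum k x = (\<Sum>i<k. val ((phi ^^ i) x))" by (rule csum_sum)
  also have "\<dots> = (\<Sum>d\<in>darts M. val d)" using sum.reindex[OF inj, of val] im by (simp add: comp_def)
  finally have "csum k x = 0" using sum_val by simp
  then show ?thesis using k(1) by (cases k) auto
qed

text \<open>A run is a first passage of the partial sums to -1; the opening step of an excursion and
  the run closing it cancel. It ends at \<open>sigma M b\<close> because \<open>b\<close> is fixed
  by \<open>alpha M\<close>.\<close>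

lemma run_csum:
  assumes "run M x b n"
  shows "csum n x = -1 \<and> (phi ^^ n) x = sigma M b \<and> alpha M b = b \<and> 0 < n \<and> (\<forall>m<n. 0 \<le> csum m x)"
  using assms
proof (induction rule: run.induct)
  case (bud x)
  then show ?case by (simp add: val_def phi_def)
next
  case (black x b n)
  note IH = black.IH[folded phi_def]
  have v: "val x = 0" using black.hyps unfolding val_def by simp
  have "0 \<le> csum m x" if "m < Suc n" for m using that IH v by (cases m) auto
  moreover have "(phi ^^ Suc n) x = (phi ^^ n) (phi x)" by (simp add: funpow_swap1)
  ultimately show ?case using IH v by simp
next
  case (white x b' n' b n)
  have v: "val x = 1" using white.hyps unfolding val_def by simp
  note 1 = white.IH(1)[folded phi_def] and 2 = white.IH(2)
  have p: "(phi ^^ n') (phi x) = sigma M b'" using 1 by simp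
  have "0 \<le> csum m x" if m: "m < Suc (n' + n)" for m
  proof (cases m)
    case (Suc k)
    show ?thesis
    proof (cases "k < n'")
      case True
      then show ?thesis using 1 v Suc by simp
    next
      case False
      then obtain l where l: "k = n' + l" by (metis add.commute le_add_diff_inverse2 not_less)
      then have "0 \<le> csum l (sigma M b')" using 2 m Suc by simp
      then show ?thesis using Suc l csum_add[of n' l "phi x"] p 1 v by simp
    qed
  qed simp
  moreover have "csum (Suc (n' + n)) x = -1" using csum_add[of n' n "phi x"] p 1 2 v by simp
  moreover have "(phi ^^ Suc (n' + n)) x = sigma M b"
  proof -
    have "(phi ^^ Suc (n' + n)) x = (phi ^^ (n' + n)) (phi x)" by (simp add: funpow_swap1)
    also have "\<dots> = (phi ^^ n) ((phi ^^ n') (phi x))" by (metis add.commute comp_apply funpow_add)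
    finally show ?thesis using p 2 by simp
  qed
  ultimately show ?case using 2 by blast
qed

text \<open>A contour word of negative sum passes below zero. The bound \<open>n \<le> t\<close>
  lets the induction hypothesis apply again to what remains after an excursion.\<close>

lemma run_exists:
  assumes "csum t x < 0"
  shows "\<exists>b n. n \<le> t \<and> run M x b n"
  using assms
proof (induction t arbitrary: x rule: less_induct)
  case (less t)
  then obtain s where t: "t = Suc s" by (cases t) auto
  consider "alpha M x = x" | "alpha M x \<noteq> x" "black M (alpha M x)" | "alpha M x \<noteq> x" "\<not> black M (alpha M x)"
    by blast
  then show ?case
  proof cases
    case 1
    then show ?thesis using run.bud[of M x] t by (intro exI[of _ x] exI[of _ 1]) simp
  next
    case 2
    then have "csum s (phi x) < 0" using less.prems t by (simp add: val_def)
    then obtain b n where "n \<le> s" "run M (phi x) b n" using less.IH[of s] t by blast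
    then show ?thesis using run.black[OF 2, of b n] t unfolding phi_def by auto
  next
    case 3
    have v: "val x = 1" using 3 by (simp add: val_def)
    then have "csum s (phi x) < 0" using less.prems t by simp
    then obtain b' n' where 1: "n' \<le> s" "run M (phi x) b' n'" using less.IH[of s] t by blast
    obtain l where l: "s = n' + l" using 1(1) by (metis le_add_diff_inverse)
    have "csum l (sigma M b') < 0"
      using less.prems t v csum_add[of n' l "phi x"] l run_csum[OF 1(2)] by simp
    moreover have "l < t" using t l by simp
    ultimately obtain b n where 2: "n \<le> l" "run M (sigma M b') b n" using less.IH[of l] by blast
    have "run M x b (Suc (n' + n))" using run.white[OF 3 1(2)[unfolded phi_def] 2(2)] .
    moreover have "Suc (n' + n) \<le> t" using 2(1) t l by simp
    ultimately show ?thesis by blast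
  qed
qed

section \<open>Matching white half-edges with buds\<close>

lemma white_not_bud: "w \<in> darts M \<Longrightarrow> \<not> black M w \<Longrightarrow> alpha M w \<noteq> w"
  using bud_black by blast

text \<open>The full turn starts one step early, at \<open>alpha M w\<close>, whose letter is the
  opening parenthesis of \<open>w\<close>; the turn sums to 0, so the rest sums to -1.\<close>

lemma white_run:
  assumes "w \<in> darts M" "\<not> black M w"
  shows "\<exists>b n. run M (sigma M w) b n"
proof -
  let ?x = "alpha M w"
  have "?x \<in> darts M" using assms(1) by (rule alpha_closed)
  then obtain k where "csum (Suc k) ?x = 0" using full_turn by blast
  moreover have "val ?x = 1"
    unfolding val_def using assms white_not_bud[OF assms] by (auto simp: alpha_alpha)
  moreover have "phi ?x = sigma M w" using alpha_alpha[OF assms(1)] by (simp add: phi_def)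
  ultimately have "csum k (sigma M w) < 0" by simp
  then show ?thesis using run_exists by blast
qed

definition mate :: "'h \<Rightarrow> 'h" where "mate w = (SOME b. \<exists>n. run M (sigma M w) b n)"

lemma mate_run:
  assumes "w \<in> darts M" "\<not> black M w"
  shows "\<exists>n. run M (sigma M w) (mate w) n"
  unfolding mate_def using white_run[OF assms] by (rule someI_ex)

lemma mate_eq:
  assumes "w \<in> darts M" "\<not> black M w" "run M (sigma M w) b n"
  shows "mate w = b"
  using mate_run[OF assms(1,2)] assms(3) run_unique by fast

lemma mate_bud:
  assumes "w \<in> darts M" "\<not> black M w"
  shows "mate w \<in> darts M" "alpha M (mate w) = mate w"
proof -
  obtain n where n: "run M (sigma M w) (mate w) n" using mate_run[OF assms] by blast
  show "mate w \<in> darts M" using run_connected[OF rotsys_axioms n sigma_closed[OF assms(1)]] by blast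
  show "alpha M (mate w) = mate w" using run_csum[OF n] by blast
qed

text \<open>The shorter run is a final piece of the longer one. If it were a proper piece, the
  opening step towards \<open>w\<close> would precede it, and the longer run would have reached -1
  already before that step.\<close>

lemma run_start_unique:
  assumes w: "w \<in> darts M" "\<not> black M w" and v: "v \<in> darts M" "\<not> black M v"
    and r: "run M (sigma M w) b n" "run M (sigma M v) b k" and le: "n \<le> k"
  shows "w = v"
proof -
  have sD: "sigma M w \<in> darts M" "sigma M v \<in> darts M" using w v sigma_closed by auto
  note 1 = run_csum[OF r(1)] and 2 = run_csum[OF r(2)]
  have "(phi ^^ k) (sigma M v) = (phi ^^ n) ((phi ^^ (k - n)) (sigma M v))"
    using le by (metis comp_apply funpow_add le_add_diff_inverse)
  then have e: "(phi ^^ (k - n)) (sigma M v) = sigma M w"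
    using 1 2 phi_pow_inj[OF phi_pow_closed[OF sD(2)] sD(1)] by metis
  show ?thesis
  proof (cases "k = n")
    case True
    then show ?thesis using e sigma_inj w v by simp
  next
    case False
    then obtain j where j: "k - n = Suc j" using le by (metis diff_is_0_eq le_antisym not0_implies_Suc)
    let ?x = "(phi ^^ j) (sigma M v)"
    have xD: "?x \<in> darts M" using phi_pow_closed[OF sD(2)] .
    have "sigma M (alpha M ?x) = sigma M w" using e unfolding j by (simp add: phi_def)
    then have ax: "alpha M ?x = w" using sigma_inj[OF alpha_closed[OF xD] w(1)] by blast
    then have "alpha M ?x \<noteq> ?x" using bud_black[OF xD] w(2) by auto
    then have "val ?x = 1" unfolding val_def using ax w(2) by simp
    moreover have "csum (k - n) (sigma M v) = csum j (sigma M v) + val ?x"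
      using csum_add[of j 1 "sigma M v"] unfolding j by simp
    moreover have "csum k (sigma M v) = csum (k - n) (sigma M v) + csum n (sigma M w)"
      using csum_add[of "k - n" n "sigma M v"] e le by simp
    ultimately have "csum j (sigma M v) = -1" using 1 2 by simp
    moreover have "j < k" using j by simp
    ultimately show ?thesis using 2 by fastforce
  qed
qed

text \<open>Surjectivity comes from counting: by excess zero there are as many white half-edges as
  buds.\<close>

lemma mate_bij: "bij_betw mate {d\<in>darts M. \<not> black M d} {d\<in>darts M. alpha M d = d}"
proof -
  have "inj_on mate {d\<in>darts M. \<not> black M d}"
  proof (rule inj_onI)
    fix w v assume w: "w \<in> {d\<in>darts M. \<not> black M d}" and v: "v \<in> {d\<in>darts M. \<not> black M d}"
      and e: "mate w = mate v"
    obtain n k where "run M (sigma M w) (mate w) n" "run M (sigma M v) (mate w) k"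
      using mate_run w v e by fastforce
    then show "w = v"
      using run_start_unique[of w v "mate w" n k] run_start_unique[of v w "mate w" k n] w v
      by (cases "n \<le> k") auto
  qed
  moreover have "mate ` {d\<in>darts M. \<not> black M d} \<subseteq> {d\<in>darts M. alpha M d = d}"
    using mate_bud by blast
  moreover have "card (mate ` {d\<in>darts M. \<not> black M d}) = card {d\<in>darts M. alpha M d = d}"
    using calculation(1) card_white_buds by (simp add: card_image)
  ultimately show ?thesis
    unfolding bij_betw_def using finite_darts by (intro conjI card_subset_eq) simp_all
qed

end

section \<open>Closing a mobile\<close>

context mobile0
begin

definition unmate :: "'h \<Rightarrow> 'h" where "unmate = inv_into {d\<in>darts M. \<not> black M d} mate"

lemma unmate_mate: "w \<in> darts M \<Longrightarrow> \<not> black M w \<Longrightarrow> unmate (mate w) = w"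
  unfolding unmate_def using mate_bij by (intro inv_into_f_f) (auto simp: bij_betw_def)

lemma bud_cases:
  assumes "x \<in> darts M" "alpha M x = x"
  obtains w where "w \<in> darts M" "\<not> black M w" "x = mate w" "unmate x = w"
proof -
  have "x \<in> mate ` {d\<in>darts M. \<not> black M d}" using mate_bij assms by (simp add: bij_betw_def)
  then obtain w where "w \<in> darts M" "\<not> black M w" "x = mate w" by blast
  then show ?thesis using that unmate_mate by blast
qed

text \<open>\<open>site x\<close> is the half-edge which faces the black half-edge \<open>x\<close> in the edge of the biorientation
  completed from \<open>x\<close>; if it is white, it is the white half-edge named \<open>Wh x\<close> by \<open>Phi0\<close>.\<close>

definition site :: "'h \<Rightarrow> 'h" where
  "site x = (if alpha M x = x then alpha M (unmate x) else alpha M x)"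

text \<open>The edge involution of the closure. A white \<open>site x\<close> opens a parenthesis,
  and the opposite half-edge of the completed edge is the bud that closes it.\<close>

definition twin :: "'h \<Rightarrow> 'h" where
  "twin x = (if black M (site x) then site x else mate (site x))"

abbreviation "blacks \<equiv> {d\<in>darts M. black M d}"

text \<open>Solves \<open>sigma M (turn y) = twin y\<close>, the relation that \<open>Phi0\<close>
  imposes between the two rotations on black half-edges.\<close>

definition turn :: "'h \<Rightarrow> 'h" where "turn y = inv_into blacks (sigma M) (twin y)"

text \<open>\<open>Phi0\<close> creates one black half-edge per half-edge of the biorientation, so
  the black half-edges of the mobile serve as its half-edges. Weights are read where
  \<open>Phi0\<close> puts them.\<close>

definition closure :: "'h \<Rightarrow> 'h wbiori" where
  "closure r = \<lparr>darts = blacks, alpha = twin, sigma = turn,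
     ingoing = (\<lambda>x. \<not> black M (site x)),
     weight = (\<lambda>x. mweight M (if black M (site x) then twin x else site x)), root = r\<rparr>"

text \<open>In this order: a 0-way edge, a 1-way edge seen from its ingoing and from its outgoing
  half-edge, a 2-way edge. The colour of \<open>site x\<close> gives the direction at
  \<open>x\<close>; being a bud gives that at \<open>twin x\<close>.\<close>

lemma twin_cases [consumes 1, case_names nonbud_black nonbud_white bud_black bud_white]:
  assumes "x \<in> blacks"
  obtains "alpha M x \<noteq> x" "black M (alpha M x)" "site x = alpha M x" "twin x = alpha M x"
    "site (twin x) = x" "alpha M (twin x) \<noteq> twin x"
  | "alpha M x \<noteq> x" "\<not> black M (alpha M x)" "site x = alpha M x" "twin x = mate (alpha M x)"
    "site (twin x) = x" "alpha M (twin x) = twin x"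
  | w where "alpha M x = x" "w \<in> darts M" "\<not> black M w" "x = mate w" "black M (alpha M w)"
    "site x = alpha M w" "twin x = alpha M w" "site (twin x) = w" "alpha M (twin x) \<noteq> twin x"
  | w where "alpha M x = x" "w \<in> darts M" "\<not> black M w" "x = mate w" "\<not> black M (alpha M w)"
    "site x = alpha M w" "twin x = mate (alpha M w)" "site (twin x) = w" "alpha M (twin x) = twin x"
proof (cases "alpha M x = x")
  case False
  have D: "x \<in> darts M" "alpha M x \<in> darts M" "alpha M (alpha M x) = x"
    using assms alpha_closed alpha_alpha by auto
  have s: "site x = alpha M x" unfolding site_def using False by simp
  show ?thesis
  proof (cases "black M (alpha M x)")
    case True
    have "twin x = alpha M x" unfolding twin_def s using True by simp
    then show ?thesis using that(1) False True s D unfolding site_def by simp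
  next
    case w: False
    have t: "twin x = mate (alpha M x)" unfolding twin_def s using w by simp
    have "site (twin x) = x" unfolding t site_def using mate_bud[OF D(2) w] unmate_mate[OF D(2) w] D(3) by simp
    then show ?thesis using that(2) False w s t mate_bud[OF D(2) w] by simp
  qed
next
  case True
  have "x \<in> darts M" using assms by simp
  then obtain w where w: "w \<in> darts M" "\<not> black M w" "x = mate w" "unmate x = w"
    using bud_cases True by blast
  have D: "alpha M w \<in> darts M" "alpha M (alpha M w) = w" using alpha_closed alpha_alpha w by auto
  have s: "site x = alpha M w" unfolding site_def using True w by simp
  show ?thesis
  proof (cases "black M (alpha M w)")
    case b: True
    have t: "twin x = alpha M w" unfolding twin_def s using b by simp
    have n: "alpha M (alpha M w) \<noteq> alpha M w" using D(2) b w(2) by auto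
    then have "site (twin x) = w" unfolding t site_def using D by simp
    then show ?thesis using that(3) True w b s t n by simp
  next
    case b: False
    have t: "twin x = mate (alpha M w)" unfolding twin_def s using b by simp
    have "site (twin x) = w" unfolding t site_def using mate_bud[OF D(1) b] unmate_mate[OF D(1) b] D(2) by simp
    then show ?thesis using that(4) True w b s t mate_bud[OF D(1) b] by simp
  qed
qed

lemma site_closed: "x \<in> blacks \<Longrightarrow> site x \<in> darts M"
  by (cases x rule: twin_cases) (auto simp: alpha_closed)

lemma twin_closed: "x \<in> blacks \<Longrightarrow> twin x \<in> blacks"
  by (cases x rule: twin_cases) (auto simp: alpha_closed mate_bud bud_black)

lemma twin_twin: assumes "x \<in> blacks" shows "twin (twin x) = x"
  using assms
proof (cases x rule: twin_cases)
  case nonbud_black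
  then show ?thesis using assms unfolding twin_def[of "twin x"] by simp
next
  case nonbud_white
  then show ?thesis using assms unfolding twin_def[of "twin x"] by simp
next
  case (bud_black w)
  then show ?thesis unfolding twin_def[of "twin x"] by simp
next
  case (bud_white w)
  then show ?thesis unfolding twin_def[of "twin x"] by simp
qed

lemma twin_ne: assumes "x \<in> blacks" shows "twin x \<noteq> x"
  using assms
proof (cases x rule: twin_cases)
  case (bud_white w)
  then have "site x \<noteq> site (twin x)" using white_not_bud by simp
  then show ?thesis by auto
qed auto

lemma site_twin_white: assumes "x \<in> blacks" shows "\<not> black M (site (twin x)) \<longleftrightarrow> alpha M x = x"
  using assms
proof (cases x rule: twin_cases)
  case nonbud_black
  then show ?thesis using assms by simp
next
  case nonbud_white
  then show ?thesis using assms by simp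
qed simp_all

lemma mate_site: "\<not> black M (site x) \<Longrightarrow> mate (site x) = twin x"
  unfolding twin_def by simp

lemma sigma_blacks: "bij_betw (sigma M) blacks blacks"
proof -
  have "inj_on (sigma M) blacks" using sigma_inj by (auto simp: inj_on_def)
  moreover have "sigma M ` blacks \<subseteq> blacks" using sigma_closed black_sigma by auto
  ultimately show ?thesis
    unfolding bij_betw_def using endo_inj_surj[of blacks "sigma M"] finite_darts by simp
qed

lemma turn_closed: "y \<in> blacks \<Longrightarrow> turn y \<in> blacks"
  and sigma_turn: "y \<in> blacks \<Longrightarrow> sigma M (turn y) = twin y"
proof -
  assume "y \<in> blacks"
  then have "twin y \<in> sigma M ` blacks" using twin_closed sigma_blacks unfolding bij_betw_def by simp
  then show "turn y \<in> blacks" "sigma M (turn y) = twin y"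
    unfolding turn_def by (rule inv_into_into, rule f_inv_into_f)
qed

lemma turn_twin_sigma:
  assumes "x \<in> blacks"
  shows "turn (twin (sigma M x)) = x"
proof -
  have s: "sigma M x \<in> blacks" using assms sigma_closed black_sigma by auto
  have "sigma M (turn (twin (sigma M x))) = sigma M x"
    using sigma_turn[OF twin_closed[OF s]] twin_twin[OF s] by simp
  then show ?thesis using sigma_inj turn_closed[OF twin_closed[OF s]] assms by blast
qed

lemma closure_biori: "biori (closure r)"
proof -
  have "bij_betw turn blacks blacks"
  proof -
    have "inj_on turn blacks"
    proof (rule inj_onI)
      fix x y assume "x \<in> blacks" "y \<in> blacks" "turn x = turn y"
      then have "twin x = twin y" using sigma_turn by metis
      then show "x = y" using twin_twin \<open>x \<in> blacks\<close> \<open>y \<in> blacks\<close> by metis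
    qed
    moreover have "turn ` blacks \<subseteq> blacks" using turn_closed by blast
    ultimately show ?thesis
      unfolding bij_betw_def using endo_inj_surj[of blacks turn] finite_darts by simp
  qed
  then show ?thesis
    unfolding biori_def rotsys_def biori_axioms_def closure_def
    using finite_darts twin_closed twin_twin twin_ne by simp
qed

text \<open>A step of the contour from \<open>y\<close> to \<open>sigma M (twin y)\<close> (possibly after an excursion)
  corresponds to a counterclockwise step around a vertex of the closure.\<close>

lemma run_rotate:
  assumes "run M y b n" "y \<in> blacks"
  shows "b \<in> blacks \<and> alpha M b = b \<and> (\<exists>t. (turn ^^ t) (twin b) = twin y \<and>
    (\<forall>u. 0 < u \<longrightarrow> u \<le> t \<longrightarrow> black M (site ((turn ^^ u) (twin b))) \<and>
      (let c = twin ((turn ^^ u) (twin b)) in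
        \<not> black M (site c) \<longrightarrow> (\<exists>k<n. run M (sigma M (site c)) (twin c) k))))"
  using assms
proof (induction rule: run.induct)
  case (bud x)
  then show ?case by (auto intro!: exI[of _ 0])
next
  case (black y b n)
  from black.prems black.hyps(1,2) have y: "twin y = alpha M y" "site (twin y) = y"
    by (cases y rule: twin_cases; simp)+
  have kb: "twin y \<in> blacks" using twin_closed black.prems by blast
  have s: "sigma M (twin y) \<in> blacks" using kb sigma_closed black_sigma by auto
  from black.IH s y(1) obtain t where b: "b \<in> blacks" "alpha M b = b" and
    t: "(turn ^^ t) (twin b) = twin (sigma M (twin y))"
    and u: "\<And>u. 0 < u \<Longrightarrow> u \<le> t \<Longrightarrow> black M (site ((turn ^^ u) (twin b))) \<and>
      (let c = twin ((turn ^^ u) (twin b)) in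
        \<not> black M (site c) \<longrightarrow> (\<exists>k<n. run M (sigma M (site c)) (twin c) k))" by auto
  \<comment> \<open>One more contour step prolongs the clockwise rotation by one position.\<close>
  have St: "(turn ^^ Suc t) (twin b) = twin y" using t turn_twin_sigma[OF kb] by simp
  have "black M (site ((turn ^^ u) (twin b))) \<and>
      (let c = twin ((turn ^^ u) (twin b)) in
        \<not> black M (site c) \<longrightarrow> (\<exists>k<Suc n. run M (sigma M (site c)) (twin c) k))" if "0 < u" "u \<le> Suc t" for u
  proof (cases "u = Suc t")
    case True
    have "site y = alpha M y" unfolding site_def using black.hyps by simp
    then show ?thesis unfolding True St Let_def twin_twin[OF black.prems] y(2) using black.prems black.hyps by simp
  next
    case False
    then show ?thesis using u[of u] that unfolding Let_def by (auto intro: less_SucI)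
  qed
  then show ?case using b St by blast
next
  case (white y b' n' b n)
  have sy: "site y = alpha M y" unfolding site_def using white.hyps by simp
  have aD: "alpha M y \<in> darts M" using white.prems alpha_closed by auto
  have b': "mate (alpha M y) = b'" using mate_eq[OF aD white.hyps(2,3)] .
  from white.prems white.hyps(1,2) have y: "twin y = b'" "site (twin y) = y"
    unfolding b'[symmetric] by (cases y rule: twin_cases; simp)+
  have kb: "twin y \<in> blacks" using twin_closed white.prems by blast
  have s: "sigma M (twin y) \<in> blacks" using kb sigma_closed black_sigma by auto
  from white.IH(2) s y(1) obtain t where b: "b \<in> blacks" "alpha M b = b" and
    t: "(turn ^^ t) (twin b) = twin (sigma M (twin y))"
    and u: "\<And>u. 0 < u \<Longrightarrow> u \<le> t \<Longrightarrow> black M (site ((turn ^^ u) (twin b))) \<and>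
      (let c = twin ((turn ^^ u) (twin b)) in
        \<not> black M (site c) \<longrightarrow> (\<exists>k<n. run M (sigma M (site c)) (twin c) k))" by auto
  have St: "(turn ^^ Suc t) (twin b) = twin y" using t turn_twin_sigma[OF kb] by simp
  have "black M (site ((turn ^^ u) (twin b))) \<and>
      (let c = twin ((turn ^^ u) (twin b)) in
        \<not> black M (site c) \<longrightarrow> (\<exists>k<Suc (n' + n). run M (sigma M (site c)) (twin c) k))"
    if "0 < u" "u \<le> Suc t" for u
  proof (cases "u = Suc t")
    case True
    \<comment> \<open>At the last position the opposite half-edge is \<open>y\<close> itself, and
      its run is the excursion just made.\<close>
    have "run M (sigma M (site y)) (twin y) n'" using white.hyps(3) y(1) sy by simp
    then show ?thesis unfolding True St Let_def twin_twin[OF white.prems] y(2) using white.prems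
      by (auto intro!: exI[of _ n'])
  next
    case False
    then show ?thesis using u[of u] that unfolding Let_def by (auto intro: trans_less_add2 less_SucI)
  qed
  then show ?case using b St by blast
qed

lemma site_surj:
  assumes "w \<in> darts M" "\<not> black M w"
  obtains j where "j \<in> blacks" "site j = w" "j = (if black M (alpha M w) then alpha M w else mate (alpha M w))"
proof (cases "black M (alpha M w)")
  case True
  have D: "alpha M w \<in> darts M" "alpha M (alpha M w) = w" using assms alpha_closed alpha_alpha by auto
  then have "alpha M (alpha M w) \<noteq> alpha M w" using True assms(2) by auto
  then have "site (alpha M w) = w" unfolding site_def using D by simp
  then show ?thesis using that[of "alpha M w"] True D by simp
next
  case False
  have D: "alpha M w \<in> darts M" "alpha M (alpha M w) = w" using assms alpha_closed alpha_alpha by auto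
  have "site (mate (alpha M w)) = w"
    unfolding site_def using mate_bud[OF D(1) False] unmate_mate[OF D(1) False] D(2) by simp
  then show ?thesis using that[of "mate (alpha M w)"] False mate_bud[OF D(1) False] bud_black by simp
qed

lemma site_inj:
  assumes "x \<in> blacks" "y \<in> blacks" "\<not> black M (site x)" "site x = site y"
  shows "x = y"
proof -
  have "twin x = twin y" using mate_site[of x] mate_site[of y] assms(3,4) by simp
  then show ?thesis using twin_twin assms(1,2) by metis
qed

text \<open>After the step across the edge of \<open>sigma M (site x)\<close>, with an excursion if
  the edge is white-white, \<open>run_rotate\<close> translates the rest of the run into a clockwise
  rotation from \<open>x\<close> to \<open>j\<close>. This identifies the next ingoing half-edge and
  shows that all children met have shorter runs.\<close>

lemma white_rotate:
  assumes x: "x \<in> blacks" "\<not> black M (site x)" and r: "run M (sigma M (site x)) (twin x) n"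
  shows "\<exists>j t. j \<in> blacks \<and> site j = sigma M (site x) \<and> 0 < t \<and> (turn ^^ t) x = j \<and>
    (\<forall>u. 0 < u \<longrightarrow> u < t \<longrightarrow> black M (site ((turn ^^ u) x))) \<and>
    (\<forall>u. 0 < u \<longrightarrow> u \<le> t \<longrightarrow> (let c = twin ((turn ^^ u) x) in
        \<not> black M (site c) \<longrightarrow> (\<exists>k<n. run M (sigma M (site c)) (twin c) k)))"
proof -
  let ?w = "sigma M (site x)"
  have w: "?w \<in> darts M" "\<not> black M ?w"
    using site_closed[OF x(1)] x(2) sigma_closed black_sigma by auto
  have aw: "alpha M ?w \<in> darts M" using w(1) alpha_closed by blast
  obtain j where j: "j \<in> blacks" "site j = ?w" "j = (if black M (alpha M ?w) then alpha M ?w else mate (alpha M ?w))"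
    using site_surj[OF w] .
  have sj: "sigma M j \<in> blacks" using j(1) sigma_closed black_sigma by auto
  obtain m where m: "m < n" "run M (sigma M j) (twin x) m"
    and tj: "\<not> black M (site (twin j)) \<Longrightarrow> \<exists>k<n. run M (sigma M (site (twin j))) j k"
  proof (cases "black M (alpha M ?w)")
    case True
    then have ja: "j = alpha M ?w" using j(3) by simp
    from r obtain m where m: "n = Suc m" "run M (sigma M (alpha M ?w)) (twin x) m"
      by (cases rule: run.cases) (use white_not_bud[OF w] True in simp_all)
    have "alpha M j \<noteq> j" using ja alpha_alpha[OF w(1)] white_not_bud[OF w] by auto
    then have "black M (site (twin j))" using site_twin_white[OF j(1)] by blast
    then show ?thesis using that[of m] m ja by simp
  next
    case False
    then have ja: "j = mate (alpha M ?w)" using j(3) by simp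
    from r obtain b' n' m where m: "n = Suc (n' + m)" "run M (sigma M (alpha M ?w)) b' n'"
      "run M (sigma M b') (twin x) m"
      by (cases rule: run.cases) (use white_not_bud[OF w] False in simp_all)
    have b': "b' = j" using mate_eq[OF aw False m(2)] ja by simp
    have "alpha M (alpha M ?w) \<noteq> alpha M ?w" using white_not_bud[OF aw False] .
    have st: "site (twin j) = alpha M ?w"
    proof -
      have "alpha M j = j" using mate_bud(2)[OF aw False] ja by simp
      have "unmate j = alpha M ?w" using unmate_mate[OF aw False] ja by simp
      show ?thesis using j(1)
      proof (cases j rule: twin_cases)
        case (bud_black v)
        then show ?thesis using \<open>unmate j = alpha M ?w\<close> unmate_mate[of v] by simp
      next
        case (bud_white v)
        then show ?thesis using \<open>unmate j = alpha M ?w\<close> unmate_mate[of v] by simp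
      qed (use \<open>alpha M j = j\<close> in simp_all)
    qed
    have "run M (sigma M (site (twin j))) j n'" using m(2) b' st by simp
    moreover have "n' < n" "m < n" using m(1) by simp_all
    ultimately show ?thesis using that[of m] m(3) b' by blast
  qed
  obtain t where t: "(turn ^^ t) (twin (twin x)) = twin (sigma M j)"
    and u: "\<And>u. 0 < u \<Longrightarrow> u \<le> t \<Longrightarrow> black M (site ((turn ^^ u) (twin (twin x)))) \<and>
      (let c = twin ((turn ^^ u) (twin (twin x))) in
        \<not> black M (site c) \<longrightarrow> (\<exists>k<m. run M (sigma M (site c)) (twin c) k))"
    using run_rotate[OF m(2) sj] by blast
  have xx: "twin (twin x) = x" using twin_twin[OF x(1)] .
  have St: "(turn ^^ Suc t) x = j" using t turn_twin_sigma[OF j(1)] unfolding xx by simp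
  have child: "let c = twin ((turn ^^ u) x) in
      \<not> black M (site c) \<longrightarrow> (\<exists>k<n. run M (sigma M (site c)) (twin c) k)" if "0 < u" "u \<le> Suc t" for u
  proof (cases "u = Suc t")
    case True
    show ?thesis unfolding True St Let_def twin_twin[OF j(1)] using tj by blast
  next
    case False
    then show ?thesis using u[of u] that m(1) unfolding xx Let_def by (auto intro: less_trans)
  qed
  have "black M (site ((turn ^^ u) x))" if "0 < u" "u < Suc t" for u
    using u[of u] that unfolding xx by simp
  then show ?thesis using j(1,2) St child by (intro exI[of _ j] exI[of _ "Suc t"]) simp
qed

section \<open>The closure as a preimage of the mobile\<close>

context
  fixes r :: 'h
begin

interpretation C: biori "closure r" by (rule closure_biori)

lemma closure_simps [simp]:
  "darts (closure r) = blacks" "alpha (closure r) = twin" "sigma (closure r) = turn"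
  "ingoing (closure r) x \<longleftrightarrow> \<not> black M (site x)" "root (closure r) = r"
  "weight (closure r) x = mweight M (if black M (site x) then twin x else site x)"
  unfolding closure_def by simp_all

lemma closure_nextIn:
  assumes x: "x \<in> blacks" "\<not> black M (site x)"
  shows "nextIn turn (ingoing (closure r)) x \<in> blacks"
    "site (nextIn turn (ingoing (closure r)) x) = sigma M (site x)"
proof -
  obtain n where "run M (sigma M (site x)) (twin x) n"
    using mate_run[OF site_closed[OF x(1)] x(2)] mate_site[OF x(2)] by auto
  from white_rotate[OF x this] obtain j t where j: "j \<in> blacks" "site j = sigma M (site x)"
    and t: "0 < t" "(turn ^^ t) x = j" "\<And>u. 0 < u \<Longrightarrow> u < t \<Longrightarrow> black M (site ((turn ^^ u) x))"
    by blast
  have "\<not> black M (site j)" using j(2) black_sigma site_closed[OF x(1)] x(2) by simp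
  then have "nextIn turn (ingoing (closure r)) x = j"
    using C.nextIn_eqI[of t x] t by simp
  then show "nextIn turn (ingoing (closure r)) x \<in> blacks"
    "site (nextIn turn (ingoing (closure r)) x) = sigma M (site x)" using j by auto
qed

definition rank where "rank c = (THE n. run M (sigma M (site c)) (twin c) n)"

lemma rank_eq: "run M (sigma M (site c)) (twin c) n \<Longrightarrow> rank c = n"
  unfolding rank_def by (rule the_equality) (use run_unique in fast)+

text \<open>The run of a child is a proper part of the run of its parent, so run lengths increase
  strictly along \<open>par\<close>.\<close>

lemma closure_acyclic: "acyclic C.par"
proof -
  have "rank c < rank i" if ci: "(c, i) \<in> C.par" for c i
  proof -
    from ci obtain s where c: "c \<in> blacks" "\<not> black M (site c)" and i: "i \<in> blacks" "\<not> black M (site i)"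
      and s: "0 < s" "(turn ^^ s) i = twin c" "\<And>u. 0 < u \<Longrightarrow> u < s \<Longrightarrow> black M (site ((turn ^^ u) i))"
      unfolding C.par_def by auto
    obtain n where n: "run M (sigma M (site i)) (twin i) n"
      using mate_run[OF site_closed[OF i(1)] i(2)] mate_site[OF i(2)] by auto
    from white_rotate[OF i n] obtain j t where j: "j \<in> blacks" "site j = sigma M (site i)"
      and t: "0 < t" "(turn ^^ t) i = j"
      "\<And>u. 0 < u \<Longrightarrow> u \<le> t \<Longrightarrow> (let c = twin ((turn ^^ u) i) in
        \<not> black M (site c) \<longrightarrow> (\<exists>k<n. run M (sigma M (site c)) (twin c) k))"
      by blast
    have "\<not> black M (site j)" using j(2) black_sigma site_closed[OF i(1)] i(2) by simp
    \<comment> \<open>Position \<open>t\<close> holds an ingoing half-edge, whereas there is none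
      strictly between \<open>i\<close> and \<open>twin c\<close>; so \<open>twin c\<close> is met
      within the rotation.\<close>
    then have "s \<le> t" using s(3)[of t] t(1,2) by (meson not_less)
    then obtain k where "k < n" "run M (sigma M (site c)) (twin c) k"
      using t(3)[of s] s(1,2) twin_twin[OF c(1)] c(2) unfolding Let_def by auto
    then show ?thesis using rank_eq n by metis
  qed
  then have "C.par \<subseteq> measure rank" by auto
  then show ?thesis using wf_acyclic[OF wf_measure] acyclic_subset by blast
qed

lemma closure_map: "mobile_map (Phi0 (closure r)) M (\<lambda>x. case x of Bl h \<Rightarrow> h | Wh h \<Rightarrow> site h)"
  (is "mobile_map _ _ ?f")
proof (rule mobile_map.intro[OF C.Phi0_rotsys], unfold_locales)
  show "bij_betw ?f (darts (Phi0 (closure r))) (darts M)"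
    unfolding bij_betw_def
  proof
    show "inj_on ?f (darts (Phi0 (closure r)))"
    proof (rule inj_onI)
      fix x y assume "x \<in> darts (Phi0 (closure r))" "y \<in> darts (Phi0 (closure r))" "?f x = ?f y"
      then show "x = y"
        by (cases x; cases y) (auto intro: site_inj)
    qed
    show "?f ` darts (Phi0 (closure r)) = darts M"
    proof (intro equalityI subsetI)
      fix d assume d: "d \<in> darts M"
      show "d \<in> ?f ` darts (Phi0 (closure r))"
      proof (cases "black M d")
        case True
        then show ?thesis using d by (intro image_eqI[of _ _ "Bl d"]) simp_all
      next
        case False
        then obtain j where "j \<in> blacks" "site j = d" using site_surj[OF d] by blast
        then show ?thesis using False by (intro image_eqI[of _ _ "Wh j"]) simp_all
      qed
    next
      fix d assume "d \<in> ?f ` darts (Phi0 (closure r))"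
      then obtain x where "x \<in> darts (Phi0 (closure r))" "d = ?f x" by blast
      then show "d \<in> darts M" using site_closed by (cases x) auto
    qed
  qed
next
  fix d assume "d \<in> darts (Phi0 (closure r))"
  then show "alpha M (?f d) = ?f (alpha (Phi0 (closure r)) d)"
  proof (cases rule: C.Phi0_cases)
    case (black h)
    then have h: "h \<in> blacks" by simp
    then show ?thesis unfolding black
      by (cases h rule: twin_cases)
        (use h in \<open>simp_all add: C.Phi0_alpha_bud C.Phi0_alpha_1way C.Phi0_alpha_0way\<close>)
  next
    case (white h)
    then have h: "h \<in> blacks" "\<not> black M (site h)" by simp_all
    from h(1) show ?thesis unfolding white
      by (cases h rule: twin_cases)
        (use h in \<open>simp_all add: C.Phi0_alpha_Wh1 C.Phi0_alpha_Wh2 alpha_alpha\<close>)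
  qed
next
  fix d assume "d \<in> darts (Phi0 (closure r))"
  then show "sigma M (?f d) = ?f (sigma (Phi0 (closure r)) d)"
  proof (cases rule: C.Phi0_cases)
    case (black h)
    then have h: "h \<in> blacks" by simp
    have s: "sigma M h \<in> blacks" using h sigma_closed black_sigma by auto
    have "sigma (Phi0 (closure r)) (Bl (turn (twin (sigma M h)))) = Bl (twin (twin (sigma M h)))"
      using C.Phi0_sigma_Bl[of "twin (sigma M h)"] twin_closed[OF s] by simp
    then show ?thesis unfolding black turn_twin_sigma[OF h] twin_twin[OF s] by simp
  next
    case (white h)
    then show ?thesis using closure_nextIn[of h] by simp
  qed
next
  fix d assume "d \<in> darts (Phi0 (closure r))"
  then show "black M (?f d) = black (Phi0 (closure r)) d"
    by (cases rule: C.Phi0_cases) simp_all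
next
  fix d assume d: "d \<in> darts (Phi0 (closure r))" "alpha (Phi0 (closure r)) d \<noteq> d"
  then have nb: "d \<in> {d \<in> darts (Phi0 (closure r)). alpha (Phi0 (closure r)) d \<noteq> d}" by blast
  from d(1) show "mweight M (?f d) = mweight (Phi0 (closure r)) d"
  proof (cases rule: C.Phi0_cases)
    case (black h)
    then have "h \<in> blacks" "black M (site (twin h))" using nb unfolding C.Phi0_nonbuds by auto
    then show ?thesis using black twin_twin by simp
  qed simp
qed

end

theorem closure_source:
  obtains r where "inB0 (closure r)" "mobile_iso (Phi0 (closure r)) M"
proof -
  have "blacks \<noteq> {}"
  proof
    assume e: "blacks = {}"
    obtain d where d: "d \<in> darts M" using mobile unfolding is_mobile_def by blast
    then have "\<not> black M d" using e by blast
    then have "mate d \<in> blacks" using mate_bud[OF d] bud_black by blast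
    then show False using e by blast
  qed
  \<comment> \<open>The source is sought in the closure with a dummy root, since edges, rotation and
    directions are the same for every root, and is then made the root.\<close>
  obtain r where r: "r \<in> blacks" "\<And>d. d \<in> vertex (closure undefined) r \<Longrightarrow> black M (site d)"
  proof -
    interpret C: biori "closure undefined" by (rule closure_biori)
    show ?thesis using C.exists_source[OF closure_acyclic] \<open>blacks \<noteq> {}\<close> that by auto
  qed
  interpret C: biori "closure r" by (rule closure_biori)
  interpret f: mobile_map "Phi0 (closure r)" M "\<lambda>x. case x of Bl h \<Rightarrow> h | Wh h \<Rightarrow> site h"
    by (rule closure_map)
  interpret g: mobile_map M "Phi0 (closure r)" "inv_into (darts (Phi0 (closure r))) (\<lambda>x. case x of Bl h \<Rightarrow> h | Wh h \<Rightarrow> site h)"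
    by (rule f.map_inverse)
  have "inB0 (closure r)"
    by (rule C.inB0_of_Phi0[OF g.map_mobile(1)[OF mobile] closure_acyclic])
      (use r in \<open>simp_all add: vertex_def\<close>)
  then show ?thesis using that f.map_iso by blast
qed

end

text \<open>The closure keeps the type of the half-edges of the mobile, while the preimage is wanted
  over \<open>nat\<close>; a finite set of half-edges can be numbered beforehand.\<close>

lemma mobile_relabel:
  fixes M :: "'c mobile"
  assumes "is_mobile M"
  obtains M' :: "nat mobile" and \<psi> where "mobile_map M M' \<psi>"
proof -
  interpret rotsys M using assms by (rule rotsys_of_mobile)
  obtain e :: "'c \<Rightarrow> nat" where e: "inj_on e (darts M)"
    using finite_imp_inj_to_nat_seg[OF finite_darts] by blast
  let ?i = "inv_into (darts M) e"
  define M' :: "nat mobile" where "M' = \<lparr>darts = e ` darts M, alpha = e \<circ> alpha M \<circ> ?i,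
    sigma = e \<circ> sigma M \<circ> ?i, black = black M \<circ> ?i, mweight = mweight M \<circ> ?i\<rparr>"
  have "mobile_map M M' e"
    unfolding M'_def by unfold_locales (use e in \<open>simp_all add: bij_betw_def\<close>)
  then show ?thesis by (rule that)
qed

text \<open>The bijection is one of isomorphism classes. The equivalence in the middle makes the
  induced map both well defined and injective, across different carrier types; \<open>nat\<close> is
  large enough a carrier for every preimage, half-edge sets being finite.\<close>

theorem theorem32:
  shows "(\<forall>B :: 'a wbiori. inB0 B \<longrightarrow> is_mobile (Phi0 B) \<and> excess (Phi0 B) = 0)
    \<and> (\<forall>(B :: 'a wbiori) (B' :: 'b wbiori). inB0 B \<longrightarrow> inB0 B' \<longrightarrow>
          (mobile_iso (Phi0 B) (Phi0 B') \<longleftrightarrow> biori_iso B B'))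
    \<and> (\<forall>M :: 'c mobile. is_mobile M \<and> excess M = 0 \<longrightarrow>
          (\<exists>B :: nat wbiori. inB0 B \<and> mobile_iso (Phi0 B) M))"
proof (intro conjI allI impI)
  have bi: "biori B" if "inB0 B" for B :: "('d, 'e) wbiori_scheme"
    using that unfolding inB0_def by (intro biori_of_planemap) blast
  show "is_mobile (Phi0 B)" if "inB0 B" for B :: "'a wbiori"
    by (rule biori.Phi0_mobile_of_inB0) (use bi that in blast)+
  show "excess (Phi0 B) = 0" if "inB0 B" for B :: "'a wbiori"
    by (rule biori.Phi0_excess) (use bi that in blast)
  show "mobile_iso (Phi0 B) (Phi0 B') \<longleftrightarrow> biori_iso B B'" if "inB0 B" "inB0 B'"
    for B :: "'a wbiori" and B' :: "'b wbiori"
    using that biori_iso_of_mobile_iso mobile_iso_of_biori_iso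
      biori_of_planemap[of B] biori_of_planemap[of B'] unfolding inB0_def by blast
next
  fix M :: "'c mobile"
  assume M: "is_mobile M \<and> excess M = 0"
  then obtain M' :: "nat mobile" and \<psi> where "mobile_map M M' \<psi>" using mobile_relabel by blast
  then interpret A: mobile_map M M' \<psi> .
  interpret mobile0 M'
    by (intro mobile0.intro mobile0_axioms.intro A.map_rotsys) (use A.map_mobile M in simp_all)
  obtain r where r: "inB0 (closure r)" "mobile_iso (Phi0 (closure r)) M'" by (rule closure_source)
  interpret C: biori "closure r" by (rule closure_biori)
  obtain \<chi> where "mobile_map (Phi0 (closure r)) M' \<chi>" using mobile_mapE[OF C.Phi0_rotsys r(2)] .
  from mobile_map_trans[OF this A.map_inverse] have "mobile_iso (Phi0 (closure r)) M"
    by (rule mobile_map.map_iso)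
  then show "\<exists>B :: nat wbiori. inB0 B \<and> mobile_iso (Phi0 B) M" using r(1) by blast
qed

end
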